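(* (Legendre transformation for evolution contact dynamics.) Let $\mathcal{Q}$ be a smooth manifold, $\mathcal{M}=T^*\mathcal{Q}\times\mathbb{R}$ with contact form $\eta=dz-p_idq^i$, $H\mathcal{M}=\ker\eta$, and let $L:T\mathcal{Q}\times\mathbb{R}\to\mathbb{R}$, $L=L(q,\dot q,z)$, be an arbitrary smooth function. Let $E(q^i,\dot q^i,p_i,z)=p_i\dot q^i-L(q,\dot q,z)$ on $T\mathcal{Q}\times_{\mathcal{Q}}T^*\mathcal{Q}\times\mathbb{R}$ and let $\mathcal{S}_{-E}$ be the Lagrangian submanifold of $T^*\mathcal{M}$ generated by the Morse family $-E$ over $\mathcal{M}$, that is $$\mathcal{S}_{-E}=\Big\{\Big(q^i,p_i,z,-\tfrac{\partial E}{\partial q^i},-\tfrac{\partial E}{\partial p_i},-\tfrac{\partial E}{\partial z}\Big)\in T^*\mathcal{M}:\ \tfrac{\partial E}{\partial\dot q^i}=0\Big\}.$$ Then, with the symplectic diffeomorphisms $\alpha^0:H\mathcal{M}\times\mathbb{R}\to T^*(T\mathcal{Q}\times\mathbb{R})$ and $\beta^0:H\mathcal{M}\times\mathbb{R}\to T^*\mathcal{M}$ given in the context, $$(\beta^0)^{-1}(\mathcal{S}_{-E})=(\alpha^0)^{-1}(\mathrm{im}(dL)),$$ and, as a subset of $T\mathcal{M}\times\mathbb{R}$ with coordinates $(q^i,p_i,z,\dot q^i,\dot p_i,\dot z,u)$, this Lagrangian submanifold of $H\mathcal{M}\times\mathbb{R}$ is $$\Big\{\Big(q^i,\tfrac{\partial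 L}{\partial\dot q^i},z,\dot q^i,\tfrac{\partial L}{\partial z}\tfrac{\partial L}{\partial\dot q^i}+\tfrac{\partial L}{\partial q^i},\dot z,-\tfrac{\partial L}{\partial z}\Big):\ \dot z=\dot q^i\tfrac{\partial L}{\partial\dot q^i}\Big\}.$$
   Context: Coordinates: $(q^i,p_i,z)$ on $\mathcal{M}=T^*\mathcal{Q}\times\mathbb{R}$, induced coordinates $(q^i,p_i,z,\dot q^i,\dot p_i,\dot z,u)$ on $T\mathcal{M}\times\mathbb{R}$; the submanifold $H\mathcal{M}\times\mathbb{R}$ is $\{\dot z=p_i\dot q^i\}$ with coordinates $(q^i,p_i,z,\dot q^i,\dot p_i,u)$. Coordinates on $T^*(T\mathcal{Q}\times\mathbb{R})$ are $(q^i,\dot q^i,z)$ followed by the momenta conjugate to $q^i,\dot q^i,z$; coordinates on $T^*\mathcal{M}$ are $(q^i,p_i,z)$ followed by the momenta conjugate to $q^i,p_i,z$. The symplectic form on $H\mathcal{M}\times\mathbb{R}$ is $\omega_\eta=d\theta_\eta$ with $\theta_\eta=u\,dz-(\dot p_i+up_i)dq^i+\dot q^idp_i$ (the restriction to $H\mathcal{M}\times\mathbb{R}$ of $u\,\eta^V+\eta^C=d\dot z+u\,dz-(\dot p_i+up_i)dq^i-p_id\dot q^i$, the sum of $u$ times the vertical lift and the complete lift of $\eta$). Cotangent bundles carry the canonical symplectic form $-d\theta$, $\theta$ the Liouville one-form. The globally defined symplectic diffeomorphisms are $$\alpha^0(q^i,p_i,z,\dot q^i,\dot p_i,u)=(q^i,\dot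 q^i,z,up_i+\dot p_i,p_i,-u),$$ $$\beta^0(V,u)=-\iota_Vd\eta-u\,\eta,\qquad \beta^0(q^i,p_i,z,\dot q^i,\dot p_i,u)=(q^i,p_i,z,up_i+\dot p_i,-\dot q^i,-u).$$ *)

theory Defs
  imports "HOL-Analysis.Analysis"
begin

section \<open>Smooth maps between Euclidean spaces\<close>

text \<open>
  For an open set \<open>S\<close>, \<open>Ck_on k S f\<close> says that \<open>f\<close> is of class \<open>C^k\<close> on \<open>S\<close>.
\<close>

primrec Ck_on :: "nat \<Rightarrow> 'a::euclidean_space set \<Rightarrow> ('a \<Rightarrow> 'b::real_normed_vector) \<Rightarrow> bool" where
  "Ck_on 0 S f \<longleftrightarrow> continuous_on S f"
| "Ck_on (Suc k) S f \<longleftrightarrow>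
     (\<forall>x\<in>S. f differentiable (at x)) \<and> (\<forall>v. Ck_on k S (\<lambda>x. frechet_derivative f (at x) v))"

definition smooth_on :: "'a::euclidean_space set \<Rightarrow> ('a \<Rightarrow> 'b::real_normed_vector) \<Rightarrow> bool" where
  "smooth_on S f \<longleftrightarrow> (\<forall>k. Ck_on k S f)"


section \<open>Smooth manifolds\<close>

text \<open>
  A manifold is given by a smooth atlas; its points are the points covered by the charts, and
  its topology is the one induced by the atlas. The values of \<open>cmap c\<close> outside \<open>cdom c\<close> are
  irrelevant.
\<close>

datatype ('a, 'e) chart = Chart (cdom: "'a set") (cmap: "'a \<Rightarrow> 'e")

definition cinv :: "('a, 'e) chart \<Rightarrow> 'e \<Rightarrow> 'a" where
  "cinv c = inv_into (cdom c) (cmap c)"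

definition carrier :: "('a, 'e) chart set \<Rightarrow> 'a set" where
  "carrier B = (\<Union>c\<in>B. cdom c)"

definition transition :: "('a, 'e) chart \<Rightarrow> ('a, 'e) chart \<Rightarrow> 'e \<Rightarrow> 'e" where
  "transition c c' = cmap c' \<circ> cinv c"

definition smooth_atlas :: "('a, 'e::euclidean_space) chart set \<Rightarrow> bool" where
  "smooth_atlas B \<longleftrightarrow>
     (\<forall>c\<in>B. inj_on (cmap c) (cdom c) \<and> open (cmap c ` cdom c)) \<and>
     (\<forall>c\<in>B. \<forall>c'\<in>B. open (cmap c ` (cdom c \<inter> cdom c')) \<and>
        smooth_on (cmap c ` (cdom c \<inter> cdom c')) (transition c c'))"

definition manifold_topology :: "('a, 'e::euclidean_space) chart set \<Rightarrow> 'a topology" where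
  "manifold_topology B =
     topology (\<lambda>W. W \<subseteq> carrier B \<and> (\<forall>c\<in>B. open (cmap c ` (cdom c \<inter> W))))"

definition smooth_manifold :: "('a, 'e::euclidean_space) chart set \<Rightarrow> bool" where
  "smooth_manifold B \<longleftrightarrow> smooth_atlas B \<and>
     Hausdorff_space (manifold_topology B) \<and> second_countable (manifold_topology B)"

definition smooth_function :: "('a, 'e::euclidean_space) chart set \<Rightarrow> ('a \<Rightarrow> real) \<Rightarrow> bool" where
  "smooth_function B F \<longleftrightarrow> (\<forall>c\<in>B. smooth_on (cmap c ` cdom c) (F \<circ> cinv c))"

text \<open>
  The product of a manifold with the real line.
\<close>

definition prodR_chart :: "('a, 'e) chart \<Rightarrow> ('a \<times> real, 'e \<times> real) chart" where
  "prodR_chart c = Chart (cdom c \<times> UNIV) (\<lambda>(x, z). (cmap c x, z))"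

definition prodR :: "('a, 'e) chart set \<Rightarrow> ('a \<times> real, 'e \<times> real) chart set" where
  "prodR B = prodR_chart ` B"

text \<open>
  For a manifold \<open>A\<close> and a rule \<open>\<Lambda>\<close> turning each chart of \<open>A\<close> into a chart of another manifold
  over \<open>A\<close> (``induced coordinates''), this is the point over \<open>q\<close> whose coordinates are
  \<open>f c\<close> in the chart \<open>\<Lambda> c\<close>, for all charts \<open>c\<close> around \<open>q\<close> at once.
\<close>

definition point_by_coords ::
    "('q, 'e) chart set \<Rightarrow> (('q, 'e) chart \<Rightarrow> ('y, 'f) chart) \<Rightarrow> 'q \<Rightarrow> (('q, 'e) chart \<Rightarrow> 'f) \<Rightarrow> 'y"
  where
  "point_by_coords A \<Lambda> q f =
     (THE y. \<forall>c\<in>A. q \<in> cdom c \<longrightarrow> y \<in> cdom (\<Lambda> c) \<and> cmap (\<Lambda> c) y = f c)"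


section \<open>Tangent and cotangent bundles\<close>

text \<open>
  A tangent vector at \<open>x\<close> is the family of its component vectors in the charts around \<open>x\<close>,
  which transform by the derivatives of the transition maps. A covector is likewise the family of
  its components; the model space is identified with its dual by the inner product, so that the
  components of covectors transform contragrediently. Families are set to zero on all other
  arguments, which makes the representation unique.
\<close>

type_synonym ('a, 'e) bundle_point = "'a \<times> (('a, 'e) chart \<Rightarrow> 'e)"

definition jacobian ::
    "('a, 'e::euclidean_space) chart \<Rightarrow> ('a, 'e) chart \<Rightarrow> 'a \<Rightarrow> 'e \<Rightarrow> 'e" where
  "jacobian c c' x = frechet_derivative (transition c c') (at (cmap c x))"

definition tangent_set :: "('a, 'e::euclidean_space) chart set \<Rightarrow> ('a, 'e) bundle_point set" where
  "tangent_set B = {(x, v). x \<in> carrier B \<and>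
     (\<forall>c. \<not> (c \<in> B \<and> x \<in> cdom c) \<longrightarrow> v c = 0) \<and>
     (\<forall>c\<in>B. \<forall>c'\<in>B. x \<in> cdom c \<inter> cdom c' \<longrightarrow> v c' = jacobian c c' x (v c))}"

definition cotangent_set :: "('a, 'e::euclidean_space) chart set \<Rightarrow> ('a, 'e) bundle_point set" where
  "cotangent_set B = {(x, \<xi>). x \<in> carrier B \<and>
     (\<forall>c. \<not> (c \<in> B \<and> x \<in> cdom c) \<longrightarrow> \<xi> c = 0) \<and>
     (\<forall>c\<in>B. \<forall>c'\<in>B. x \<in> cdom c \<inter> cdom c' \<longrightarrow> (\<forall>w. \<xi> c \<bullet> w = \<xi> c' \<bullet> jacobian c c' x w))}"

definition tangent_chart ::
    "('a, 'e::euclidean_space) chart set \<Rightarrow> ('a, 'e) chart \<Rightarrow> (('a, 'e) bundle_point, 'e \<times> 'e) chart"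
  where
  "tangent_chart B c =
     Chart {(x, v). (x, v) \<in> tangent_set B \<and> x \<in> cdom c} (\<lambda>(x, v). (cmap c x, v c))"

definition cotangent_chart ::
    "('a, 'e::euclidean_space) chart set \<Rightarrow> ('a, 'e) chart \<Rightarrow> (('a, 'e) bundle_point, 'e \<times> 'e) chart"
  where
  "cotangent_chart B c =
     Chart {(x, \<xi>). (x, \<xi>) \<in> cotangent_set B \<and> x \<in> cdom c} (\<lambda>(x, \<xi>). (cmap c x, \<xi> c))"

definition tangent_bundle ::
    "('a, 'e::euclidean_space) chart set \<Rightarrow> (('a, 'e) bundle_point, 'e \<times> 'e) chart set" where
  "tangent_bundle B = tangent_chart B ` B"

definition cotangent_bundle ::
    "('a, 'e::euclidean_space) chart set \<Rightarrow> (('a, 'e) bundle_point, 'e \<times> 'e) chart set" where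
  "cotangent_bundle B = cotangent_chart B ` B"

text \<open>
  The value of the covector \<open>y\<close> on the tangent vector \<open>v\<close> (at the same base point).
\<close>

definition pairing ::
    "('a, 'e::euclidean_space) chart set \<Rightarrow> ('a, 'e) bundle_point \<Rightarrow> ('a, 'e) bundle_point \<Rightarrow> real"
  where
  "pairing B y v = (THE r. \<forall>c\<in>B. fst v \<in> cdom c \<longrightarrow> snd y c \<bullet> snd v c = r)"

text \<open>
  The image of the differential \<open>dF\<close> of a function, as a section of the cotangent bundle.
\<close>

definition im_d ::
    "('a, 'e::euclidean_space) chart set \<Rightarrow> ('a \<Rightarrow> real) \<Rightarrow> ('a, 'e) bundle_point set" where
  "im_d B F = {(x, \<xi>). (x, \<xi>) \<in> cotangent_set B \<and>
     (\<forall>c\<in>B. x \<in> cdom c \<longrightarrow> (GDERIV (F \<circ> cinv c) (cmap c x) :> \<xi> c))}"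

text \<open>
  One-forms are sections \<open>x \<mapsto> (x, \<sigma>\<^sub>x)\<close> of the cotangent bundle. With
  \<open>\<sigma> = \<sigma>\<^sub>i dx\<^sup>i\<close>, the value of \<open>d\<sigma> = d\<sigma>\<^sub>i \<and> dx\<^sup>i\<close> on two tangent vectors at the same point is
  \<open>d\<sigma>\<^sub>i(v) w\<^sup>i - d\<sigma>\<^sub>i(w) v\<^sup>i\<close>.
\<close>

definition ext_d ::
    "('a, 'e::euclidean_space) chart set \<Rightarrow> ('a \<Rightarrow> ('a, 'e) bundle_point)
      \<Rightarrow> ('a, 'e) bundle_point \<Rightarrow> ('a, 'e) bundle_point \<Rightarrow> real" where
  "ext_d B \<sigma> v w = (THE r. \<forall>c\<in>B. fst v \<in> cdom c \<longrightarrow>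
     (let D = frechet_derivative (\<lambda>y. snd (\<sigma> (cinv c y)) c) (at (cmap c (fst v)))
      in D (snd v c) \<bullet> snd w c - D (snd w c) \<bullet> snd v c = r))"


section \<open>Lagrangian submanifolds\<close>

text \<open>
  Embedded submanifolds of dimension \<open>k\<close>: in a neighbourhood of each of its points, \<open>S\<close> is
  straightened to a \<open>k\<close>-dimensional linear subspace by a diffeomorphism \<open>\<Psi>\<close> between open sets.
\<close>

definition embedded_submanifold ::
    "('a, 'e::euclidean_space) chart set \<Rightarrow> nat \<Rightarrow> 'a set \<Rightarrow> bool" where
  "embedded_submanifold B k S \<longleftrightarrow> S \<subseteq> carrier B \<and>
     (\<forall>x\<in>S. \<exists>c\<in>B. x \<in> cdom c \<and>
        (\<exists>W (\<Psi> :: 'e \<Rightarrow> 'e) \<Psi>' K.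
           open W \<and> cmap c x \<in> W \<and> W \<subseteq> cmap c ` cdom c \<and> open (\<Psi> ` W) \<and>
           smooth_on W \<Psi> \<and> smooth_on (\<Psi> ` W) \<Psi>' \<and> (\<forall>y\<in>W. \<Psi>' (\<Psi> y) = y) \<and>
           subspace K \<and> dim K = k \<and>
           \<Psi> ` (W \<inter> cmap c ` (S \<inter> cdom c)) = \<Psi> ` W \<inter> K))"

text \<open>
  Tangent vectors to \<open>S\<close>: the velocities of smooth curves contained in \<open>S\<close>.
\<close>

definition tangent_to ::
    "('a, 'e::euclidean_space) chart set \<Rightarrow> 'a set \<Rightarrow> 'a \<Rightarrow> ('a, 'e) bundle_point set" where
  "tangent_to B S x = {(x', v). x' = x \<and> (x, v) \<in> tangent_set B \<and>
     (\<exists>c\<in>B. \<exists>\<epsilon>>0. \<exists>\<gamma> :: real \<Rightarrow> 'a.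
        \<gamma> 0 = x \<and> \<gamma> ` {-\<epsilon><..<\<epsilon>} \<subseteq> S \<inter> cdom c \<and> smooth_on {-\<epsilon><..<\<epsilon>} (cmap c \<circ> \<gamma>) \<and>
        ((cmap c \<circ> \<gamma>) has_vector_derivative v c) (at 0))}"

definition lagrangian_submanifold ::
    "('a, 'e::euclidean_space) chart set
      \<Rightarrow> (('a, 'e) bundle_point \<Rightarrow> ('a, 'e) bundle_point \<Rightarrow> real) \<Rightarrow> 'a set \<Rightarrow> bool" where
  "lagrangian_submanifold B \<omega> S \<longleftrightarrow>
     (\<exists>k. 2 * k = DIM('e) \<and> embedded_submanifold B k S) \<and>
     (\<forall>x\<in>S. \<forall>v\<in>tangent_to B S x. \<forall>w\<in>tangent_to B S x. \<omega> v w = 0)"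


section \<open>The manifolds built from the configuration manifold\<close>

text \<open>
  \<open>TQR\<close> is \<open>TQ \<times> \<real>\<close> with coordinates \<open>((q, q'), z)\<close>; \<open>contactM\<close> is \<open>M = T*Q \<times> \<real>\<close>
  with coordinates \<open>((q, p), z)\<close>; \<open>TMR\<close> is \<open>TM \<times> \<real>\<close> with coordinates
  \<open>((((q, p), z), ((q', p'), z')), u)\<close>, where a prime stands for a dot.
\<close>

type_synonym ('q, 'e) TQR_pt = "('q, 'e) bundle_point \<times> real"
type_synonym ('q, 'e) M_pt = "('q, 'e) bundle_point \<times> real"
type_synonym ('q, 'e) TM_pt = "(('q, 'e) M_pt, ('e \<times> 'e) \<times> real) bundle_point"
type_synonym ('q, 'e) TMR_pt = "('q, 'e) TM_pt \<times> real"
type_synonym ('q, 'e) CTM_pt = "(('q, 'e) M_pt, ('e \<times> 'e) \<times> real) bundle_point"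
type_synonym ('q, 'e) CTQR_pt = "(('q, 'e) TQR_pt, ('e \<times> 'e) \<times> real) bundle_point"

definition TQR_chart ::
    "('q, 'e::euclidean_space) chart set \<Rightarrow> ('q, 'e) chart
      \<Rightarrow> (('q, 'e) TQR_pt, ('e \<times> 'e) \<times> real) chart" where
  "TQR_chart A c = prodR_chart (tangent_chart A c)"

definition TQR ::
    "('q, 'e::euclidean_space) chart set \<Rightarrow> (('q, 'e) TQR_pt, ('e \<times> 'e) \<times> real) chart set" where
  "TQR A = prodR (tangent_bundle A)"

definition M_chart ::
    "('q, 'e::euclidean_space) chart set \<Rightarrow> ('q, 'e) chart
      \<Rightarrow> (('q, 'e) M_pt, ('e \<times> 'e) \<times> real) chart" where
  "M_chart A c = prodR_chart (cotangent_chart A c)"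

definition contactM ::
    "('q, 'e::euclidean_space) chart set \<Rightarrow> (('q, 'e) M_pt, ('e \<times> 'e) \<times> real) chart set" where
  "contactM A = prodR (cotangent_bundle A)"

definition TMR_chart ::
    "('q, 'e::euclidean_space) chart set \<Rightarrow> ('q, 'e) chart
      \<Rightarrow> (('q, 'e) TMR_pt, ((('e \<times> 'e) \<times> real) \<times> (('e \<times> 'e) \<times> real)) \<times> real) chart" where
  "TMR_chart A c = prodR_chart (tangent_chart (contactM A) (M_chart A c))"

text \<open>
  The contact form \<open>\<eta> = dz - p\<^sub>i dq\<^sup>i\<close>.
\<close>

definition eta :: "('q, 'e::euclidean_space) chart set \<Rightarrow> ('q, 'e) M_pt \<Rightarrow> ('q, 'e) CTM_pt" where
  "eta A m = point_by_coords A (\<lambda>c. cotangent_chart (contactM A) (M_chart A c)) (fst (fst m))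
     (\<lambda>c. case cmap (M_chart A c) m of ((x, p), z) \<Rightarrow> (((x, p), z), ((-p, 0), 1)))"

definition HM_set :: "('q, 'e::euclidean_space) chart set \<Rightarrow> ('q, 'e) TM_pt set" where
  "HM_set A = {(m, V). (m, V) \<in> tangent_set (contactM A) \<and>
     pairing (contactM A) (eta A m) (m, V) = 0}"

text \<open>
  \<open>HM \<times> \<real>\<close> as a manifold with coordinates \<open>(q, p, z, q', p', u)\<close>. Its points are the points
  of \<open>TM \<times> \<real>\<close> that lie in \<open>HM \<times> \<real>\<close>.
\<close>

definition HMR_chart ::
    "('q, 'e::euclidean_space) chart set \<Rightarrow> ('q, 'e) chart
      \<Rightarrow> (('q, 'e) TMR_pt, 'e \<times> 'e \<times> real \<times> 'e \<times> 'e \<times> real) chart" where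
  "HMR_chart A c =
     Chart {((m, V), u). (m, V) \<in> HM_set A \<and> m \<in> cdom (M_chart A c)}
       (\<lambda>w. case cmap (TMR_chart A c) w of
          ((((x, p), z), ((xd, pd), zd)), u) \<Rightarrow> (x, p, z, xd, pd, u))"

definition HMR ::
    "('q, 'e::euclidean_space) chart set
      \<Rightarrow> (('q, 'e) TMR_pt, 'e \<times> 'e \<times> real \<times> 'e \<times> 'e \<times> real) chart set" where
  "HMR A = HMR_chart A ` A"

definition base_point :: "('q, 'e) TMR_pt \<Rightarrow> 'q" where
  "base_point w = (case w of ((((q, \<xi>), z), V), u) \<Rightarrow> q)"

text \<open>
  The symplectic form \<open>\<omega>\<^sub>\<eta> = d\<theta>\<^sub>\<eta>\<close> with \<open>\<theta>\<^sub>\<eta> = u dz - (p'\<^sub>i + u p\<^sub>i) dq\<^sup>i + q'\<^sup>i dp\<^sub>i\<close>.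
\<close>

definition theta_eta ::
    "('q, 'e::euclidean_space) chart set \<Rightarrow> ('q, 'e) TMR_pt
      \<Rightarrow> (('q, 'e) TMR_pt, 'e \<times> 'e \<times> real \<times> 'e \<times> 'e \<times> real) bundle_point" where
  "theta_eta A w = point_by_coords A (\<lambda>c. cotangent_chart (HMR A) (HMR_chart A c)) (base_point w)
     (\<lambda>c. case cmap (HMR_chart A c) w of (x, p, z, xd, pd, u) \<Rightarrow>
        ((x, p, z, xd, pd, u), (- (pd + u *\<^sub>R p), xd, u, 0, 0, 0)))"

definition omega_eta ::
    "('q, 'e::euclidean_space) chart set
      \<Rightarrow> (('q, 'e) TMR_pt, 'e \<times> 'e \<times> real \<times> 'e \<times> 'e \<times> real) bundle_point
      \<Rightarrow> (('q, 'e) TMR_pt, 'e \<times> 'e \<times> real \<times> 'e \<times> 'e \<times> real) bundle_point \<Rightarrow> real" where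
  "omega_eta A = ext_d (HMR A) (theta_eta A)"


section \<open>The maps to the cotangent bundles\<close>

definition alpha0 ::
    "('q, 'e::euclidean_space) chart set \<Rightarrow> ('q, 'e) TMR_pt \<Rightarrow> ('q, 'e) CTQR_pt" where
  "alpha0 A w = point_by_coords A (\<lambda>c. cotangent_chart (TQR A) (TQR_chart A c)) (base_point w)
     (\<lambda>c. case cmap (HMR_chart A c) w of (x, p, z, xd, pd, u) \<Rightarrow>
        (((x, xd), z), ((u *\<^sub>R p + pd, p), - u)))"

text \<open>
  \<open>\<beta>\<^sup>0(V, u) = - \<iota>\<^sub>V d\<eta> - u \<eta>\<close>, where \<open>V\<close> is a tangent vector at \<open>m \<in> M\<close>.
\<close>

definition beta0 ::
    "('q, 'e::euclidean_space) chart set \<Rightarrow> ('q, 'e) TMR_pt \<Rightarrow> ('q, 'e) CTM_pt" where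
  "beta0 A w = (case w of ((m, V), u) \<Rightarrow>
     (THE y. y \<in> cotangent_set (contactM A) \<and> fst y = m \<and>
        (\<forall>W. (m, W) \<in> tangent_set (contactM A) \<longrightarrow>
           pairing (contactM A) y (m, W) =
             - ext_d (contactM A) (eta A) (m, V) (m, W)
             - u * pairing (contactM A) (eta A m) (m, W))))"


section \<open>The Morse family\<close>

text \<open>
  The manifold \<open>TQ \<times>\<^sub>Q T*Q \<times> \<real>\<close>, with points \<open>(q, v, \<xi>, z)\<close> and coordinates
  \<open>(q, q', p, z)\<close>; it fibres over \<open>M\<close> with fibre coordinate \<open>q'\<close>.
\<close>

type_synonym ('q, 'e) whitney_pt =
  "'q \<times> (('q, 'e) chart \<Rightarrow> 'e) \<times> (('q, 'e) chart \<Rightarrow> 'e) \<times> real"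

definition whitney_chart ::
    "('q, 'e::euclidean_space) chart set \<Rightarrow> ('q, 'e) chart
      \<Rightarrow> (('q, 'e) whitney_pt, 'e \<times> 'e \<times> 'e \<times> real) chart" where
  "whitney_chart A c =
     Chart {(q, v, \<xi>, z). (q, v) \<in> tangent_set A \<and> (q, \<xi>) \<in> cotangent_set A \<and> q \<in> cdom c}
       (\<lambda>(q, v, \<xi>, z). (cmap c q, v c, \<xi> c, z))"

definition energy ::
    "('q, 'e::euclidean_space) chart set \<Rightarrow> (('q, 'e) TQR_pt \<Rightarrow> real) \<Rightarrow> ('q, 'e) whitney_pt \<Rightarrow> real"
  where
  "energy A L b = (case b of (q, v, \<xi>, z) \<Rightarrow> pairing A (q, \<xi>) (q, v) - L ((q, v), z))"

text \<open>
  The subset of \<open>T*M\<close> generated by a family \<open>F(q, q', p, z)\<close> over \<open>M\<close>: the covectors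
  \<open>(q, p, z, \<partial>F/\<partial>q, \<partial>F/\<partial>p, \<partial>F/\<partial>z)\<close> for which \<open>\<partial>F/\<partial>q' = 0\<close>.
\<close>

definition generated_set ::
    "('q, 'e::euclidean_space) chart set \<Rightarrow> (('q, 'e) whitney_pt \<Rightarrow> real) \<Rightarrow> ('q, 'e) CTM_pt set"
  where
  "generated_set A F = {(((q, \<xi>), z), \<zeta>). (((q, \<xi>), z), \<zeta>) \<in> cotangent_set (contactM A) \<and>
     (\<exists>v. (q, v) \<in> tangent_set A \<and>
       (\<forall>c\<in>A. q \<in> cdom c \<longrightarrow>
         (\<exists>Fq Fp Fz.
            (GDERIV (F \<circ> cinv (whitney_chart A c)) (cmap c q, v c, \<xi> c, z) :> (Fq, 0, Fp, Fz)) \<and>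
            cmap (cotangent_chart (contactM A) (M_chart A c)) (((q, \<xi>), z), \<zeta>)
              = (((cmap c q, \<xi> c), z), ((Fq, Fp), Fz)))))}"

end

theory Submission
  imports Defs
begin

text \<open>
  Fix a chart of \<open>Q\<close> and let \<open>w\<close> be a point of \<open>HM \<times> \<real>\<close> with coordinates \<open>(q, p, z, q', p', u)\<close>.
  Both inverse images are cut out by one and the same condition (\<open>legendre_at\<close>): at \<open>(q, q', z)\<close>,
  \<open>dL = (u p\<^sub>i + p'\<^sub>i) dq\<^sup>i + p\<^sub>i dq'\<^sup>i - u dz\<close>. For \<open>\<alpha>\<^sup>0\<close> this is what membership of \<open>\<alpha>\<^sup>0(w)\<close>
  in the image of \<open>dL\<close> means (\<open>alpha0_in_im_d_iff\<close>). For \<open>\<beta>\<^sup>0\<close>, the family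
  \<open>-E = L - p\<^sub>i v\<^sup>i\<close> has partial derivatives \<open>(\<partial>L/\<partial>q, \<partial>L/\<partial>v - p, -v, \<partial>L/\<partial>z)\<close> in \<open>(q, v, p, z)\<close>, while
  \<open>\<beta>\<^sup>0(w)\<close> has momenta \<open>(u p + p', -q', -u)\<close>; hence \<open>v = q'\<close>, criticality in \<open>v\<close> gives the
  middle term of the condition, and the \<open>q\<close> and \<open>z\<close> momenta give the other two
  (\<open>beta0_in_generated_set_iff\<close>).

  Solved for \<open>p\<close>, \<open>u\<close> and \<open>p'\<close>, the condition reads \<open>p = \<partial>L/\<partial>q'\<close>, \<open>u = -\<partial>L/\<partial>z\<close>,
  \<open>p' = \<partial>L/\<partial>z \<partial>L/\<partial>q' + \<partial>L/\<partial>q\<close>. This is the asserted parametrization, and it exhibits the set as a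
  graph over \<open>(q, q', z)\<close>, hence as an embedded submanifold of half the dimension
  (\<open>submanifold_embedded\<close>). Along this graph \<open>\<theta>\<^sub>\<eta> = u dz - (p'\<^sub>i + u p\<^sub>i) dq\<^sup>i + q'\<^sup>i dp\<^sub>i\<close> is the
  differential of \<open>q'\<^sup>i p\<^sub>i - L\<close>, so \<open>\<omega>\<^sub>\<eta>\<close> vanishes on it; pointwise this is the symmetry of the Hessian
  of \<open>L\<close> (\<open>submanifold_isotropic\<close>).

  The remaining work is to justify computing in one chart, since forms, maps and sets are specified
  by their coordinates in all charts at once. A change of chart \<open>\<phi>\<close> of \<open>Q\<close> acts on velocities by
  \<open>D\<phi>\<close> and on momenta by the inverse transpose, so the induced changes of chart have Jacobians that
  involve the second derivative of \<open>\<phi>\<close> (\<open>jacobian_M_chart\<close>, \<open>jacobian_TQR_chart\<close>). In \<open>\<theta>\<^sub>\<eta>\<close>, in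
  \<open>\<alpha>\<^sup>0\<close> and in every exterior derivative these terms come in pairs that cancel because the second
  derivative is symmetric (\<open>D2_symmetric\<close>, \<open>ext_d_eq\<close>).
\<close>


section \<open>Calculus of smooth maps\<close>

lemma Ck_on_cong:
  assumes "open S" "\<And>x. x \<in> S \<Longrightarrow> f x = g x" "Ck_on k S f"
  shows "Ck_on k S g"
  using assms(2,3)
proof (induction k arbitrary: f g)
  case 0
  then show ?case using continuous_on_cong by fastforce
next
  case (Suc k)
  have D: "(g has_derivative frechet_derivative f (at x)) (at x)" if "x \<in> S" for x
    using Suc.prems \<open>open S\<close> that
    by (metis Ck_on.simps(2) frechet_derivative_works has_derivative_transform_within_open)
  have "Ck_on k S (\<lambda>x. frechet_derivative g (at x) v)" for v
  proof (rule Suc.IH)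
    show "frechet_derivative f (at x) v = frechet_derivative g (at x) v" if "x \<in> S" for x
      using frechet_derivative_at[OF D[OF that]] by simp
  qed (use Suc.prems(2) in simp)
  with D show ?case by (auto simp: differentiable_def)
qed

lemma Ck_on_has_derivativeI:
  assumes "open S" "\<And>x. x \<in> S \<Longrightarrow> (f has_derivative f' x) (at x)" "\<And>v. Ck_on k S (\<lambda>x. f' x v)"
  shows "Ck_on (Suc k) S f"
proof -
  have "f' x = frechet_derivative f (at x)" if "x \<in> S" for x
    by (rule frechet_derivative_at[OF assms(2)[OF that]])
  then have "Ck_on k S (\<lambda>x. frechet_derivative f (at x) v)" for v
    by (intro Ck_on_cong[OF assms(1) _ assms(3)[of v]]) simp
  then show ?thesis using assms(2) by (auto simp: differentiable_def)
qed

lemma Ck_on_Suc_D: "Ck_on (Suc k) S f \<Longrightarrow> Ck_on k S f"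
proof (induction k arbitrary: f)
  case 0
  then show ?case
    by (simp add: continuous_at_imp_continuous_on differentiable_imp_continuous_within)
next
  case (Suc k)
  then show ?case by (metis Ck_on.simps(2))
qed

lemma Ck_on_const: "Ck_on k S (\<lambda>x. c)"
  by (induction k arbitrary: c) auto

lemma Ck_on_has_derivative:
  "Ck_on (Suc k) S f \<Longrightarrow> x \<in> S \<Longrightarrow> (f has_derivative frechet_derivative f (at x)) (at x)"
  by (simp add: frechet_derivative_works)

lemma Ck_on_linear:
  assumes "open S" "bounded_linear h"
  shows "Ck_on k S h"
proof (cases k)
  case 0
  then show ?thesis using assms by (simp add: linear_continuous_on)
next
  case (Suc j)
  show ?thesis unfolding Suc
    by (rule Ck_on_has_derivativeI[OF assms(1) bounded_linear_imp_has_derivative[OF assms(2)]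
          Ck_on_const])
qed

lemma Ck_on_linear_compose:
  assumes "open S" "bounded_linear h" "Ck_on k S f"
  shows "Ck_on k S (\<lambda>x. h (f x))"
  using assms(3)
proof (induction k arbitrary: f)
  case 0
  then show ?case using assms(2)
    by (simp add: bounded_linear.continuous_on)
next
  case (Suc k)
  show ?case
  proof (rule Ck_on_has_derivativeI[OF assms(1)])
    show "((\<lambda>x. h (f x)) has_derivative (\<lambda>v. h (frechet_derivative f (at x) v))) (at x)"
      if "x \<in> S" for x
      using bounded_linear.has_derivative[OF assms(2) Ck_on_has_derivative[OF Suc.prems that]] .
  qed (use Suc \<open>open S\<close> in auto)
qed

lemma Ck_on_add:
  assumes "open S" "Ck_on k S f" "Ck_on k S g"
  shows "Ck_on k S (\<lambda>x. f x + g x)"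
  using assms(2,3)
proof (induction k arbitrary: f g)
  case 0
  then show ?case by (simp add: continuous_on_add)
next
  case (Suc k)
  show ?case
    by (rule Ck_on_has_derivativeI[OF assms(1) has_derivative_add[OF
          Ck_on_has_derivative[OF Suc.prems(1)] Ck_on_has_derivative[OF Suc.prems(2)]]])
       (use Suc in auto)
qed

lemma Ck_on_bilinear:
  assumes "open S" "bounded_bilinear pr" "Ck_on k S f" "Ck_on k S g"
  shows "Ck_on k S (\<lambda>x. pr (f x) (g x))"
  using assms(3,4)
proof (induction k arbitrary: f g)
  case 0
  then show ?case using bounded_bilinear.continuous_on[OF assms(2)] by simp
next
  case (Suc k)
  show ?case
  proof (rule Ck_on_has_derivativeI[OF assms(1)])
    show "((\<lambda>x. pr (f x) (g x)) has_derivative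
        (\<lambda>v. pr (f x) (frechet_derivative g (at x) v) + pr (frechet_derivative f (at x) v) (g x))) (at x)"
      if "x \<in> S" for x
      using bounded_bilinear.FDERIV[OF assms(2) Ck_on_has_derivative[OF Suc.prems(1) that]
          Ck_on_has_derivative[OF Suc.prems(2) that]] .
  qed (use Suc Ck_on_Suc_D[OF Suc.prems(1)] Ck_on_Suc_D[OF Suc.prems(2)] \<open>open S\<close>
      in \<open>auto intro!: Ck_on_add\<close>)
qed

lemma Ck_on_sum:
  assumes "open S" "\<And>i. i \<in> I \<Longrightarrow> Ck_on k S (f i)"
  shows "Ck_on k S (\<lambda>x. \<Sum>i\<in>I. f i x)"
  using assms(2)
  by (induction I rule: infinite_finite_induct) (auto intro!: Ck_on_add Ck_on_const assms(1))

lemma linear_eq_sum_Basis: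
  fixes D :: "'a::euclidean_space \<Rightarrow> 'b::real_vector"
  assumes "linear D"
  shows "D v = (\<Sum>b\<in>Basis. (v \<bullet> b) *\<^sub>R D b)"
  by (metis (no_types, lifting) assms euclidean_representation linear_scale linear_sum sum.cong)

text \<open>
  The chain rule writes the directional derivative of a composition as a sum, over a basis, of
  products of maps of the same class; this is what makes the induction on the order go through.
\<close>

lemma Ck_on_compose:
  fixes f :: "'a::euclidean_space \<Rightarrow> 'b::euclidean_space"
  assumes "open S" "open T" "Ck_on k S f" "Ck_on k T g" "f ` S \<subseteq> T"
  shows "Ck_on k S (\<lambda>x. g (f x))"
  using assms(3,4)
proof (induction k arbitrary: g)
  case 0
  then show ?case using assms(5)
    by (simp add: continuous_on_compose2)
next
  case (Suc k)
  let ?D = "\<lambda>x v. \<Sum>b\<in>Basis. (frechet_derivative f (at x) v \<bullet> b) *\<^sub>R frechet_derivative g (at (f x)) b"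
  show ?case
  proof (rule Ck_on_has_derivativeI[OF assms(1), of _ ?D])
    fix x assume x: "x \<in> S"
    then have fx: "f x \<in> T" using assms(5) by auto
    have dg: "g differentiable at (f x)" using Suc.prems(2) fx by auto
    have "((\<lambda>x. g (f x)) has_derivative
       (\<lambda>v. frechet_derivative g (at (f x)) (frechet_derivative f (at x) v))) (at x)"
      using has_derivative_compose[OF Ck_on_has_derivative[OF Suc.prems(1) x]
            Ck_on_has_derivative[OF Suc.prems(2) fx]] .
    moreover have "frechet_derivative g (at (f x)) (frechet_derivative f (at x) v) = ?D x v" for v
      by (rule linear_eq_sum_Basis[OF linear_frechet_derivative[OF dg]])
    ultimately show "((\<lambda>x. g (f x)) has_derivative ?D x) (at x)" by simp
  next
    fix v
    show "Ck_on k S (\<lambda>x. ?D x v)"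
    proof (intro Ck_on_sum[OF assms(1)] Ck_on_bilinear[OF assms(1) bounded_bilinear_scaleR])
      fix b :: 'b
      show "Ck_on k S (\<lambda>x. frechet_derivative f (at x) v \<bullet> b)"
        using Suc.prems(1) by (intro Ck_on_linear_compose[OF assms(1) bounded_linear_inner_left]) auto
      show "Ck_on k S (\<lambda>x. frechet_derivative g (at (f x)) b)"
        using Suc.prems(2) Ck_on_Suc_D[OF Suc.prems(1)]
        by (intro Suc.IH) auto
    qed
  qed
qed

lemma smooth_onD: "smooth_on S f \<Longrightarrow> Ck_on k S f"
  by (simp add: smooth_on_def)

lemma smooth_on_differentiable: "smooth_on S f \<Longrightarrow> x \<in> S \<Longrightarrow> f differentiable at x"
  using smooth_onD[of S f "Suc 0"] by simp

lemma smooth_on_has_derivative: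
  "smooth_on S f \<Longrightarrow> x \<in> S \<Longrightarrow> (f has_derivative frechet_derivative f (at x)) (at x)"
  using smooth_on_differentiable frechet_derivative_works by blast

lemma smooth_on_cong: "open S \<Longrightarrow> smooth_on S f \<Longrightarrow> (\<And>x. x \<in> S \<Longrightarrow> f x = g x) \<Longrightarrow> smooth_on S g"
  unfolding smooth_on_def using Ck_on_cong by blast

lemma smooth_on_const: "smooth_on S (\<lambda>x. c)"
  by (simp add: smooth_on_def Ck_on_const)

lemma smooth_on_linear: "bounded_linear h \<Longrightarrow> open S \<Longrightarrow> smooth_on S h"
  by (simp add: smooth_on_def Ck_on_linear)

lemma smooth_on_linear_compose:
  "bounded_linear h \<Longrightarrow> open S \<Longrightarrow> smooth_on S f \<Longrightarrow> smooth_on S (\<lambda>x. h (f x))"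
  by (simp add: smooth_on_def Ck_on_linear_compose)

lemma smooth_on_add:
  "open S \<Longrightarrow> smooth_on S f \<Longrightarrow> smooth_on S g \<Longrightarrow> smooth_on S (\<lambda>x. f x + g x)"
  by (simp add: smooth_on_def Ck_on_add)

lemma smooth_on_minus: "open S \<Longrightarrow> smooth_on S f \<Longrightarrow> smooth_on S (\<lambda>x. - f x)"
  by (rule smooth_on_linear_compose[OF bounded_linear_minus[OF bounded_linear_ident]])

lemma smooth_on_diff:
  "open S \<Longrightarrow> smooth_on S f \<Longrightarrow> smooth_on S g \<Longrightarrow> smooth_on S (\<lambda>x. f x - g x)"
  using smooth_on_add[of S f "\<lambda>x. - g x"] smooth_on_minus[of S g] by simp

lemma smooth_on_fst: "open S \<Longrightarrow> smooth_on S fst" and smooth_on_snd: "open S \<Longrightarrow> smooth_on S snd"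
  by (auto intro: smooth_on_linear bounded_linear_fst bounded_linear_snd)

lemma smooth_on_fst': "open S \<Longrightarrow> smooth_on S f \<Longrightarrow> smooth_on S (\<lambda>x. fst (f x))"
  and smooth_on_snd': "open S \<Longrightarrow> smooth_on S f \<Longrightarrow> smooth_on S (\<lambda>x. snd (f x))"
  and smooth_on_ident: "open S \<Longrightarrow> smooth_on S (\<lambda>x. x)"
  by (auto intro: smooth_on_linear_compose smooth_on_linear bounded_linear_fst bounded_linear_snd
      bounded_linear_ident)

lemma smooth_on_sum:
  "open S \<Longrightarrow> (\<And>i. i \<in> I \<Longrightarrow> smooth_on S (f i)) \<Longrightarrow> smooth_on S (\<lambda>x. \<Sum>i\<in>I. f i x)"
  by (simp add: smooth_on_def Ck_on_sum)

lemma smooth_on_scaleR: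
  "open S \<Longrightarrow> smooth_on S f \<Longrightarrow> smooth_on S g \<Longrightarrow> smooth_on S (\<lambda>x. f x *\<^sub>R g x)"
  by (simp add: smooth_on_def Ck_on_bilinear bounded_bilinear_scaleR)

lemma smooth_on_inner:
  "open S \<Longrightarrow> smooth_on S f \<Longrightarrow> smooth_on S g \<Longrightarrow> smooth_on S (\<lambda>x. f x \<bullet> g x)"
  by (simp add: smooth_on_def Ck_on_bilinear bounded_bilinear_inner)

lemma smooth_on_Pair:
  assumes "open S" "smooth_on S f" "smooth_on S g"
  shows "smooth_on S (\<lambda>x. (f x, g x))"
proof -
  have "smooth_on S (\<lambda>x. (f x, 0) + (0, g x))"
    by (intro smooth_on_add assms(1) smooth_on_linear_compose[OF _ assms(1) assms(2)]
        smooth_on_linear_compose[OF _ assms(1) assms(3)] bounded_linear_Pair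
        bounded_linear_ident bounded_linear_zero)
  then show ?thesis by simp
qed

lemma smooth_on_compose:
  fixes f :: "'a::euclidean_space \<Rightarrow> 'b::euclidean_space"
  assumes "open S" "open T" "smooth_on S f" "smooth_on T g" "f ` S \<subseteq> T"
  shows "smooth_on S (\<lambda>x. g (f x))"
  using assms Ck_on_compose unfolding smooth_on_def by blast

lemma smooth_on_frechet:
  fixes f :: "'a::euclidean_space \<Rightarrow> 'b::real_normed_vector"
    and g :: "'c::euclidean_space \<Rightarrow> 'a"
  assumes "open S" "open T" "smooth_on S g" "smooth_on S h" "smooth_on T f" "g ` S \<subseteq> T"
  shows "smooth_on S (\<lambda>x. frechet_derivative f (at (g x)) (h x))"
proof -
  have d: "smooth_on T (\<lambda>x. frechet_derivative f (at x) v)" for v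
    using assms(5) unfolding smooth_on_def by (metis Ck_on.simps(2))
  have "smooth_on S (\<lambda>x. \<Sum>b\<in>Basis. (h x \<bullet> b) *\<^sub>R frechet_derivative f (at (g x)) b)"
    by (intro smooth_on_sum smooth_on_scaleR smooth_on_inner smooth_on_const
        smooth_on_compose[OF assms(1,2) assms(3) d] assms)
  then show ?thesis
  proof (rule smooth_on_cong[OF assms(1)])
    fix x assume "x \<in> S"
    then have "f differentiable at (g x)" using assms(5,6) smooth_on_differentiable by blast
    from linear_eq_sum_Basis[OF linear_frechet_derivative[OF this], of "h x"]
    show "(\<Sum>b\<in>Basis. (h x \<bullet> b) *\<^sub>R frechet_derivative f (at (g x)) b)
      = frechet_derivative f (at (g x)) (h x)" by simp
  qed
qed

lemmas smooth_on_intros =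
  smooth_on_add smooth_on_minus smooth_on_diff smooth_on_scaleR smooth_on_inner smooth_on_Pair
  smooth_on_const smooth_on_sum


section \<open>Second derivatives and gradients\<close>

definition D2 :: "('a::euclidean_space \<Rightarrow> 'b::real_normed_vector) \<Rightarrow> 'a \<Rightarrow> 'a \<Rightarrow> 'a \<Rightarrow> 'b" where
  "D2 f x v w = frechet_derivative (\<lambda>y. frechet_derivative f (at y) w) (at x) v"

lemma has_derivative_D2:
  assumes "smooth_on S f" "x \<in> S"
  shows "((\<lambda>y. frechet_derivative f (at y) w) has_derivative (\<lambda>h. D2 f x h w)) (at x)"
proof -
  have "smooth_on S (\<lambda>y. frechet_derivative f (at y) w)"
    using assms(1) unfolding smooth_on_def by (metis Ck_on.simps(2))
  then show ?thesis unfolding D2_def using assms(2) by (rule smooth_on_has_derivative)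
qed

lemma has_real_derivative_along_line:
  fixes f :: "'a::euclidean_space \<Rightarrow> real"
  assumes "f differentiable at (p + s *\<^sub>R v)"
  shows "((\<lambda>s. f (p + s *\<^sub>R v)) has_real_derivative frechet_derivative f (at (p + s *\<^sub>R v)) v) (at s)"
proof -
  have "((\<lambda>s. p + s *\<^sub>R v) has_derivative (\<lambda>h. h *\<^sub>R v)) (at s)"
    by (auto intro!: derivative_eq_intros)
  from has_derivative_compose[OF this assms[unfolded frechet_derivative_works]]
  show ?thesis unfolding has_field_derivative_def
    using linear_scale[OF linear_frechet_derivative[OF assms]] by (simp add: mult_commute_abs)
qed

text \<open>
  The mean value theorem is applied first along \<open>v\<close>, to the difference of \<open>f\<close> across the step
  \<open>h w\<close>, and then along \<open>w\<close>, to the directional derivative of \<open>f\<close> in direction \<open>v\<close>.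
\<close>

lemma second_difference_mvt:
  fixes f :: "'a::euclidean_space \<Rightarrow> real"
  assumes f: "Ck_on (Suc (Suc 0)) S f" and "h > 0"
    and S: "\<And>s t. 0 \<le> s \<Longrightarrow> s \<le> h \<Longrightarrow> 0 \<le> t \<Longrightarrow> t \<le> h \<Longrightarrow> x + s *\<^sub>R v + t *\<^sub>R w \<in> S"
  shows "\<exists>s t. 0 \<le> s \<and> s \<le> h \<and> 0 \<le> t \<and> t \<le> h \<and>
     f (x + h *\<^sub>R v + h *\<^sub>R w) - f (x + h *\<^sub>R v) - (f (x + h *\<^sub>R w) - f x)
       = h * h * D2 f (x + s *\<^sub>R v + t *\<^sub>R w) w v"
proof -
  let ?g = "\<lambda>s. f (x + h *\<^sub>R w + s *\<^sub>R v) - f (x + s *\<^sub>R v)"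
  let ?Dv = "\<lambda>y. frechet_derivative f (at y) v"
  have d1: "f differentiable at y" and d2: "?Dv differentiable at y" if "y \<in> S" for y
    using f that by auto
  have "\<exists>s>0. s < h \<and> ?g h - ?g 0
      = (h - 0) * (?Dv (x + h *\<^sub>R w + s *\<^sub>R v) - ?Dv (x + s *\<^sub>R v))"
  proof (rule MVT2[OF \<open>h > 0\<close>])
    fix s assume s: "0 \<le> s" "s \<le> h"
    have "x + h *\<^sub>R w + s *\<^sub>R v \<in> S" "x + s *\<^sub>R v \<in> S"
      using S[OF s, of h] S[OF s, of 0] \<open>h > 0\<close> by (auto simp: algebra_simps)
    then show "(?g has_real_derivative ?Dv (x + h *\<^sub>R w + s *\<^sub>R v) - ?Dv (x + s *\<^sub>R v)) (at s)"
      by (intro DERIV_diff has_real_derivative_along_line d1)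
  qed
  then obtain s where s: "0 < s" "s < h"
    "?g h - ?g 0 = h * (?Dv (x + h *\<^sub>R w + s *\<^sub>R v) - ?Dv (x + s *\<^sub>R v))" by auto
  have "\<exists>t>0. t < h \<and> ?Dv (x + s *\<^sub>R v + h *\<^sub>R w) - ?Dv (x + s *\<^sub>R v + 0 *\<^sub>R w)
      = (h - 0) * D2 f (x + s *\<^sub>R v + t *\<^sub>R w) w v"
    unfolding D2_def
    by (rule MVT2[OF \<open>h > 0\<close>], rule has_real_derivative_along_line, rule d2)
       (use s S in auto)
  then obtain t where t: "0 < t" "t < h" "?Dv (x + s *\<^sub>R v + h *\<^sub>R w) - ?Dv (x + s *\<^sub>R v)
      = h * D2 f (x + s *\<^sub>R v + t *\<^sub>R w) w v" by auto
  show ?thesis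
    using s t by (intro exI[of _ s] exI[of _ t]) (simp add: algebra_simps)
qed

text \<open>
  The second difference of \<open>f\<close> over a small parallelogram spanned by \<open>v\<close> and \<open>w\<close> is symmetric in
  \<open>v\<close> and \<open>w\<close>, and by the mean value theorem it equals either mixed derivative at some point of the
  parallelogram; continuity then identifies the two.
\<close>

lemma D2_symmetric_real:
  fixes f :: "'a::euclidean_space \<Rightarrow> real"
  assumes f: "Ck_on (Suc (Suc 0)) S f" and "open S" "x \<in> S"
  shows "D2 f x v w = D2 f x w v"
proof (rule ccontr)
  assume ne: "D2 f x v w \<noteq> D2 f x w v"
  define e where "e = \<bar>D2 f x v w - D2 f x w v\<bar> / 2"
  have "e > 0" using ne by (simp add: e_def)
  have cont: "isCont (\<lambda>y. D2 f y a b) x" for a b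
    using f \<open>open S\<close> \<open>x \<in> S\<close> by (simp add: continuous_on_eq_continuous_at D2_def)
  obtain d1 where d1: "d1 > 0" "\<And>y. dist y x < d1 \<Longrightarrow> dist (D2 f y v w) (D2 f x v w) < e"
    using cont[of v w] \<open>e > 0\<close> unfolding continuous_at_eps_delta by blast
  obtain d2 where d2: "d2 > 0" "\<And>y. dist y x < d2 \<Longrightarrow> dist (D2 f y w v) (D2 f x w v) < e"
    using cont[of w v] \<open>e > 0\<close> unfolding continuous_at_eps_delta by blast
  obtain d3 where d3: "d3 > 0" "\<And>y. dist y x < d3 \<Longrightarrow> y \<in> S"
    using \<open>open S\<close> \<open>x \<in> S\<close> unfolding open_dist by blast
  define d where "d = min d1 (min d2 d3)"
  \<comment> \<open>small enough that the parallelogram of side \<open>h\<close> lies in the ball of radius \<open>d\<close>\<close>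
  define h where "h = d / (2 * (norm v + norm w + 1))"
  have pos: "norm v + norm w + 1 > 0" by (smt (verit) norm_ge_zero)
  have "d > 0" using d1 d2 d3 by (simp add: d_def)
  have "h > 0" using \<open>d > 0\<close> pos by (simp add: h_def)
  have near: "dist (x + s *\<^sub>R v + t *\<^sub>R w) x < d" if "0 \<le> s" "s \<le> h" "0 \<le> t" "t \<le> h" for s t
  proof -
    have "dist (x + s *\<^sub>R v + t *\<^sub>R w) x = norm (s *\<^sub>R v + t *\<^sub>R w)" by (simp add: dist_norm)
    also have "\<dots> \<le> s * norm v + t * norm w"
      using norm_triangle_ineq[of "s *\<^sub>R v" "t *\<^sub>R w"] that by simp
    also have "\<dots> \<le> h * norm v + h * norm w"
      using that by (intro add_mono mult_right_mono) auto
    also have "\<dots> < h * (2 * (norm v + norm w + 1))"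
      using \<open>h > 0\<close> pos by (simp add: algebra_simps add_strict_increasing2)
    also have "\<dots> = d" using pos by (simp add: h_def)
    finally show ?thesis .
  qed
  have inS: "x + s *\<^sub>R v + t *\<^sub>R w \<in> S" if "0 \<le> s" "s \<le> h" "0 \<le> t" "t \<le> h" for s t
    using near[OF that] d3(2) by (simp add: d_def)
  have inS': "x + s *\<^sub>R w + t *\<^sub>R v \<in> S" if "0 \<le> s" "s \<le> h" "0 \<le> t" "t \<le> h" for s t
    using inS[OF that(3,4,1,2)] by (simp add: algebra_simps)
  obtain s t where st: "0 \<le> s" "s \<le> h" "0 \<le> t" "t \<le> h"
     "f (x + h *\<^sub>R v + h *\<^sub>R w) - f (x + h *\<^sub>R v) - (f (x + h *\<^sub>R w) - f x)
       = h * h * D2 f (x + s *\<^sub>R v + t *\<^sub>R w) w v"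
    using second_difference_mvt[OF f \<open>h > 0\<close> inS] by blast
  obtain s' t' where st': "0 \<le> s'" "s' \<le> h" "0 \<le> t'" "t' \<le> h"
     "f (x + h *\<^sub>R w + h *\<^sub>R v) - f (x + h *\<^sub>R w) - (f (x + h *\<^sub>R v) - f x)
       = h * h * D2 f (x + s' *\<^sub>R w + t' *\<^sub>R v) v w"
    using second_difference_mvt[OF f \<open>h > 0\<close> inS'] by blast
  have "h * h * D2 f (x + s *\<^sub>R v + t *\<^sub>R w) w v = h * h * D2 f (x + t' *\<^sub>R v + s' *\<^sub>R w) v w"
    using st(5) st'(5) by (simp add: algebra_simps)
  then have "D2 f (x + s *\<^sub>R v + t *\<^sub>R w) w v = D2 f (x + t' *\<^sub>R v + s' *\<^sub>R w) v w"
    using \<open>h > 0\<close> by simp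
  moreover have "dist (D2 f (x + s *\<^sub>R v + t *\<^sub>R w) w v) (D2 f x w v) < e"
    using near[OF st(1-4)] by (intro d2) (simp add: d_def)
  moreover have "dist (D2 f (x + t' *\<^sub>R v + s' *\<^sub>R w) v w) (D2 f x v w) < e"
    using near[OF st'(3,4,1,2)] by (intro d1) (simp add: d_def)
  ultimately show False by (simp add: e_def dist_real_def abs_if split: if_splits)
qed

lemma D2_symmetric:
  fixes f :: "'a::euclidean_space \<Rightarrow> 'b::real_inner"
  assumes f: "smooth_on S f" and S: "open S" "x \<in> S"
  shows "D2 f x v w = D2 f x w v"
proof -
  have "D2 f x v w \<bullet> c = D2 f x w v \<bullet> c" for c
  proof -
    have sm: "smooth_on S (\<lambda>x. f x \<bullet> c)"
      by (intro smooth_on_inner S f smooth_on_const)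
    have D: "frechet_derivative (\<lambda>x. f x \<bullet> c) (at y) a = frechet_derivative f (at y) a \<bullet> c"
      if "y \<in> S" for y a
      using frechet_derivative_at[OF has_derivative_inner_left[OF smooth_on_has_derivative[OF f that]], symmetric]
      by metis
    have "D2 (\<lambda>x. f x \<bullet> c) x a b = D2 f x a b \<bullet> c" for a b
    proof -
      have "((\<lambda>y. frechet_derivative f (at y) b \<bullet> c) has_derivative
          (\<lambda>v. D2 f x v b \<bullet> c)) (at x)"
        by (intro has_derivative_inner_left has_derivative_D2[OF f S(2)])
      then have "((\<lambda>y. frechet_derivative (\<lambda>x. f x \<bullet> c) (at y) b) has_derivative
          (\<lambda>v. D2 f x v b \<bullet> c)) (at x)"
        by (rule has_derivative_transform_within_open[OF _ S]) (simp add: D)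
      from frechet_derivative_at[OF this, symmetric] show ?thesis by (simp add: D2_def)
    qed
    then show ?thesis
      using D2_symmetric_real[OF smooth_onD[OF sm] S] by metis
  qed
  then show ?thesis by (metis vector_eq_rdot)
qed

text \<open>
  The second summand is the directional derivative with the base point held fixed; it is present
  because \<open>k\<close> varies along with \<open>y\<close>. This is the derivative of the tangent map of \<open>f\<close>.
\<close>

lemma has_derivative_frechet_derivative:
  fixes f :: "'a::euclidean_space \<Rightarrow> 'b::real_normed_vector"
  assumes f: "smooth_on S f" and S: "open S" "x \<in> S"
  shows "((\<lambda>(y, k). frechet_derivative f (at y) k) has_derivative
     (\<lambda>(h, l). D2 f x h k + frechet_derivative f (at x) l)) (at (x, k))"
proof -
  let ?F = "\<lambda>(y, k). frechet_derivative f (at y) k"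
  let ?G = "\<lambda>yk. \<Sum>b\<in>Basis. (snd yk \<bullet> b) *\<^sub>R frechet_derivative f (at (fst yk)) b"
  have d: "((\<lambda>y. frechet_derivative f (at y) w) has_derivative (\<lambda>h. D2 f x h w)) (at x)" for w
    by (rule has_derivative_D2[OF f S(2)])
  have expand: "frechet_derivative f (at y) k = (\<Sum>b\<in>Basis. (k \<bullet> b) *\<^sub>R frechet_derivative f (at y) b)"
    if "y \<in> S" for y k
    by (rule linear_eq_sum_Basis[OF linear_frechet_derivative[OF smooth_on_differentiable[OF f that]]])
  have d': "((\<lambda>yk. frechet_derivative f (at (fst yk)) b) has_derivative (\<lambda>hl. D2 f x (fst hl) b)) (at (x, k))" for b
  proof (rule has_derivative_compose[OF has_derivative_fst[OF has_derivative_ident]])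
    show "((\<lambda>y. frechet_derivative f (at y) b) has_derivative (\<lambda>h. D2 f x h b)) (at (fst (x, k)))"
      using d[of b] by simp
  qed
  have "(\<lambda>h. \<Sum>b\<in>Basis. (k \<bullet> b) *\<^sub>R D2 f x h b) = (\<lambda>h. D2 f x h k)"
  proof (rule has_derivative_unique[OF _ d[of k]])
    have "((\<lambda>y. \<Sum>b\<in>Basis. (k \<bullet> b) *\<^sub>R frechet_derivative f (at y) b) has_derivative
        (\<lambda>h. \<Sum>b\<in>Basis. (k \<bullet> b) *\<^sub>R D2 f x h b)) (at x)"
      by (intro has_derivative_sum has_derivative_scaleR_right d)
    then show "((\<lambda>y. frechet_derivative f (at y) k) has_derivative
        (\<lambda>h. \<Sum>b\<in>Basis. (k \<bullet> b) *\<^sub>R D2 f x h b)) (at x)"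
      by (rule has_derivative_transform_within_open[OF _ S]) (rule expand[symmetric])
  qed
  then have k: "D2 f x h k = (\<Sum>b\<in>Basis. (k \<bullet> b) *\<^sub>R D2 f x h b)" for h by metis
  have "(?G has_derivative (\<lambda>hl. \<Sum>b\<in>Basis. (k \<bullet> b) *\<^sub>R D2 f x (fst hl) b +
      (snd hl \<bullet> b) *\<^sub>R frechet_derivative f (at x) b)) (at (x, k))"
    by (intro has_derivative_sum)
       (rule has_derivative_eq_rhs[OF has_derivative_scaleR[OF
          has_derivative_inner_left[OF has_derivative_snd[OF has_derivative_ident]] d']], simp)
  then have "(?G has_derivative (\<lambda>(h, l). D2 f x h k + frechet_derivative f (at x) l)) (at (x, k))"
    by (rule has_derivative_eq_rhs)
       (simp add: fun_eq_iff sum.distrib k[symmetric] expand[OF S(2), symmetric] split: prod.splits)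
  then show ?thesis
  proof (rule has_derivative_transform_within_open[where s = "S \<times> UNIV"])
    show "open (S \<times> (UNIV :: 'a set))" using S by (simp add: open_Times)
  qed (use S expand in auto)
qed

lemma GDERIV_unique:
  assumes "GDERIV f x :> a" "GDERIV f x :> b"
  shows "a = b"
proof -
  have "(\<lambda>h. h \<bullet> a) = (\<lambda>h. h \<bullet> b)" using has_derivative_unique assms unfolding gderiv_def by blast
  then have "\<forall>h. h \<bullet> a = h \<bullet> b" by (simp add: fun_eq_iff)
  then show ?thesis using vector_eq_ldot by blast
qed

definition grad :: "('a::euclidean_space \<Rightarrow> real) \<Rightarrow> 'a \<Rightarrow> 'a" where
  "grad f x = (\<Sum>b\<in>Basis. frechet_derivative f (at x) b *\<^sub>R b)"

lemma inner_grad: "f differentiable at x \<Longrightarrow> h \<bullet> grad f x = frechet_derivative f (at x) h"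
  unfolding grad_def
  by (subst linear_eq_sum_Basis[OF linear_frechet_derivative, of f "at x" h])
     (auto simp: inner_sum_right mult.commute)

lemma GDERIV_grad: "f differentiable at x \<Longrightarrow> GDERIV f x :> grad f x"
  by (simp add: gderiv_def inner_grad frechet_derivative_works)

lemma smooth_on_grad:
  assumes "open S" "smooth_on S f"
  shows "smooth_on S (grad f)"
proof -
  have "smooth_on S (\<lambda>x. frechet_derivative f (at x) b)" for b
    using assms(2) unfolding smooth_on_def by (metis Ck_on.simps(2))
  then show ?thesis
    unfolding grad_def[abs_def] by (intro smooth_on_sum smooth_on_scaleR smooth_on_const assms(1))
qed

text \<open>
  The derivative of the gradient is the Hessian, a self-adjoint operator.
\<close>

lemma grad_has_derivative_symmetric:
  fixes f :: "'a::euclidean_space \<Rightarrow> real"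
  assumes S: "open S" "x \<in> S" and f: "smooth_on S f" and G: "(grad f has_derivative G) (at x)"
  shows "G v \<bullet> w = G w \<bullet> v"
proof -
  have *: "G a \<bullet> b = D2 f x a b" for a b
  proof -
    have "((\<lambda>y. grad f y \<bullet> b) has_derivative (\<lambda>a. G a \<bullet> b)) (at x)"
      by (rule has_derivative_inner_left[OF G])
    then have "((\<lambda>y. frechet_derivative f (at y) b) has_derivative (\<lambda>a. G a \<bullet> b)) (at x)"
      by (rule has_derivative_transform_within_open[OF _ S])
         (metis inner_grad inner_commute smooth_on_differentiable[OF f])
    from has_derivative_unique[OF this has_derivative_D2[OF f S(2)]] show ?thesis by metis
  qed
  show ?thesis unfolding * by (rule D2_symmetric[OF f S])
qed


section \<open>Atlases, tangent vectors and covectors\<close>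

lemma smooth_atlas_inj: "smooth_atlas B \<Longrightarrow> c \<in> B \<Longrightarrow> inj_on (cmap c) (cdom c)"
  by (simp add: smooth_atlas_def)

lemma cinv_cmap: "smooth_atlas B \<Longrightarrow> c \<in> B \<Longrightarrow> x \<in> cdom c \<Longrightarrow> cinv c (cmap c x) = x"
  by (simp add: smooth_atlas_def cinv_def)

lemma open_overlap:
  "smooth_atlas B \<Longrightarrow> c \<in> B \<Longrightarrow> c' \<in> B \<Longrightarrow> open (cmap c ` (cdom c \<inter> cdom c'))"
  by (simp add: smooth_atlas_def)

lemma open_chart_image: "smooth_atlas B \<Longrightarrow> c \<in> B \<Longrightarrow> open (cmap c ` cdom c)"
  by (simp add: smooth_atlas_def)

lemma transition_cmap:
  "smooth_atlas B \<Longrightarrow> c \<in> B \<Longrightarrow> x \<in> cdom c \<Longrightarrow> transition c c' (cmap c x) = cmap c' x"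
  by (simp add: transition_def cinv_cmap)

lemma smooth_transition:
  "smooth_atlas B \<Longrightarrow> c \<in> B \<Longrightarrow> c' \<in> B \<Longrightarrow> smooth_on (cmap c ` (cdom c \<inter> cdom c')) (transition c c')"
  by (simp add: smooth_atlas_def)

lemma transition_has_derivative:
  "smooth_atlas B \<Longrightarrow> c \<in> B \<Longrightarrow> c' \<in> B \<Longrightarrow> x \<in> cdom c \<Longrightarrow> x \<in> cdom c' \<Longrightarrow>
    (transition c c' has_derivative jacobian c c' x) (at (cmap c x))"
  unfolding jacobian_def by (rule smooth_on_has_derivative[OF smooth_transition]) auto

lemma linear_jacobian:
  "smooth_atlas B \<Longrightarrow> c \<in> B \<Longrightarrow> c' \<in> B \<Longrightarrow> x \<in> cdom c \<Longrightarrow> x \<in> cdom c' \<Longrightarrow> linear (jacobian c c' x)"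
  using has_derivative_linear[OF transition_has_derivative] .

text \<open>
  Smoothness of transitions only has to be witnessed by some map \<open>g\<close> with the right values on the
  overlap, which spares any reference to chart inverses when bundle charts are compared.
\<close>

lemma smooth_atlasI:
  assumes "\<And>c. c \<in> B \<Longrightarrow> inj_on (cmap c) (cdom c)"
    and "\<And>c c'. c \<in> B \<Longrightarrow> c' \<in> B \<Longrightarrow> open (cmap c ` (cdom c \<inter> cdom c')) \<and>
      (\<exists>g. smooth_on (cmap c ` (cdom c \<inter> cdom c')) g \<and>
        (\<forall>x\<in>cdom c \<inter> cdom c'. cmap c' x = g (cmap c x)))"
  shows "smooth_atlas B"
  unfolding smooth_atlas_def
proof (intro conjI ballI)
  fix c c' assume c: "c \<in> B" "c' \<in> B"
  show "inj_on (cmap c) (cdom c)" using assms(1) c by simp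
  show "open (cmap c ` cdom c)" using assms(2)[of c c] c by simp
  show op: "open (cmap c ` (cdom c \<inter> cdom c'))" using assms(2)[of c c'] c by simp
  obtain g where g: "smooth_on (cmap c ` (cdom c \<inter> cdom c')) g"
    "\<And>x. x \<in> cdom c \<inter> cdom c' \<Longrightarrow> cmap c' x = g (cmap c x)"
    using assms(2)[OF c] by blast
  show "smooth_on (cmap c ` (cdom c \<inter> cdom c')) (transition c c')"
    by (rule smooth_on_cong[OF op g(1)])
       (use g(2) assms(1)[OF c(1)] in \<open>auto simp: transition_def cinv_def\<close>)
qed

lemma jacobian_self:
  assumes "smooth_atlas B" "c \<in> B" "x \<in> cdom c"
  shows "jacobian c c x v = v"
proof -
  have "((\<lambda>y. y) has_derivative jacobian c c x) (at (cmap c x))"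
    by (rule has_derivative_transform_within_open[OF transition_has_derivative[OF assms(1,2,2,3,3)]
          open_chart_image[OF assms(1,2)]])
       (use assms in \<open>auto simp: transition_cmap\<close>)
  from has_derivative_unique[OF this has_derivative_ident] show ?thesis by metis
qed

lemma jacobian_cocycle:
  assumes B: "smooth_atlas B" "c \<in> B" "c' \<in> B" "c'' \<in> B"
    and x: "x \<in> cdom c" "x \<in> cdom c'" "x \<in> cdom c''"
  shows "jacobian c' c'' x (jacobian c c' x v) = jacobian c c'' x v"
proof -
  let ?O = "cmap c ` (cdom c \<inter> cdom c') \<inter> cmap c ` (cdom c \<inter> cdom c'')"
  have "((\<lambda>y. transition c' c'' (transition c c' y)) has_derivative
      (\<lambda>v. jacobian c' c'' x (jacobian c c' x v))) (at (cmap c x))"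
    by (rule has_derivative_compose[OF transition_has_derivative[OF B(1-3) x(1,2)]])
       (use transition_has_derivative[OF B(1,3,4) x(2,3)] B x in \<open>simp add: transition_cmap\<close>)
  then have "(transition c c'' has_derivative
      (\<lambda>v. jacobian c' c'' x (jacobian c c' x v))) (at (cmap c x))"
  proof (rule has_derivative_transform_within_open)
    show "open ?O" using B open_overlap by blast
    show "cmap c x \<in> ?O" using x by auto
    fix y assume "y \<in> ?O"
    then have "y \<in> cmap c ` (cdom c \<inter> cdom c')" "y \<in> cmap c ` (cdom c \<inter> cdom c'')" by blast+
    then obtain a b where ab: "y = cmap c a" "a \<in> cdom c" "a \<in> cdom c'"
      "y = cmap c b" "b \<in> cdom c" "b \<in> cdom c''" by (elim imageE IntE)
    then have "a = b" using smooth_atlas_inj[OF B(1,2)] by (metis inj_onD)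
    then show "transition c' c'' (transition c c' y) = transition c c'' y"
      using ab B by (simp add: transition_cmap)
  qed
  from has_derivative_unique[OF this transition_has_derivative[OF B(1,2,4) x(1,3)]]
  show ?thesis by metis
qed

lemma tangent_setD:
  assumes "(x, v) \<in> tangent_set B"
  shows "c \<in> B \<Longrightarrow> c' \<in> B \<Longrightarrow> x \<in> cdom c \<Longrightarrow> x \<in> cdom c' \<Longrightarrow> v c' = jacobian c c' x (v c)"
    and "\<not> (c \<in> B \<and> x \<in> cdom c) \<Longrightarrow> v c = 0"
  using assms unfolding tangent_set_def by blast+

lemma cotangent_setD:
  assumes "(x, \<xi>) \<in> cotangent_set B"
  shows "c \<in> B \<Longrightarrow> c' \<in> B \<Longrightarrow> x \<in> cdom c \<Longrightarrow> x \<in> cdom c' \<Longrightarrow> \<xi> c \<bullet> w = \<xi> c' \<bullet> jacobian c c' x w"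
    and "\<not> (c \<in> B \<and> x \<in> cdom c) \<Longrightarrow> \<xi> c = 0"
  using assms unfolding cotangent_set_def by blast+

lemma tangent_vector_eqI:
  assumes "smooth_atlas B" "(x, v) \<in> tangent_set B" "(x, v') \<in> tangent_set B"
    "c \<in> B" "x \<in> cdom c" "v c = v' c"
  shows "v = v'"
proof
  fix d
  show "v d = v' d"
    using tangent_setD[OF assms(2)] tangent_setD[OF assms(3)] assms(4-6)
    by (cases "d \<in> B \<and> x \<in> cdom d") (metis, metis)
qed

lemma inner_eqI: "(\<And>w. a \<bullet> w = b \<bullet> w) \<Longrightarrow> a = b"
  using vector_eq_rdot by blast

lemma covector_eqI:
  assumes "smooth_atlas B" "(x, \<xi>) \<in> cotangent_set B" "(x, \<xi>') \<in> cotangent_set B"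
    "c \<in> B" "x \<in> cdom c" "\<xi> c = \<xi>' c"
  shows "\<xi> = \<xi>'"
proof
  fix d
  show "\<xi> d = \<xi>' d"
  proof (cases "d \<in> B \<and> x \<in> cdom d")
    case True
    then have "\<xi> d \<bullet> w = \<xi>' d \<bullet> w" for w
      using cotangent_setD(1)[OF assms(2), of d c w] cotangent_setD(1)[OF assms(3), of d c w]
        assms(4-6) by simp
    then show ?thesis by (rule inner_eqI)
  qed (use cotangent_setD(2)[OF assms(2)] cotangent_setD(2)[OF assms(3)] in metis)
qed

lemma tangent_vector_exists:
  assumes "smooth_atlas B" "c \<in> B" "x \<in> cdom c"
  obtains v where "(x, v) \<in> tangent_set B" "v c = e"
proof
  let ?v = "\<lambda>d. if d \<in> B \<and> x \<in> cdom d then jacobian c d x e else 0"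
  show "(x, ?v) \<in> tangent_set B"
    using assms by (auto simp: tangent_set_def carrier_def jacobian_cocycle)
  show "?v c = e" using assms by (simp add: jacobian_self)
qed

text \<open>
  The components in another chart are obtained by applying the transposed Jacobian, written out in
  an orthonormal basis because covectors are identified with vectors by the inner product.
\<close>

lemma covector_exists:
  assumes "smooth_atlas B" "c \<in> B" "x \<in> cdom c"
  obtains \<xi> where "(x, \<xi>) \<in> cotangent_set B" "\<xi> c = e"
proof
  let ?\<xi> = "\<lambda>d. if d \<in> B \<and> x \<in> cdom d then \<Sum>b\<in>Basis. (e \<bullet> jacobian d c x b) *\<^sub>R b else 0"
  have eq: "(\<Sum>b\<in>Basis. (e \<bullet> jacobian d c x b) *\<^sub>R b) \<bullet> w = e \<bullet> jacobian d c x w"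
    if "d \<in> B" "x \<in> cdom d" for d w
    using linear_eq_sum_Basis[OF linear_jacobian[OF assms(1) that(1) assms(2) that(2) assms(3)], of w]
    by (simp add: inner_sum_left inner_sum_right mult.commute inner_commute[of _ w])
  then show "(x, ?\<xi>) \<in> cotangent_set B"
    using assms by (auto simp: cotangent_set_def carrier_def jacobian_cocycle)
  show "?\<xi> c = e"
  proof -
    have "?\<xi> c \<bullet> w = e \<bullet> w" for w using eq[OF assms(2,3)] assms by (simp add: jacobian_self)
    then show ?thesis by (rule inner_eqI)
  qed
qed

lemma pairing_eq:
  assumes "(x, \<xi>) \<in> cotangent_set B" "(x, v) \<in> tangent_set B" "c \<in> B" "x \<in> cdom c"
  shows "pairing B (y, \<xi>) (x, v) = \<xi> c \<bullet> v c"
proof -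
  have *: "\<xi> d \<bullet> v d = \<xi> c \<bullet> v c" if "d \<in> B" "x \<in> cdom d" for d
    using cotangent_setD(1)[OF assms(1) that(1) assms(3) that(2) assms(4)]
      tangent_setD(1)[OF assms(2) that(1) assms(3) that(2) assms(4)] by simp
  show ?thesis
    unfolding pairing_def fst_conv snd_conv
  proof (rule the_equality)
    show "\<forall>d\<in>B. x \<in> cdom d \<longrightarrow> \<xi> d \<bullet> v d = \<xi> c \<bullet> v c" by (intro ballI impI *)
  qed (use assms(3,4) in blast)
qed

text \<open>
  Gradients in charts transform like covectors, so a covector that is the differential of \<open>F\<close> in
  one chart is the differential of \<open>F\<close> in every chart.
\<close>

lemma GDERIV_change_chart:
  assumes B: "smooth_atlas B" "c \<in> B" "c' \<in> B" and x: "x \<in> cdom c" "x \<in> cdom c'"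
    and \<xi>: "(x, \<xi>) \<in> cotangent_set B" and G: "GDERIV (F \<circ> cinv c) (cmap c x) :> \<xi> c"
  shows "GDERIV (F \<circ> cinv c') (cmap c' x) :> \<xi> c'"
proof -
  have "((\<lambda>y. (F \<circ> cinv c) (transition c' c y)) has_derivative
      (\<lambda>h. jacobian c' c x h \<bullet> \<xi> c)) (at (cmap c' x))"
    by (rule has_derivative_compose[OF transition_has_derivative[OF B(1,3,2) x(2,1)]])
       (use G B x in \<open>simp add: gderiv_def transition_cmap o_def\<close>)
  then have "((F \<circ> cinv c') has_derivative (\<lambda>h. jacobian c' c x h \<bullet> \<xi> c)) (at (cmap c' x))"
    by (rule has_derivative_transform_within_open[OF _ open_overlap[OF B(1,3,2)]])
       (use B x in \<open>auto simp: transition_cmap cinv_cmap\<close>)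
  moreover have "(\<lambda>h. jacobian c' c x h \<bullet> \<xi> c) = (\<lambda>h. h \<bullet> \<xi> c')"
    using cotangent_setD(1)[OF \<xi> B(3,2) x(2,1)] by (simp add: inner_commute)
  ultimately show ?thesis by (simp add: gderiv_def)
qed

text \<open>
  In the coordinates of another chart the components of a one-form acquire a term in the second
  derivative of the transition map. That derivative is symmetric, so the term drops out of the
  antisymmetrized derivative: this is why \<open>ext_d\<close> is well defined.
\<close>

lemma ext_d_eq:
  assumes B: "smooth_atlas B"
    and \<sigma>: "\<And>y. y \<in> carrier B \<Longrightarrow> fst (\<sigma> y) = y \<and> \<sigma> y \<in> cotangent_set B"
    and diff: "\<And>c y. c \<in> B \<Longrightarrow> y \<in> cmap c ` cdom c \<Longrightarrow>
        (\<lambda>y. snd (\<sigma> (cinv c y)) c) differentiable at y"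
    and vw: "(x, v) \<in> tangent_set B" "(x, w) \<in> tangent_set B"
    and c: "c \<in> B" "x \<in> cdom c"
    and D: "((\<lambda>y. snd (\<sigma> (cinv c y)) c) has_derivative D) (at (cmap c x))"
  shows "ext_d B \<sigma> (x, v) (x, w) = D (v c) \<bullet> w c - D (w c) \<bullet> v c"
proof -
  define s where "s c y = snd (\<sigma> (cinv c y)) c" for c y
  define r where "r d = frechet_derivative (s d) (at (cmap d x)) (v d) \<bullet> w d
     - frechet_derivative (s d) (at (cmap d x)) (w d) \<bullet> v d" for d
  have *: "r d = r c" if d: "d \<in> B" "x \<in> cdom d" for d
  proof -
    let ?\<phi> = "transition c d" and ?X = "cmap c x"
    let ?O = "cmap c ` (cdom c \<inter> cdom d)"
    have X: "?X \<in> ?O" using c d by auto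
    have dc: "(s c has_derivative frechet_derivative (s c) (at ?X)) (at ?X)"
      using diff[OF c(1), of ?X] c(2) unfolding s_def by (simp add: frechet_derivative_works[symmetric])
    have dd: "(s d has_derivative frechet_derivative (s d) (at (cmap d x))) (at (?\<phi> ?X))"
      using diff[OF d(1), of "cmap d x"] d(2) B c unfolding s_def
      by (simp add: frechet_derivative_works[symmetric] transition_cmap)
    have law: "s c y \<bullet> k = s d (?\<phi> y) \<bullet> frechet_derivative ?\<phi> (at y) k" if y: "y \<in> ?O" for y k
    proof -
      obtain a where a: "y = cmap c a" "a \<in> cdom c" "a \<in> cdom d" using y by auto
      obtain \<zeta> where \<zeta>: "\<sigma> a = (a, \<zeta>)" "(a, \<zeta>) \<in> cotangent_set B"
        using \<sigma>[of a] a c by (metis UN_I carrier_def prod.collapse)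
      show ?thesis
        using cotangent_setD(1)[OF \<zeta>(2) c(1) d(1) a(2,3), of k] a \<zeta> B c d
        by (simp add: s_def cinv_cmap transition_cmap jacobian_def)
    qed
    have "frechet_derivative (s c) (at ?X) h \<bullet> k
      = frechet_derivative (s d) (at (cmap d x)) (jacobian c d x h) \<bullet> jacobian c d x k
        + s d (cmap d x) \<bullet> D2 ?\<phi> ?X h k" for h k
    proof -
      have j: "((\<lambda>y. frechet_derivative ?\<phi> (at y) k) has_derivative (\<lambda>h. D2 ?\<phi> ?X h k)) (at ?X)"
        by (rule has_derivative_D2[OF smooth_transition[OF B c(1) d(1)] X])
      have "((\<lambda>y. s d (?\<phi> y) \<bullet> frechet_derivative ?\<phi> (at y) k) has_derivative
         (\<lambda>h. s d (?\<phi> ?X) \<bullet> D2 ?\<phi> ?X h k +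
           frechet_derivative (s d) (at (cmap d x)) (jacobian c d x h) \<bullet> frechet_derivative ?\<phi> (at ?X) k))
         (at ?X)"
        by (rule has_derivative_inner[OF has_derivative_compose[OF
            transition_has_derivative[OF B c(1) d(1) c(2) d(2)] dd] j])
      then have "((\<lambda>y. s c y \<bullet> k) has_derivative
         (\<lambda>h. s d (?\<phi> ?X) \<bullet> D2 ?\<phi> ?X h k +
           frechet_derivative (s d) (at (cmap d x)) (jacobian c d x h) \<bullet> frechet_derivative ?\<phi> (at ?X) k))
         (at ?X)"
        by (rule has_derivative_transform_within_open[OF _ open_overlap[OF B c(1) d(1)] X])
           (simp add: law)
      from has_derivative_unique[OF has_derivative_inner_left[OF dc] this]
      show ?thesis using B c by (simp add: fun_eq_iff transition_cmap jacobian_def)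
    qed
    moreover have "D2 ?\<phi> ?X (v c) (w c) = D2 ?\<phi> ?X (w c) (v c)"
      by (rule D2_symmetric[OF smooth_transition[OF B c(1) d(1)] open_overlap[OF B c(1) d(1)] X])
    moreover have "v d = jacobian c d x (v c)" "w d = jacobian c d x (w c)"
      using tangent_setD(1)[OF vw(1) c(1) d(1) c(2) d(2)] tangent_setD(1)[OF vw(2) c(1) d(1) c(2) d(2)]
      by auto
    ultimately show ?thesis by (simp add: r_def)
  qed
  have "ext_d B \<sigma> (x, v) (x, w) = (THE a. \<forall>d\<in>B. x \<in> cdom d \<longrightarrow> r d = a)"
    by (simp add: ext_d_def Let_def r_def s_def[abs_def])
  also have "\<dots> = r c"
  proof (rule the_equality)
    show "\<forall>d\<in>B. x \<in> cdom d \<longrightarrow> r d = r c" by (intro ballI impI *)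
  qed (use c in blast)
  finally have "ext_d B \<sigma> (x, v) (x, w) = r c" .
  moreover have "frechet_derivative (s c) (at (cmap c x)) = D"
    using frechet_derivative_at[OF D] unfolding s_def by simp
  ultimately show ?thesis by (simp add: r_def)
qed


section \<open>Products with the line, tangent and cotangent bundles as manifolds\<close>

lemma cdom_prodR_chart [simp]: "cdom (prodR_chart c) = cdom c \<times> UNIV"
  and cmap_prodR_chart [simp]: "cmap (prodR_chart c) (x, z) = (cmap c x, z)"
  by (auto simp: prodR_chart_def)

lemma prodR_overlap:
  "cmap (prodR_chart c) ` (cdom (prodR_chart c) \<inter> cdom (prodR_chart c'))
     = cmap c ` (cdom c \<inter> cdom c') \<times> UNIV"
proof -
  have "(cmap c x, z) \<in> cmap (prodR_chart c) ` (cdom (prodR_chart c) \<inter> cdom (prodR_chart c'))"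
    if "x \<in> cdom c" "x \<in> cdom c'" for x z
    using that by (intro image_eqI[of _ _ "(x, z)"]) auto
  then show ?thesis by auto
qed

lemma smooth_atlas_prodR:
  assumes B: "smooth_atlas B"
  shows "smooth_atlas (prodR B)"
proof (rule smooth_atlasI)
  fix C assume "C \<in> prodR B"
  then show "inj_on (cmap C) (cdom C)"
    using smooth_atlas_inj[OF B] by (auto simp: prodR_def inj_on_def)
next
  fix C C' assume "C \<in> prodR B" "C' \<in> prodR B"
  then obtain c c' where c: "c \<in> B" "c' \<in> B" and C: "C = prodR_chart c" "C' = prodR_chart c'"
    by (auto simp: prodR_def)
  let ?O = "cmap c ` (cdom c \<inter> cdom c')"
  have op: "open (?O \<times> (UNIV :: real set))" using open_overlap[OF B c] by (simp add: open_Times)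
  have "smooth_on (?O \<times> (UNIV :: real set)) (\<lambda>yz. (transition c c' (fst yz), snd yz))"
    by (intro smooth_on_Pair op smooth_on_snd
        smooth_on_compose[OF op open_overlap[OF B c] smooth_on_fst smooth_transition[OF B c]]) auto
  then show "open (cmap C ` (cdom C \<inter> cdom C')) \<and>
      (\<exists>g. smooth_on (cmap C ` (cdom C \<inter> cdom C')) g \<and>
        (\<forall>x\<in>cdom C \<inter> cdom C'. cmap C' x = g (cmap C x)))"
    unfolding C prodR_overlap using op B c
    by (intro conjI exI[of _ "\<lambda>yz. (transition c c' (fst yz), snd yz)"])
       (auto simp: transition_cmap)
qed

lemma tangent_chart_simps [simp]:
  "cdom (tangent_chart B c) = {(x, v). (x, v) \<in> tangent_set B \<and> x \<in> cdom c}"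
  "cmap (tangent_chart B c) (x, v) = (cmap c x, v c)"
  by (auto simp: tangent_chart_def)

lemma cotangent_chart_simps [simp]:
  "cdom (cotangent_chart B c) = {(x, \<xi>). (x, \<xi>) \<in> cotangent_set B \<and> x \<in> cdom c}"
  "cmap (cotangent_chart B c) (x, \<xi>) = (cmap c x, \<xi> c)"
  by (auto simp: cotangent_chart_def)

lemma tangent_overlap:
  assumes "smooth_atlas B" "c \<in> B"
  shows "cmap (tangent_chart B c) ` (cdom (tangent_chart B c) \<inter> cdom (tangent_chart B c'))
     = cmap c ` (cdom c \<inter> cdom c') \<times> UNIV"
proof -
  have "(cmap c x, e) \<in> cmap (tangent_chart B c) ` (cdom (tangent_chart B c) \<inter> cdom (tangent_chart B c'))"
    if x: "x \<in> cdom c" "x \<in> cdom c'" for x e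
  proof -
    obtain v where "(x, v) \<in> tangent_set B" "v c = e"
      using tangent_vector_exists[OF assms x(1)] by blast
    then show ?thesis using x by (intro image_eqI[of _ _ "(x, v)"]) auto
  qed
  then show ?thesis by auto
qed

lemma cotangent_overlap:
  assumes "smooth_atlas B" "c \<in> B"
  shows "cmap (cotangent_chart B c) ` (cdom (cotangent_chart B c) \<inter> cdom (cotangent_chart B c'))
     = cmap c ` (cdom c \<inter> cdom c') \<times> UNIV"
proof -
  have "(cmap c x, e) \<in> cmap (cotangent_chart B c) ` (cdom (cotangent_chart B c) \<inter> cdom (cotangent_chart B c'))"
    if x: "x \<in> cdom c" "x \<in> cdom c'" for x e
  proof -
    obtain v where "(x, v) \<in> cotangent_set B" "v c = e"
      using covector_exists[OF assms x(1)] by blast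
    then show ?thesis using x by (intro image_eqI[of _ _ "(x, v)"]) auto
  qed
  then show ?thesis by auto
qed

text \<open>
  The change of coordinates is \<open>(y, k) \<mapsto> (\<phi> y, D\<phi>\<^sub>y k)\<close>, which is smooth because \<open>\<phi>\<close> is.
\<close>

lemma smooth_atlas_tangent_bundle:
  fixes B :: "('a, 'e::euclidean_space) chart set"
  assumes B: "smooth_atlas B"
  shows "smooth_atlas (tangent_bundle B)"
proof (rule smooth_atlasI)
  fix C assume "C \<in> tangent_bundle B"
  then obtain c where c: "c \<in> B" and C: "C = tangent_chart B c" by (auto simp: tangent_bundle_def)
  show "inj_on (cmap C) (cdom C)"
  proof (rule inj_onI)
    fix a b assume ab: "a \<in> cdom C" "b \<in> cdom C" "cmap C a = cmap C b"
    obtain x v y w where xy: "a = (x, v)" "b = (y, w)" by (cases a, cases b) auto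
    have "x = y" using ab smooth_atlas_inj[OF B c] unfolding C xy by (auto dest: inj_onD)
    moreover have "v = w"
      using ab \<open>x = y\<close> unfolding C xy by (intro tangent_vector_eqI[OF B _ _ c]) auto
    ultimately show "a = b" using xy by simp
  qed
next
  fix C C' assume "C \<in> tangent_bundle B" "C' \<in> tangent_bundle B"
  then obtain c c' where c: "c \<in> B" "c' \<in> B" and C: "C = tangent_chart B c" "C' = tangent_chart B c'"
    by (auto simp: tangent_bundle_def)
  let ?O = "cmap c ` (cdom c \<inter> cdom c')"
  have op': "open ?O" and op: "open (?O \<times> (UNIV :: 'e set))"
    using open_overlap[OF B c] by (simp_all add: open_Times)
  let ?g = "\<lambda>yk. (transition c c' (fst yk), frechet_derivative (transition c c') (at (fst yk)) (snd yk))"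
  have "smooth_on (?O \<times> UNIV) ?g"
    by (intro smooth_on_Pair op smooth_on_snd smooth_on_fst
        smooth_on_compose[OF op op' smooth_on_fst smooth_transition[OF B c]]
        smooth_on_frechet[OF op op' _ _ smooth_transition[OF B c]]) auto
  moreover have "\<forall>x\<in>cdom C \<inter> cdom C'. cmap C' x = ?g (cmap C x)"
    unfolding C using B c by (auto simp: transition_cmap jacobian_def[symmetric] dest: tangent_setD(1)[of _ _ B c c'])
  ultimately show "open (cmap C ` (cdom C \<inter> cdom C')) \<and>
      (\<exists>g. smooth_on (cmap C ` (cdom C \<inter> cdom C')) g \<and>
        (\<forall>x\<in>cdom C \<inter> cdom C'. cmap C' x = g (cmap C x)))"
    unfolding C tangent_overlap[OF B c(1)] using op by blast
qed

lemma smooth_atlas_cotangent_bundle: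
  fixes B :: "('a, 'e::euclidean_space) chart set"
  assumes B: "smooth_atlas B"
  shows "smooth_atlas (cotangent_bundle B)"
proof (rule smooth_atlasI)
  fix C assume "C \<in> cotangent_bundle B"
  then obtain c where c: "c \<in> B" and C: "C = cotangent_chart B c" by (auto simp: cotangent_bundle_def)
  show "inj_on (cmap C) (cdom C)"
  proof (rule inj_onI)
    fix a b assume ab: "a \<in> cdom C" "b \<in> cdom C" "cmap C a = cmap C b"
    obtain x v y w where xy: "a = (x, v)" "b = (y, w)" by (cases a, cases b) auto
    have "x = y" using ab smooth_atlas_inj[OF B c] unfolding C xy by (auto dest: inj_onD)
    moreover have "v = w"
      using ab \<open>x = y\<close> unfolding C xy by (intro covector_eqI[OF B _ _ c]) auto
    ultimately show "a = b" using xy by simp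
  qed
next
  fix C C' assume "C \<in> cotangent_bundle B" "C' \<in> cotangent_bundle B"
  then obtain c c' where c: "c \<in> B" "c' \<in> B" and C: "C = cotangent_chart B c" "C' = cotangent_chart B c'"
    by (auto simp: cotangent_bundle_def)
  let ?O = "cmap c ` (cdom c \<inter> cdom c')" and ?O' = "cmap c' ` (cdom c' \<inter> cdom c)"
  have op': "open ?O" "open ?O'" and op: "open (?O \<times> (UNIV :: 'e set))"
    using open_overlap[OF B c] open_overlap[OF B c(2,1)] by (simp_all add: open_Times)
  \<comment> \<open>the inverse transpose of the Jacobian, read off from the inverse transition map\<close>
  let ?g = "\<lambda>yp. (transition c c' (fst yp),
     \<Sum>b\<in>Basis. (snd yp \<bullet> frechet_derivative (transition c' c) (at (transition c c' (fst yp))) b) *\<^sub>R b)"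
  have tr: "smooth_on (?O \<times> (UNIV :: 'e set)) (\<lambda>yp. transition c c' (fst yp))"
    by (rule smooth_on_compose[OF op op'(1) smooth_on_fst[OF op] smooth_transition[OF B c]]) auto
  have "smooth_on (?O \<times> UNIV) ?g"
    by (intro smooth_on_Pair op tr smooth_on_sum smooth_on_scaleR smooth_on_inner smooth_on_const
        smooth_on_snd smooth_on_frechet[OF op op'(2) tr _ smooth_transition[OF B c(2,1)]])
       (use B c in \<open>auto simp: transition_cmap\<close>)
  moreover have "cmap C' X = ?g (cmap C X)" if X: "X \<in> cdom C \<inter> cdom C'" for X
  proof -
    obtain x \<xi> where X_eq: "X = (x, \<xi>)" by (cases X)
    have x: "(x, \<xi>) \<in> cotangent_set B" "x \<in> cdom c" "x \<in> cdom c'" using X X_eq C by auto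
    have "\<xi> c' \<bullet> b = \<xi> c \<bullet> frechet_derivative (transition c' c) (at (cmap c' x)) b" for b
      using cotangent_setD(1)[OF x(1) c(2,1) x(3,2)] by (simp add: jacobian_def)
    then have "\<xi> c' = (\<Sum>b\<in>Basis. (\<xi> c \<bullet> frechet_derivative (transition c' c) (at (cmap c' x)) b) *\<^sub>R b)"
      by (metis (no_types, lifting) euclidean_representation sum.cong)
    then show ?thesis using B c x by (simp add: C X_eq transition_cmap)
  qed
  ultimately show "open (cmap C ` (cdom C \<inter> cdom C')) \<and>
      (\<exists>g. smooth_on (cmap C ` (cdom C \<inter> cdom C')) g \<and>
        (\<forall>x\<in>cdom C \<inter> cdom C'. cmap C' x = g (cmap C x)))"
    unfolding C cotangent_overlap[OF B c(1)] using op by blast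
qed


section \<open>The manifolds over the configuration manifold\<close>

text \<open>
  Existence of the point requires that the prescribed components \<open>g\<close> transform contragrediently;
  uniqueness follows from the injectivity of a single chart. Injectivity of \<open>N\<close> makes the
  components, which are indexed by charts of the large manifold, a function of the chart of \<open>A\<close>.
\<close>

lemma point_by_coords_covector:
  fixes A :: "('q, 'e) chart set" and N :: "('q, 'e) chart \<Rightarrow> ('m, 'f::euclidean_space) chart"
  assumes B: "smooth_atlas (N ` A)" and N: "inj_on N A"
    and q: "q \<in> carrier A" "\<And>c. c \<in> A \<Longrightarrow> m \<in> cdom (N c) \<longleftrightarrow> q \<in> cdom c"
    and law: "\<And>c c' w. \<lbrakk>c \<in> A; c' \<in> A; q \<in> cdom c; q \<in> cdom c'\<rbrakk> \<Longrightarrow>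
        g c \<bullet> w = g c' \<bullet> jacobian (N c) (N c') m w"
    and f: "\<And>c. c \<in> A \<Longrightarrow> q \<in> cdom c \<Longrightarrow> f c = (cmap (N c) m, g c)"
  obtains \<zeta> where "point_by_coords A (\<lambda>c. cotangent_chart (N ` A) (N c)) q f = (m, \<zeta>)"
    "(m, \<zeta>) \<in> cotangent_set (N ` A)" "\<And>c. c \<in> A \<Longrightarrow> q \<in> cdom c \<Longrightarrow> \<zeta> (N c) = g c"
proof -
  define \<zeta> where "\<zeta> C = (if C \<in> N ` A \<and> m \<in> cdom C then g (inv_into A N C) else 0)" for C
  have \<zeta>: "\<zeta> (N c) = g c" if "c \<in> A" "q \<in> cdom c" for c
    using that q(2) N by (simp add: \<zeta>_def)
  obtain c\<^sub>0 where c\<^sub>0: "c\<^sub>0 \<in> A" "q \<in> cdom c\<^sub>0" using q(1) by (auto simp: carrier_def)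
  have cot: "(m, \<zeta>) \<in> cotangent_set (N ` A)"
    unfolding cotangent_set_def
  proof (clarsimp, intro conjI allI impI ballI)
    show "m \<in> carrier (N ` A)" using c\<^sub>0 q(2) by (auto simp: carrier_def)
    show "\<zeta> C = 0" if "C \<in> N ` A \<longrightarrow> m \<notin> cdom C" for C
      using that by (auto simp: \<zeta>_def)
    show "\<zeta> (N c) \<bullet> w = \<zeta> (N c') \<bullet> jacobian (N c) (N c') m w"
      if "c \<in> A" "c' \<in> A" "m \<in> cdom (N c) \<and> m \<in> cdom (N c')" for c c' w
      using law[of c c' w] \<zeta> q(2) that by simp
  qed
  have "point_by_coords A (\<lambda>c. cotangent_chart (N ` A) (N c)) q f = (m, \<zeta>)"
    unfolding point_by_coords_def
  proof (rule the_equality)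
    show "\<forall>c\<in>A. q \<in> cdom c \<longrightarrow> (m, \<zeta>) \<in> cdom (cotangent_chart (N ` A) (N c)) \<and>
        cmap (cotangent_chart (N ` A) (N c)) (m, \<zeta>) = f c"
      using cot \<zeta> f q(2) by simp
  next
    fix y assume y: "\<forall>c\<in>A. q \<in> cdom c \<longrightarrow> y \<in> cdom (cotangent_chart (N ` A) (N c)) \<and>
        cmap (cotangent_chart (N ` A) (N c)) y = f c"
    obtain m' \<zeta>' where y_eq: "y = (m', \<zeta>')" by (cases y)
    have *: "(m', \<zeta>') \<in> cotangent_set (N ` A)" "m' \<in> cdom (N c\<^sub>0)" "cmap (N c\<^sub>0) m' = cmap (N c\<^sub>0) m"
       "\<zeta>' (N c\<^sub>0) = \<zeta> (N c\<^sub>0)"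
      using y c\<^sub>0 f[OF c\<^sub>0] \<zeta>[OF c\<^sub>0] by (auto simp: y_eq)
    have "m' = m"
      using inj_onD[OF smooth_atlas_inj[OF B] *(3) *(2)] c\<^sub>0 q(2) by blast
    moreover have "\<zeta>' = \<zeta>"
      using covector_eqI[OF B *(1)[unfolded \<open>m' = m\<close>] cot _ _ *(4)] c\<^sub>0 q(2) by blast
    ultimately show "y = (m, \<zeta>)" by (simp add: y_eq)
  qed
  then show thesis using that cot \<zeta> by blast
qed

lemma M_chart_simps [simp]:
  "cdom (M_chart A c) = {((q, \<xi>), z). (q, \<xi>) \<in> cotangent_set A \<and> q \<in> cdom c}"
  "cmap (M_chart A c) ((q, \<xi>), z) = ((cmap c q, \<xi> c), z)"
  by (auto simp: M_chart_def)

lemma TQR_chart_simps [simp]: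
  "cdom (TQR_chart A c) = {((q, v), z). (q, v) \<in> tangent_set A \<and> q \<in> cdom c}"
  "cmap (TQR_chart A c) ((q, v), z) = ((cmap c q, v c), z)"
  by (auto simp: TQR_chart_def)

lemma contactM_eq: "contactM A = M_chart A ` A"
  by (auto simp: contactM_def prodR_def cotangent_bundle_def M_chart_def)

lemma TQR_eq: "TQR A = TQR_chart A ` A"
  by (auto simp: TQR_def prodR_def tangent_bundle_def TQR_chart_def)

lemma smooth_atlas_contactM: "smooth_atlas A \<Longrightarrow> smooth_atlas (contactM A)"
  by (simp add: contactM_def smooth_atlas_prodR smooth_atlas_cotangent_bundle)

lemma smooth_atlas_TQR: "smooth_atlas A \<Longrightarrow> smooth_atlas (TQR A)"
  by (simp add: TQR_def smooth_atlas_prodR smooth_atlas_tangent_bundle)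

text \<open>
  Charts record their values on all families, also those outside the domain, so that a bundle
  chart determines the chart of the base even when domains are empty.
\<close>

lemma eq_if_all_values_eq:
  assumes "\<And>v. v c = (v c' :: 'e::euclidean_space)"
  shows "c = c'"
proof (rule ccontr)
  assume "c \<noteq> c'"
  obtain b :: 'e where "b \<in> Basis" by (meson nonempty_Basis ex_in_conv)
  then have "b \<noteq> 0" by (rule nonzero_Basis)
  then show False using assms[of "\<lambda>d. if d = c then b else 0"] \<open>c \<noteq> c'\<close> by simp
qed

lemma inj_M_chart:
  fixes A :: "('q, 'e::euclidean_space) chart set"
  shows "inj (M_chart A)"
proof (rule injI)
  fix c c' assume "M_chart A c = M_chart A c'"
  then have "cmap (M_chart A c) ((undefined, \<xi>), 0) = cmap (M_chart A c') ((undefined, \<xi>), 0)" for \<xi>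
    by simp
  then have "\<xi> c = \<xi> c'" for \<xi> :: "('q, 'e) chart \<Rightarrow> 'e" by simp
  then show "c = c'" by (rule eq_if_all_values_eq)
qed

lemma inj_TQR_chart:
  fixes A :: "('q, 'e::euclidean_space) chart set"
  shows "inj (TQR_chart A)"
proof (rule injI)
  fix c c' assume "TQR_chart A c = TQR_chart A c'"
  then have "cmap (TQR_chart A c) ((undefined, v), 0) = cmap (TQR_chart A c') ((undefined, v), 0)" for v
    by simp
  then have "v c = v c'" for v :: "('q, 'e) chart \<Rightarrow> 'e" by simp
  then show "c = c'" by (rule eq_if_all_values_eq)
qed

text \<open>
  The middle component of the derivative of a cotangent transition map is determined by
  differentiating the invariance of \<open>p\<^sub>i w\<^sup>i\<close>; that is the form in which every use below needs it.
\<close>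

lemma jacobian_M_chart:
  assumes A: "smooth_atlas A" and c: "c \<in> A" "c' \<in> A" "q \<in> cdom c" "q \<in> cdom c'"
    and \<xi>: "(q, \<xi>) \<in> cotangent_set A"
    and j: "jacobian (M_chart A c) (M_chart A c') ((q, \<xi>), z) ((h, r), s) = ((h', r'), s')"
  shows "h' = jacobian c c' q h" "s' = s"
    "r' \<bullet> jacobian c c' q w + \<xi> c' \<bullet> D2 (transition c c') (cmap c q) h w = r \<bullet> w"
proof -
  let ?T = "transition (M_chart A c) (M_chart A c')" and ?m = "((q, \<xi>), z)"
  let ?J = "jacobian (M_chart A c) (M_chart A c') ?m"
  let ?X = "((cmap c q, \<xi> c), z)" and ?\<phi> = "transition c c'"
  let ?O = "cmap (M_chart A c) ` (cdom (M_chart A c) \<inter> cdom (M_chart A c'))"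
  note M = smooth_atlas_contactM[OF A, unfolded contactM_eq] imageI[OF c(1)] imageI[OF c(2)]
  have T: "(?T has_derivative ?J) (at ?X)"
    using transition_has_derivative[OF M, of ?m] c \<xi> by simp
  have op: "open ?O" by (rule open_overlap[OF M])
  have X: "?X \<in> ?O" using c \<xi> by (intro image_eqI[of _ _ ?m]) auto
  \<comment> \<open>the transition map is not given by a formula; its values are read off from points of \<open>M\<close>\<close>
  have T_eq: "\<exists>a \<zeta> t. a \<in> cdom c \<and> a \<in> cdom c' \<and> (a, \<zeta>) \<in> cotangent_set A \<and>
      Y = ((cmap c a, \<zeta> c), t) \<and> ?T Y = ((cmap c' a, \<zeta> c'), t)" if Y: "Y \<in> ?O" for Y
  proof -
    obtain n where n: "n \<in> cdom (M_chart A c)" "n \<in> cdom (M_chart A c')" "Y = cmap (M_chart A c) n"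
      using Y by auto
    obtain a \<zeta> t where "n = ((a, \<zeta>), t)" by (metis prod.collapse)
    then show ?thesis using n transition_cmap[OF M(1,2) n(1), of "M_chart A c'"] by auto
  qed
  have X1: "((\<lambda>Y. ?\<phi> (fst (fst Y))) has_derivative (\<lambda>k. jacobian c c' q (fst (fst k)))) (at ?X)"
    by (rule has_derivative_compose[OF has_derivative_fst[OF has_derivative_fst[OF has_derivative_ident]]])
       (use transition_has_derivative[OF A c] in simp)
  have "((\<lambda>Y. fst (fst (?T Y))) has_derivative (\<lambda>k. jacobian c c' q (fst (fst k)))) (at ?X)"
  proof (rule has_derivative_transform_within_open[OF X1 op X])
    fix Y assume "Y \<in> ?O"
    from T_eq[OF this] show "?\<phi> (fst (fst Y)) = fst (fst (?T Y))"
      by (elim exE conjE) (simp add: transition_cmap[OF A c(1)])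
  qed
  from has_derivative_unique[OF has_derivative_fst[OF has_derivative_fst[OF T]] this]
  show "h' = jacobian c c' q h" using j by (metis fst_conv)
  have "((\<lambda>Y. snd (?T Y)) has_derivative (\<lambda>k. snd k)) (at ?X)"
  proof (rule has_derivative_transform_within_open[OF has_derivative_snd[OF has_derivative_ident] op X])
    fix Y assume "Y \<in> ?O"
    from T_eq[OF this] show "snd Y = snd (?T Y)" by (elim exE conjE) simp
  qed
  from has_derivative_unique[OF has_derivative_snd[OF T] this]
  show "s' = s" using j by (metis snd_conv)
  have "((\<lambda>Y. frechet_derivative ?\<phi> (at (fst (fst Y))) w) has_derivative
      (\<lambda>k. D2 ?\<phi> (cmap c q) (fst (fst k)) w)) (at ?X)"
    by (rule has_derivative_compose[OF has_derivative_fst[OF has_derivative_fst[OF has_derivative_ident]]])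
       (use has_derivative_D2[OF smooth_transition[OF A c(1,2)], of "cmap c q" w] c(3,4) in simp)
  from has_derivative_inner[OF has_derivative_snd[OF has_derivative_fst[OF T]] this]
  have 1: "((\<lambda>Y. snd (fst (?T Y)) \<bullet> frechet_derivative ?\<phi> (at (fst (fst Y))) w) has_derivative
      (\<lambda>k. \<xi> c' \<bullet> D2 ?\<phi> (cmap c q) (fst (fst k)) w + snd (fst (?J k)) \<bullet> jacobian c c' q w)) (at ?X)"
    using transition_cmap[OF M(1,2), of ?m "M_chart A c'"] c \<xi> by (simp add: jacobian_def[of c c'])
  have "((\<lambda>Y. snd (fst Y) \<bullet> w) has_derivative
      (\<lambda>k. \<xi> c' \<bullet> D2 ?\<phi> (cmap c q) (fst (fst k)) w + snd (fst (?J k)) \<bullet> jacobian c c' q w)) (at ?X)"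
  proof (rule has_derivative_transform_within_open[OF 1 op X])
    fix Y assume "Y \<in> ?O"
    from T_eq[OF this] obtain a \<zeta> t where a: "a \<in> cdom c" "a \<in> cdom c'" "(a, \<zeta>) \<in> cotangent_set A"
      "Y = ((cmap c a, \<zeta> c), t)" "?T Y = ((cmap c' a, \<zeta> c'), t)" by blast
    show "snd (fst (?T Y)) \<bullet> frechet_derivative ?\<phi> (at (fst (fst Y))) w = snd (fst Y) \<bullet> w"
      using cotangent_setD(1)[OF a(3) c(1,2) a(1,2), of w] unfolding a(5) by (simp add: a(4) jacobian_def)
  qed
  from has_derivative_unique[OF this has_derivative_inner_left[OF has_derivative_snd[OF has_derivative_fst[OF has_derivative_ident]]]]
  have "\<xi> c' \<bullet> D2 ?\<phi> (cmap c q) (fst (fst k)) w + snd (fst (?J k)) \<bullet> jacobian c c' q w = snd (fst k) \<bullet> w" for k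
    by metis
  from this[of "((h, r), s)"] show "r' \<bullet> jacobian c c' q w + \<xi> c' \<bullet> D2 ?\<phi> (cmap c q) h w = r \<bullet> w"
    using j by simp
qed

text \<open>
  The velocity transforms by \<open>D\<phi>\<close> at the varying base point, so the variation \<open>h\<close> of the base
  point contributes the second derivative of \<open>\<phi>\<close> to the variation of the velocity.
\<close>

lemma jacobian_TQR_chart:
  assumes A: "smooth_atlas A" and c: "c \<in> A" "c' \<in> A" "q \<in> cdom c" "q \<in> cdom c'"
    and v: "(q, v) \<in> tangent_set A"
  shows "jacobian (TQR_chart A c) (TQR_chart A c') ((q, v), z) ((h, l), s) =
    ((jacobian c c' q h, D2 (transition c c') (cmap c q) h (v c) + jacobian c c' q l), s)"
proof -
  let ?T = "transition (TQR_chart A c) (TQR_chart A c')" and ?m = "((q, v), z)"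
  let ?J = "jacobian (TQR_chart A c) (TQR_chart A c') ?m"
  let ?X = "((cmap c q, v c), z)" and ?\<phi> = "transition c c'"
  let ?F = "\<lambda>Y. ((?\<phi> (fst (fst Y)), (\<lambda>(y, k). frechet_derivative ?\<phi> (at y) k) (fst Y)), snd Y)"
  let ?O = "cmap (TQR_chart A c) ` (cdom (TQR_chart A c) \<inter> cdom (TQR_chart A c'))"
  note M = smooth_atlas_TQR[OF A, unfolded TQR_eq] imageI[OF c(1)] imageI[OF c(2)]
  have T: "(?T has_derivative ?J) (at ?X)"
    using transition_has_derivative[OF M, of ?m] c v by simp
  have op: "open ?O" by (rule open_overlap[OF M])
  have X: "?X \<in> ?O" using c v by (intro image_eqI[of _ _ ?m]) auto
  have "((\<lambda>Y. ?\<phi> (fst (fst Y))) has_derivative (\<lambda>k. jacobian c c' q (fst (fst k)))) (at ?X)"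
    by (rule has_derivative_compose[OF has_derivative_fst[OF has_derivative_fst[OF has_derivative_ident]]])
       (use transition_has_derivative[OF A c] in simp)
  moreover have "((\<lambda>Y. (\<lambda>(y, k). frechet_derivative ?\<phi> (at y) k) (fst Y)) has_derivative
      (\<lambda>k. (\<lambda>(h, l). D2 ?\<phi> (cmap c q) h (v c) + frechet_derivative ?\<phi> (at (cmap c q)) l) (fst k))) (at ?X)"
    by (rule has_derivative_compose[OF has_derivative_fst[OF has_derivative_ident]])
       (use has_derivative_frechet_derivative[OF smooth_transition[OF A c(1,2)] open_overlap[OF A c(1,2)],
          of "cmap c q" "v c"] c(3,4) in simp)
  ultimately have F: "(?F has_derivative (\<lambda>k. ((jacobian c c' q (fst (fst k)),
      (\<lambda>(h, l). D2 ?\<phi> (cmap c q) h (v c) + frechet_derivative ?\<phi> (at (cmap c q)) l) (fst k)), snd k))) (at ?X)"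
    by (intro has_derivative_Pair has_derivative_snd[OF has_derivative_ident])
  have "(?T has_derivative (\<lambda>k. ((jacobian c c' q (fst (fst k)),
      (\<lambda>(h, l). D2 ?\<phi> (cmap c q) h (v c) + frechet_derivative ?\<phi> (at (cmap c q)) l) (fst k)), snd k))) (at ?X)"
  proof (rule has_derivative_transform_within_open[OF F op X])
    fix Y assume "Y \<in> ?O"
    then obtain n where n: "n \<in> cdom (TQR_chart A c)" "n \<in> cdom (TQR_chart A c')" "Y = cmap (TQR_chart A c) n"
      by auto
    obtain a \<zeta> t where n_eq: "n = ((a, \<zeta>), t)" by (metis prod.collapse)
    have a: "(a, \<zeta>) \<in> tangent_set A" "a \<in> cdom c" "a \<in> cdom c'" using n n_eq by auto
    show "?F Y = ?T Y"
      using n transition_cmap[OF M(1,2) n(1), of "TQR_chart A c'"] transition_cmap[OF A c(1) a(2), of c']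
        tangent_setD(1)[OF a(1) c(1,2) a(2,3)]
      by (simp add: n_eq jacobian_def)
  qed
  from has_derivative_unique[OF T this] show ?thesis by (simp add: jacobian_def[of c c'])
qed

lemma carrier_contactM:
  "((q, \<xi>), z) \<in> carrier (contactM A) \<longleftrightarrow> (q, \<xi>) \<in> cotangent_set A"
  by (auto simp: contactM_eq carrier_def cotangent_set_def)

text \<open>
  The covector law for \<open>dz - p\<^sub>i dq\<^sup>i\<close> is that of \<open>p\<close> itself, since the changes of chart of \<open>M\<close>
  fix \<open>z\<close> and cover those of \<open>Q\<close>.
\<close>

lemma eta_eq:
  assumes A: "smooth_atlas A" and \<xi>: "(q, \<xi>) \<in> cotangent_set A"
  obtains \<zeta> where "eta A ((q, \<xi>), z) = (((q, \<xi>), z), \<zeta>)"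
    "(((q, \<xi>), z), \<zeta>) \<in> cotangent_set (contactM A)"
    "\<And>c. c \<in> A \<Longrightarrow> q \<in> cdom c \<Longrightarrow> \<zeta> (M_chart A c) = ((- \<xi> c, 0), 1)"
proof -
  let ?m = "((q, \<xi>), z)"
  let ?f = "\<lambda>c. case cmap (M_chart A c) ?m of ((x, p), z) \<Rightarrow> (((x, p), z), ((-p, 0), 1 :: real))"
  have q: "q \<in> carrier A" using \<xi> by (simp add: cotangent_set_def)
  have dom: "?m \<in> cdom (M_chart A c) \<longleftrightarrow> q \<in> cdom c" for c using \<xi> by simp
  have law: "((- \<xi> c, 0), 1) \<bullet> w = ((- \<xi> c', 0), 1) \<bullet> jacobian (M_chart A c) (M_chart A c') ?m w"
    if c: "c \<in> A" "c' \<in> A" "q \<in> cdom c" "q \<in> cdom c'" for c c' w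
  proof -
    obtain h r s where w: "w = ((h, r), s)" by (metis prod.collapse)
    obtain h' r' s' where j: "jacobian (M_chart A c) (M_chart A c') ?m ((h, r), s) = ((h', r'), s')"
      by (metis prod.collapse)
    show ?thesis
      using cotangent_setD(1)[OF \<xi> c, of h] jacobian_M_chart(1,2)[OF A c \<xi> j]
      unfolding w j by simp
  qed
  have f: "?f c = (cmap (M_chart A c) ?m, ((- \<xi> c, 0), 1))" for c by simp
  show thesis
    by (rule point_by_coords_covector[where N = "M_chart A" and f = ?f and g = "\<lambda>c. ((- \<xi> c, 0), 1)",
        OF smooth_atlas_contactM[OF A, unfolded contactM_eq] inj_on_subset[OF inj_M_chart subset_UNIV]
          q dom law f])
       (use that in \<open>auto simp: eta_def contactM_eq\<close>)
qed

lemma pairing_eta: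
  assumes A: "smooth_atlas A" and m: "(((q, \<xi>), z), V) \<in> tangent_set (contactM A)"
    and c: "c \<in> A" "q \<in> cdom c" and V: "V (M_chart A c) = ((xd, pd), zd)"
  shows "pairing (contactM A) (eta A ((q, \<xi>), z)) (((q, \<xi>), z), V) = zd - \<xi> c \<bullet> xd"
proof -
  have \<xi>: "(q, \<xi>) \<in> cotangent_set A" using m by (simp add: tangent_set_def carrier_contactM)
  obtain \<zeta> where \<zeta>: "eta A ((q, \<xi>), z) = (((q, \<xi>), z), \<zeta>)"
    "(((q, \<xi>), z), \<zeta>) \<in> cotangent_set (contactM A)" "\<zeta> (M_chart A c) = ((- \<xi> c, 0), 1)"
    using eta_eq[OF A \<xi>, of z] c by metis
  show ?thesis
    using pairing_eq[OF \<zeta>(2) m, of "M_chart A c"] c \<xi> by (simp add: \<zeta> V contactM_eq)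
qed

text \<open>
  In coordinates \<open>d\<eta> = dq\<^sup>i \<and> dp\<^sub>i\<close>. The components of \<open>\<eta>\<close> depend on the point only through
  \<open>p\<close>, linearly, so their derivative does not depend on the point.
\<close>

lemma ext_d_eta:
  assumes A: "smooth_atlas A"
    and V: "(((q, \<xi>), z), V) \<in> tangent_set (contactM A)" "V (M_chart A c) = ((xd, pd), zd)"
    and W: "(((q, \<xi>), z), W) \<in> tangent_set (contactM A)" "W (M_chart A c) = ((xd', pd'), zd')"
    and c: "c \<in> A" "q \<in> cdom c"
  shows "ext_d (contactM A) (eta A) (((q, \<xi>), z), V) (((q, \<xi>), z), W) = pd' \<bullet> xd - pd \<bullet> xd'"
proof -
  note M = smooth_atlas_contactM[OF A]
  let ?m = "((q, \<xi>), z)"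
  have \<xi>: "(q, \<xi>) \<in> cotangent_set A" using V by (simp add: tangent_set_def carrier_contactM)
  have D: "((\<lambda>y. snd (eta A (cinv (M_chart A c) y)) (M_chart A c)) has_derivative
      (\<lambda>((h, r), s). ((-r, 0), 0))) (at y)" if c: "c \<in> A" and y: "y \<in> cmap (M_chart A c) ` cdom (M_chart A c)"
    for c y
  proof -
    have C: "M_chart A c \<in> contactM A" using c by (simp add: contactM_eq)
    have "((\<lambda>y. ((- snd (fst y), 0), 1)) has_derivative (\<lambda>k. ((- snd (fst k), 0), 0))) (at y)"
      by (auto intro!: derivative_eq_intros)
    then have "((\<lambda>y. snd (eta A (cinv (M_chart A c) y)) (M_chart A c)) has_derivative
        (\<lambda>k. ((- snd (fst k), 0), 0))) (at y)"
    proof (rule has_derivative_transform_within_open[OF _ open_chart_image[OF M C] y])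
      fix Y assume "Y \<in> cmap (M_chart A c) ` cdom (M_chart A c)"
      then obtain n where n: "n \<in> cdom (M_chart A c)" "Y = cmap (M_chart A c) n" by auto
      obtain a \<zeta> t where n_eq: "n = ((a, \<zeta>), t)" by (metis prod.collapse)
      have a: "(a, \<zeta>) \<in> cotangent_set A" "a \<in> cdom c" using n n_eq by auto
      obtain \<mu> where "eta A n = (n, \<mu>)" "\<mu> (M_chart A c) = ((- \<zeta> c, 0), 1)"
        using eta_eq[OF A a(1), of t] c a(2) unfolding n_eq by metis
      then show "((- snd (fst Y), 0), 1) = snd (eta A (cinv (M_chart A c) Y)) (M_chart A c)"
        using cinv_cmap[OF M C n(1)] n(2) n_eq by simp
    qed
    then show ?thesis by (simp add: case_prod_unfold)
  qed
  have \<sigma>: "fst (eta A y) = y \<and> eta A y \<in> cotangent_set (contactM A)" if y: "y \<in> carrier (contactM A)" for y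
  proof -
    obtain a \<zeta> t where y_eq: "y = ((a, \<zeta>), t)" by (metis prod.collapse)
    then have "(a, \<zeta>) \<in> cotangent_set A" using y by (simp add: carrier_contactM)
    then show ?thesis using eta_eq[OF A, of a \<zeta> t] y_eq by (metis fst_conv)
  qed
  have diff: "(\<lambda>y. snd (eta A (cinv C y)) C) differentiable at y"
    if C: "C \<in> contactM A" and y: "y \<in> cmap C ` cdom C" for C y
  proof -
    obtain c where "c \<in> A" "C = M_chart A c" using C by (auto simp: contactM_eq)
    then show ?thesis using D[of c y] y unfolding differentiable_def by blast
  qed
  have C: "M_chart A c \<in> contactM A" "?m \<in> cdom (M_chart A c)"
    using c \<xi> by (auto simp: contactM_eq)
  show ?thesis
    using ext_d_eq[OF M \<sigma> diff V(1) W(1) C D[OF c(1)]] imageI[OF C(2), of "cmap (M_chart A c)"]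
    by (simp add: V(2) W(2))
qed


section \<open>The manifold of horizontal vectors\<close>

lemma cotangent_of_contactM_tangent:
  "(((q, \<xi>), z), V) \<in> tangent_set (contactM A) \<Longrightarrow> (q, \<xi>) \<in> cotangent_set A"
  by (simp add: tangent_set_def carrier_contactM)

lemma HM_set_iff:
  assumes A: "smooth_atlas A" and c: "c \<in> A" "q \<in> cdom c"
  shows "(((q, \<xi>), z), V) \<in> HM_set A \<longleftrightarrow> (((q, \<xi>), z), V) \<in> tangent_set (contactM A) \<and>
    snd (V (M_chart A c)) = \<xi> c \<bullet> fst (fst (V (M_chart A c)))"
proof -
  obtain xd pd zd where V: "V (M_chart A c) = ((xd, pd), zd)" by (metis prod.collapse)
  show ?thesis
    using pairing_eta[OF A, of q \<xi> z V c xd pd zd] c V by (auto simp: HM_set_def)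
qed

lemma TMR_chart_simps [simp]:
  "cdom (TMR_chart A c) = {((m, V), u). (m, V) \<in> tangent_set (contactM A) \<and> m \<in> cdom (M_chart A c)}"
  "cmap (TMR_chart A c) ((m, V), u) = ((cmap (M_chart A c) m, V (M_chart A c)), u)"
  by (auto simp: TMR_chart_def)

lemma HMR_chart_simps [simp]:
  "cdom (HMR_chart A c) = {((m, V), u). (m, V) \<in> HM_set A \<and> m \<in> cdom (M_chart A c)}"
  "cmap (HMR_chart A c) ((((q, \<xi>), z), V), u) =
     (cmap c q, \<xi> c, z, fst (fst (V (M_chart A c))), snd (fst (V (M_chart A c))), u)"
  by (auto simp: HMR_chart_def case_prod_unfold)

lemma HMR_eq: "HMR A = HMR_chart A ` A"
  by (simp add: HMR_def)

lemma HM_setD: "(m, V) \<in> HM_set A \<Longrightarrow> (m, V) \<in> tangent_set (contactM A)"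
  by (simp add: HM_set_def)

lemma carrier_HMR: "((m, V), u) \<in> carrier (HMR A) \<longleftrightarrow> (m, V) \<in> HM_set A"
proof -
  have "\<exists>c\<in>A. m \<in> cdom (M_chart A c)" if "(m, V) \<in> HM_set A"
    using HM_setD[OF that] by (auto simp: tangent_set_def carrier_def contactM_eq)
  then show ?thesis by (auto simp: HMR_eq carrier_def)
qed

lemma HMR_point_exists:
  assumes A: "smooth_atlas A" and c: "c \<in> A" "q \<in> cdom c"
  obtains \<xi> V where "(((q, \<xi>), z), V) \<in> HM_set A" "\<xi> c = p" "V (M_chart A c) = ((xd, pd), p \<bullet> xd)"
proof -
  obtain \<xi> where \<xi>: "(q, \<xi>) \<in> cotangent_set A" "\<xi> c = p" using covector_exists[OF A c] by blast
  have C: "M_chart A c \<in> contactM A" "((q, \<xi>), z) \<in> cdom (M_chart A c)"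
    using c \<xi>(1) by (auto simp: contactM_eq)
  obtain V where "(((q, \<xi>), z), V) \<in> tangent_set (contactM A)" "V (M_chart A c) = ((xd, pd), p \<bullet> xd)"
    by (rule tangent_vector_exists[OF smooth_atlas_contactM[OF A] C])
  then show thesis using that[of \<xi> V] \<xi> HM_set_iff[OF A c] by simp
qed

lemma HMR_overlap:
  assumes A: "smooth_atlas A" and c: "c \<in> A"
  shows "cmap (HMR_chart A c) ` (cdom (HMR_chart A c) \<inter> cdom (HMR_chart A c'))
    = cmap c ` (cdom c \<inter> cdom c') \<times> UNIV"
proof -
  have "(cmap c q, p, z, xd, pd, u) \<in>
      cmap (HMR_chart A c) ` (cdom (HMR_chart A c) \<inter> cdom (HMR_chart A c'))"
    if q: "q \<in> cdom c" "q \<in> cdom c'" for q p z xd pd u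
  proof -
    obtain \<xi> V where *: "(((q, \<xi>), z), V) \<in> HM_set A" "\<xi> c = p" "V (M_chart A c) = ((xd, pd), p \<bullet> xd)"
      using HMR_point_exists[OF A c q(1)] by blast
    have "(q, \<xi>) \<in> cotangent_set A"
      using cotangent_of_contactM_tangent[OF HM_setD[OF *(1)]] .
    with * q show ?thesis by (intro image_eqI[of _ _ "((((q, \<xi>), z), V), u)"]) auto
  qed
  then show ?thesis by auto
qed

text \<open>
  The charts are restrictions of charts of \<open>TM \<times> \<real>\<close>, hence their changes are changes of chart of
  \<open>TM \<times> \<real>\<close> between a smooth inclusion and a linear projection.
\<close>

lemma smooth_atlas_HMR:
  fixes A :: "('q, 'e::euclidean_space) chart set"
  assumes A: "smooth_atlas A"
  shows "smooth_atlas (HMR A)"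
proof (rule smooth_atlasI)
  fix C assume "C \<in> HMR A"
  then obtain c where c: "c \<in> A" and C: "C = HMR_chart A c" by (auto simp: HMR_eq)
  show "inj_on (cmap C) (cdom C)"
  proof (rule inj_onI)
    fix a b assume ab: "a \<in> cdom C" "b \<in> cdom C" "cmap C a = cmap C b"
    obtain q \<xi> z V u where a: "a = ((((q, \<xi>), z), V), u)" by (metis prod.collapse)
    obtain q' \<xi>' z' V' u' where b: "b = ((((q', \<xi>'), z'), V'), u')" by (metis prod.collapse)
    have q: "q \<in> cdom c" "q' \<in> cdom c" "cmap c q = cmap c q'" "z = z'" "u = u'" "\<xi> c = \<xi>' c"
      and \<xi>: "(q, \<xi>) \<in> cotangent_set A" "(q', \<xi>') \<in> cotangent_set A"
      using ab by (auto simp: C a b)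
    have qq: "q = q'" using inj_onD[OF smooth_atlas_inj[OF A c] q(3,1,2)] .
    have \<xi>\<xi>: "\<xi> = \<xi>'" by (rule covector_eqI[OF A \<xi>(1) \<xi>(2)[folded qq] c q(1) q(6)])
    have "V = V'"
    proof (rule tangent_vector_eqI[OF smooth_atlas_contactM[OF A], of "((q, \<xi>), z)" _ _ "M_chart A c"])
      show "V (M_chart A c) = V' (M_chart A c)"
        using ab HM_set_iff[OF A c q(1)] qq \<xi>\<xi> q(4) by (simp add: C a b prod_eq_iff)
    qed (use ab c q \<xi> qq \<xi>\<xi> HM_setD in \<open>auto simp: C a b contactM_eq\<close>)
    then show "a = b" using a b qq \<xi>\<xi> q by simp
  qed
next
  fix C C' assume "C \<in> HMR A" "C' \<in> HMR A"
  then obtain c c' where c: "c \<in> A" "c' \<in> A" and C: "C = HMR_chart A c" "C' = HMR_chart A c'"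
    by (auto simp: HMR_eq)
  let ?O = "cmap c ` (cdom c \<inter> cdom c') \<times> (UNIV :: ('e \<times> real \<times> 'e \<times> 'e \<times> real) set)"
  let ?T = "TMR_chart A c" and ?T' = "TMR_chart A c'"
  have op: "open ?O" using open_overlap[OF A c] by (simp add: open_Times)
  have TM: "smooth_atlas (prodR (tangent_bundle (contactM A)))"
    by (rule smooth_atlas_prodR[OF smooth_atlas_tangent_bundle[OF smooth_atlas_contactM[OF A]]])
  have T: "?T \<in> prodR (tangent_bundle (contactM A))" "?T' \<in> prodR (tangent_bundle (contactM A))"
    using c by (auto simp: prodR_def tangent_bundle_def contactM_eq TMR_chart_def)
  \<comment> \<open>the horizontal vectors sit inside all tangent vectors as the graph of \<open>z' = p\<^sub>i q'\<^sup>i\<close>\<close>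
  define incl :: "'e \<times> 'e \<times> real \<times> 'e \<times> 'e \<times> real \<Rightarrow> ((('e \<times> 'e) \<times> real) \<times> (('e \<times> 'e) \<times> real)) \<times> real"
    where "incl X = ((((fst X, fst (snd X)), fst (snd (snd X))),
      ((fst (snd (snd (snd X))), fst (snd (snd (snd (snd X))))),
        fst (snd X) \<bullet> fst (snd (snd (snd X))))), snd (snd (snd (snd (snd X)))))" for X
  define proj :: "((('e \<times> 'e) \<times> real) \<times> (('e \<times> 'e) \<times> real)) \<times> real \<Rightarrow> 'e \<times> 'e \<times> real \<times> 'e \<times> 'e \<times> real"
    where "proj Y = (fst (fst (fst (fst Y))), snd (fst (fst (fst Y))), snd (fst (fst Y)),
      fst (fst (snd (fst Y))), snd (fst (snd (fst Y))), snd Y)" for Y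
  have incl: "incl (cmap (HMR_chart A c) w) = cmap ?T w" and proj: "proj (cmap ?T' w) = cmap (HMR_chart A c') w"
    and dom: "w \<in> cdom ?T \<inter> cdom ?T'"
    if w: "w \<in> cdom (HMR_chart A c) \<inter> cdom (HMR_chart A c')" for w
  proof -
    obtain q \<xi> z V u where w_eq: "w = ((((q, \<xi>), z), V), u)" by (metis prod.collapse)
    show "incl (cmap (HMR_chart A c) w) = cmap ?T w" "proj (cmap ?T' w) = cmap (HMR_chart A c') w"
      "w \<in> cdom ?T \<inter> cdom ?T'"
      using w HM_set_iff[OF A c(1), of q \<xi> z V] by (auto simp: w_eq incl_def proj_def prod_eq_iff)
  qed
  have "smooth_on ?O incl"
    unfolding incl_def[abs_def] using op
    by (intro smooth_on_intros smooth_on_fst' smooth_on_snd' smooth_on_ident)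
  moreover have "incl ` ?O \<subseteq> cmap ?T ` (cdom ?T \<inter> cdom ?T')"
  proof
    fix Y assume "Y \<in> incl ` ?O"
    then obtain w where "w \<in> cdom (HMR_chart A c) \<inter> cdom (HMR_chart A c')"
      "Y = incl (cmap (HMR_chart A c) w)"
      unfolding HMR_overlap[OF A c(1), symmetric] by blast
    then show "Y \<in> cmap ?T ` (cdom ?T \<inter> cdom ?T')" using incl dom by blast
  qed
  ultimately have TI: "smooth_on ?O (\<lambda>X. transition ?T ?T' (incl X))"
    by (intro smooth_on_compose[OF op open_overlap[OF TM T] _ smooth_transition[OF TM T]])
  have "smooth_on ?O (\<lambda>X. proj (transition ?T ?T' (incl X)))"
    unfolding proj_def using op TI by (intro smooth_on_intros smooth_on_fst' smooth_on_snd')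
  moreover have "cmap C' w = proj (transition ?T ?T' (incl (cmap C w)))"
    if w: "w \<in> cdom C \<inter> cdom C'" for w
    using incl proj dom w transition_cmap[OF TM T(1), of w ?T'] unfolding C by (metis IntD1)
  ultimately show "open (cmap C ` (cdom C \<inter> cdom C')) \<and>
      (\<exists>g. smooth_on (cmap C ` (cdom C \<inter> cdom C')) g \<and>
        (\<forall>x\<in>cdom C \<inter> cdom C'. cmap C' x = g (cmap C x)))"
    unfolding C HMR_overlap[OF A c(1)] using op by blast
qed

lemma inj_HMR_chart:
  fixes A :: "('q, 'e::euclidean_space) chart set"
  shows "inj (HMR_chart A)"
proof (rule injI)
  fix c c' assume "HMR_chart A c = HMR_chart A c'"
  then have "cmap (HMR_chart A c) ((((undefined, \<xi>), 0), undefined), 0)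
    = cmap (HMR_chart A c') ((((undefined, \<xi>), 0), undefined), 0)" for \<xi>
    by simp
  then have "\<xi> c = \<xi> c'" for \<xi> :: "('q, 'e) chart \<Rightarrow> 'e" by simp
  then show "c = c'" by (rule eq_if_all_values_eq)
qed

text \<open>
  The projection to \<open>M\<close> intertwines the changes of chart, and \<open>\<theta>\<^sub>\<eta>\<close> sees a tangent vector
  only through its projection.
\<close>

lemma jacobian_HMR_chart:
  assumes A: "smooth_atlas A" and c: "c \<in> A" "c' \<in> A" "q \<in> cdom c" "q \<in> cdom c'"
    and w: "(((q, \<xi>), z), V) \<in> HM_set A"
    and j: "jacobian (HMR_chart A c) (HMR_chart A c') ((((q, \<xi>), z), V), u) (h, r, s, k) = (h', r', s', k')"
  shows "jacobian (M_chart A c) (M_chart A c') ((q, \<xi>), z) ((h, r), s) = ((h', r'), s')"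
proof -
  define \<pi> :: "'b \<times> 'b \<times> real \<times> 'b \<times> 'b \<times> real \<Rightarrow> ('b \<times> 'b) \<times> real"
    where "\<pi> X = ((fst X, fst (snd X)), fst (snd (snd X)))" for X
  let ?w = "((((q, \<xi>), z), V), u)" and ?m = "((q, \<xi>), z)"
  let ?TH = "transition (HMR_chart A c) (HMR_chart A c')"
  let ?TM = "transition (M_chart A c) (M_chart A c')"
  let ?X = "cmap (HMR_chart A c) ?w"
  let ?O = "cmap (HMR_chart A c) ` (cdom (HMR_chart A c) \<inter> cdom (HMR_chart A c'))"
  note M = smooth_atlas_contactM[OF A, unfolded contactM_eq] imageI[OF c(1)] imageI[OF c(2)]
  note H = smooth_atlas_HMR[OF A, unfolded HMR_eq] imageI[OF c(1)] imageI[OF c(2)]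
  have \<xi>: "(q, \<xi>) \<in> cotangent_set A" using cotangent_of_contactM_tangent[OF HM_setD[OF w]] .
  have \<pi>: "bounded_linear \<pi>"
    unfolding \<pi>_def[abs_def]
    by (intro bounded_linear_Pair bounded_linear_fst_comp bounded_linear_snd_comp bounded_linear_ident)
  have X: "?X \<in> ?O" using c w \<xi> by (intro imageI) auto
  have "((\<lambda>X. ?TM (\<pi> X)) has_derivative (\<lambda>k. jacobian (M_chart A c) (M_chart A c') ?m (\<pi> k))) (at ?X)"
    by (rule has_derivative_compose[OF bounded_linear_imp_has_derivative[OF \<pi>]])
       (use transition_has_derivative[OF M, of ?m] c \<xi> in \<open>simp add: \<pi>_def\<close>)
  then have "((\<lambda>X. \<pi> (?TH X)) has_derivative (\<lambda>k. jacobian (M_chart A c) (M_chart A c') ?m (\<pi> k))) (at ?X)"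
  proof (rule has_derivative_transform_within_open[OF _ open_overlap[OF H] X])
    fix Y assume "Y \<in> ?O"
    then obtain v where v: "v \<in> cdom (HMR_chart A c)" "v \<in> cdom (HMR_chart A c')" "Y = cmap (HMR_chart A c) v"
      by auto
    obtain q' \<xi>' z' V' u' where v_eq: "v = ((((q', \<xi>'), z'), V'), u')" by (metis prod.collapse)
    show "?TM (\<pi> Y) = \<pi> (?TH Y)"
      using transition_cmap[OF H(1,2) v(1), of "HMR_chart A c'"]
        transition_cmap[OF M(1,2), of "((q', \<xi>'), z')" "M_chart A c'"] v
      by (simp add: v_eq \<pi>_def)
  qed
  moreover have "((\<lambda>X. \<pi> (?TH X)) has_derivative
      (\<lambda>k. \<pi> (jacobian (HMR_chart A c) (HMR_chart A c') ?w k))) (at ?X)"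
    by (rule bounded_linear.has_derivative[OF \<pi> transition_has_derivative[OF H]]) (use c w \<xi> in auto)
  ultimately have "jacobian (M_chart A c) (M_chart A c') ?m (\<pi> k)
     = \<pi> (jacobian (HMR_chart A c) (HMR_chart A c') ?w k)" for k
    using has_derivative_unique by metis
  from this[of "(h, r, s, k)"] show ?thesis by (simp add: j \<pi>_def)
qed

text \<open>
  A velocity \<open>(q', p')\<close> on \<open>T*Q\<close> changes by the derivative of the cotangent change of chart: \<open>p'\<close>
  is not a covector, and the second derivative of \<open>\<phi>\<close> measures the defect.
\<close>

lemma contactM_tangent_change_chart:
  assumes A: "smooth_atlas A" and c: "c \<in> A" "c' \<in> A" "q \<in> cdom c" "q \<in> cdom c'"
    and V: "(((q, \<xi>), z), V) \<in> tangent_set (contactM A)"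
  shows "fst (fst (V (M_chart A c'))) = jacobian c c' q (fst (fst (V (M_chart A c))))"
    "snd (fst (V (M_chart A c'))) \<bullet> jacobian c c' q w
      + \<xi> c' \<bullet> D2 (transition c c') (cmap c q) (fst (fst (V (M_chart A c)))) w
     = snd (fst (V (M_chart A c))) \<bullet> w"
proof -
  obtain h r s where Vc: "V (M_chart A c) = ((h, r), s)" by (metis prod.collapse)
  obtain h' r' s' where Vc': "V (M_chart A c') = ((h', r'), s')" by (metis prod.collapse)
  have \<xi>: "(q, \<xi>) \<in> cotangent_set A" using cotangent_of_contactM_tangent[OF V] .
  have "V (M_chart A c') = jacobian (M_chart A c) (M_chart A c') ((q, \<xi>), z) (V (M_chart A c))"
    using tangent_setD(1)[OF V, of "M_chart A c" "M_chart A c'"] c \<xi> by (simp add: contactM_eq)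
  then have j: "jacobian (M_chart A c) (M_chart A c') ((q, \<xi>), z) ((h, r), s) = ((h', r'), s')"
    by (simp add: Vc Vc')
  from jacobian_M_chart(1,3)[OF A c \<xi> j]
  show "fst (fst (V (M_chart A c'))) = jacobian c c' q (fst (fst (V (M_chart A c))))"
    "snd (fst (V (M_chart A c'))) \<bullet> jacobian c c' q w
      + \<xi> c' \<bullet> D2 (transition c c') (cmap c q) (fst (fst (V (M_chart A c)))) w
     = snd (fst (V (M_chart A c))) \<bullet> w"
    by (auto simp: Vc Vc')
qed

text \<open>
  Under a change of chart the term \<open>p'\<^sub>i dq\<^sup>i\<close> produces \<open>p\<^sub>i\<close> times the second derivative in the
  directions \<open>(q', dq)\<close>, and \<open>q'\<^sup>i dp\<^sub>i\<close> produces the same in the directions \<open>(dq, q')\<close>;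
  by symmetry the two cancel.
\<close>

lemma theta_eta_eq:
  assumes A: "smooth_atlas A" and w: "(((q, \<xi>), z), V) \<in> HM_set A"
  obtains \<zeta> where "theta_eta A ((((q, \<xi>), z), V), u) = (((((q, \<xi>), z), V), u), \<zeta>)"
    "(((((q, \<xi>), z), V), u), \<zeta>) \<in> cotangent_set (HMR A)"
    "\<And>c. c \<in> A \<Longrightarrow> q \<in> cdom c \<Longrightarrow> \<zeta> (HMR_chart A c) =
      (- (snd (fst (V (M_chart A c))) + u *\<^sub>R \<xi> c), fst (fst (V (M_chart A c))), u, 0, 0, 0)"
proof -
  let ?w = "((((q, \<xi>), z), V), u)"
  let ?f = "\<lambda>c. case cmap (HMR_chart A c) ?w of (x, p, z, xd, pd, u) \<Rightarrow>
        ((x, p, z, xd, pd, u), (- (pd + u *\<^sub>R p), xd, u, 0 :: 'b, 0 :: 'b, 0 :: real))"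
  let ?g = "\<lambda>c. (- (snd (fst (V (M_chart A c))) + u *\<^sub>R \<xi> c), fst (fst (V (M_chart A c))), u, 0 :: 'b, 0 :: 'b, 0 :: real)"
  note V = HM_setD[OF w]
  have \<xi>: "(q, \<xi>) \<in> cotangent_set A" using cotangent_of_contactM_tangent[OF V] .
  have q: "q \<in> carrier A" using \<xi> by (simp add: cotangent_set_def)
  have dom: "?w \<in> cdom (HMR_chart A c) \<longleftrightarrow> q \<in> cdom c" for c using \<xi> w by simp
  have law: "?g c \<bullet> k = ?g c' \<bullet> jacobian (HMR_chart A c) (HMR_chart A c') ?w k"
    if c: "c \<in> A" "c' \<in> A" "q \<in> cdom c" "q \<in> cdom c'" for c c' k
  proof -
    obtain h r s l where k: "k = (h, r, s, l)" by (metis prod.collapse)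
    obtain h' r' s' l' where j: "jacobian (HMR_chart A c) (HMR_chart A c') ?w (h, r, s, l) = (h', r', s', l')"
      by (metis prod.collapse)
    obtain a b e where l: "l = (a, b, e)" by (metis prod.collapse)
    obtain a' b' e' where l': "l' = (a', b', e')" by (metis prod.collapse)
    let ?xd = "fst (fst (V (M_chart A c)))"
    note jM = jacobian_M_chart[OF A c \<xi> jacobian_HMR_chart[OF A c w j]]
    have "D2 (transition c c') (cmap c q) h ?xd = D2 (transition c c') (cmap c q) ?xd h"
      by (rule D2_symmetric[OF smooth_transition[OF A c(1,2)] open_overlap[OF A c(1,2)]]) (use c in auto)
    with contactM_tangent_change_chart(1)[OF A c V] contactM_tangent_change_chart(2)[OF A c V, of h]
      jM(1,2) jM(3)[of ?xd] cotangent_setD(1)[OF \<xi> c, of h]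
    show ?thesis
      unfolding k unfolding j unfolding l l'
      by (simp add: inner_diff_left inner_minus_left inner_commute[of _ r] inner_commute[of _ r'])
  qed
  have f: "?f c = (cmap (HMR_chart A c) ?w, ?g c)" for c by simp
  show thesis
    by (rule point_by_coords_covector[where N = "HMR_chart A" and f = ?f and g = ?g,
        OF smooth_atlas_HMR[OF A, unfolded HMR_eq] inj_on_subset[OF inj_HMR_chart subset_UNIV]
          q dom law f])
       (use that in \<open>auto simp: theta_eta_def HMR_eq base_point_def\<close>)
qed


section \<open>The two symplectic maps in coordinates\<close>

text \<open>
  Here the second derivative produced by \<open>p'\<^sub>i dq\<^sup>i\<close> cancels against the one produced by the
  transformation of \<open>dq'\<close> in \<open>p\<^sub>i dq'\<^sup>i\<close>.
\<close>

lemma alpha0_eq: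
  assumes A: "smooth_atlas A" and w: "(((q, \<xi>), z), V) \<in> HM_set A"
  obtains v \<zeta> where "alpha0 A ((((q, \<xi>), z), V), u) = (((q, v), z), \<zeta>)"
    "(q, v) \<in> tangent_set A" "(((q, v), z), \<zeta>) \<in> cotangent_set (TQR A)"
    "\<And>c. c \<in> A \<Longrightarrow> q \<in> cdom c \<Longrightarrow> v c = fst (fst (V (M_chart A c)))"
    "\<And>c. c \<in> A \<Longrightarrow> q \<in> cdom c \<Longrightarrow> \<zeta> (TQR_chart A c) =
      ((u *\<^sub>R \<xi> c + snd (fst (V (M_chart A c))), \<xi> c), - u)"
proof -
  let ?w = "((((q, \<xi>), z), V), u)"
  define v where "v c = (if c \<in> A \<and> q \<in> cdom c then fst (fst (V (M_chart A c))) else 0)" for c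
  let ?m = "((q, v), z)"
  let ?f = "\<lambda>c. case cmap (HMR_chart A c) ?w of (x, p, z, xd, pd, u) \<Rightarrow>
        (((x, xd), z), ((u *\<^sub>R p + pd, p), - u))"
  let ?g = "\<lambda>c. ((u *\<^sub>R \<xi> c + snd (fst (V (M_chart A c))), \<xi> c), - u)"
  note V = HM_setD[OF w]
  have \<xi>: "(q, \<xi>) \<in> cotangent_set A" using cotangent_of_contactM_tangent[OF V] .
  have q: "q \<in> carrier A" using \<xi> by (simp add: cotangent_set_def)
  have vc: "v c = fst (fst (V (M_chart A c)))" if "c \<in> A" "q \<in> cdom c" for c
    using that by (simp add: v_def)
  have v: "(q, v) \<in> tangent_set A"
    unfolding tangent_set_def mem_Collect_eq prod.case
  proof (intro conjI allI ballI impI)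
    show "v c = 0" if "\<not> (c \<in> A \<and> q \<in> cdom c)" for c
      using that unfolding v_def by (rule if_not_P)
    show "v c' = jacobian c c' q (v c)" if "c \<in> A" "c' \<in> A" "q \<in> cdom c \<inter> cdom c'" for c c'
      using that contactM_tangent_change_chart(1)[OF A that(1,2) _ _ V] by (simp add: vc)
  qed (rule q)
  have dom: "?m \<in> cdom (TQR_chart A c) \<longleftrightarrow> q \<in> cdom c" for c using v by simp
  have law: "?g c \<bullet> k = ?g c' \<bullet> jacobian (TQR_chart A c) (TQR_chart A c') ?m k"
    if c: "c \<in> A" "c' \<in> A" "q \<in> cdom c" "q \<in> cdom c'" for c c' k
  proof -
    obtain h l s where k: "k = ((h, l), s)" by (metis prod.collapse)
    let ?xd = "fst (fst (V (M_chart A c)))"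
    have "D2 (transition c c') (cmap c q) h ?xd = D2 (transition c c') (cmap c q) ?xd h"
      by (rule D2_symmetric[OF smooth_transition[OF A c(1,2)] open_overlap[OF A c(1,2)]]) (use c in auto)
    with contactM_tangent_change_chart(2)[OF A c V, of h]
      cotangent_setD(1)[OF \<xi> c, of h] cotangent_setD(1)[OF \<xi> c, of l]
    show ?thesis
      unfolding k jacobian_TQR_chart[OF A c v]
      by (simp add: inner_add_left inner_add_right vc c)
  qed
  have f: "?f c = (cmap (TQR_chart A c) ?m, ?g c)" if "c \<in> A" "q \<in> cdom c" for c
    using vc[OF that] by simp
  show thesis
    by (rule point_by_coords_covector[where N = "TQR_chart A" and f = ?f and g = ?g,
        OF smooth_atlas_TQR[OF A, unfolded TQR_eq] inj_on_subset[OF inj_TQR_chart subset_UNIV]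
          q dom law f])
       (use that[of v] v vc in \<open>auto simp: alpha0_def TQR_eq base_point_def\<close>)
qed

text \<open>
  The defining pairings with all tangent vectors determine the components in every chart, because
  each value of the components of a tangent vector is attained; the covector is then built in one
  chart, where the required pairings hold by the coordinate formulas for \<open>\<eta>\<close> and \<open>d\<eta>\<close>.
\<close>

lemma beta0_eq:
  assumes A: "smooth_atlas A" and w: "(((q, \<xi>), z), V) \<in> HM_set A"
  obtains \<zeta> where "beta0 A ((((q, \<xi>), z), V), u) = (((q, \<xi>), z), \<zeta>)"
    "(((q, \<xi>), z), \<zeta>) \<in> cotangent_set (contactM A)"
    "\<And>c. c \<in> A \<Longrightarrow> q \<in> cdom c \<Longrightarrow> \<zeta> (M_chart A c) =
      ((u *\<^sub>R \<xi> c + snd (fst (V (M_chart A c))), - fst (fst (V (M_chart A c)))), - u)"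
proof -
  let ?m = "((q, \<xi>), z)"
  let ?g = "\<lambda>c. ((u *\<^sub>R \<xi> c + snd (fst (V (M_chart A c))), - fst (fst (V (M_chart A c)))), - u)"
  let ?B = "contactM A"
  note V = HM_setD[OF w] and B = smooth_atlas_contactM[OF A]
  have \<xi>: "(q, \<xi>) \<in> cotangent_set A" using cotangent_of_contactM_tangent[OF V] .
  have rhs: "- ext_d ?B (eta A) (?m, V) (?m, W) - u * pairing ?B (eta A ?m) (?m, W) = ?g c \<bullet> W (M_chart A c)"
    if W: "(?m, W) \<in> tangent_set ?B" and c: "c \<in> A" "q \<in> cdom c" for W c
  proof -
    obtain xd pd zd where Vc: "V (M_chart A c) = ((xd, pd), zd)" by (metis prod.collapse)
    obtain xd' pd' zd' where Wc: "W (M_chart A c) = ((xd', pd'), zd')" by (metis prod.collapse)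
    show ?thesis
      by (simp add: ext_d_eta[OF A V Vc W Wc c] pairing_eta[OF A W c Wc] Vc Wc algebra_simps
          inner_add_left inner_commute)
  qed
  define P where "P y \<longleftrightarrow> y \<in> cotangent_set ?B \<and> fst y = ?m \<and>
        (\<forall>W. (?m, W) \<in> tangent_set ?B \<longrightarrow> pairing ?B y (?m, W) =
             - ext_d ?B (eta A) (?m, V) (?m, W) - u * pairing ?B (eta A ?m) (?m, W))" for y
  have C: "M_chart A c \<in> ?B" "?m \<in> cdom (M_chart A c)" if "c \<in> A" "q \<in> cdom c" for c
    using that \<xi> by (auto simp: contactM_eq)
  have P_coords: "\<zeta> (M_chart A c) = ?g c" if P: "P (?m, \<zeta>)" and c: "c \<in> A" "q \<in> cdom c" for \<zeta> c
  proof (rule inner_eqI)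
    fix e
    obtain W where W: "(?m, W) \<in> tangent_set ?B" "W (M_chart A c) = e"
      using tangent_vector_exists[OF B C[OF c]] by blast
    have \<zeta>: "(?m, \<zeta>) \<in> cotangent_set ?B" using P by (simp add: P_def)
    show "\<zeta> (M_chart A c) \<bullet> e = ?g c \<bullet> e"
      using pairing_eq[OF \<zeta> W(1) C[OF c], of ?m] rhs[OF W(1) c] P W by (simp add: P_def)
  qed
  obtain c where c: "c \<in> A" "q \<in> cdom c" using \<xi> by (auto simp: cotangent_set_def carrier_def)
  obtain \<zeta> where \<zeta>: "(?m, \<zeta>) \<in> cotangent_set ?B" "\<zeta> (M_chart A c) = ?g c"
    using covector_exists[OF B C[OF c]] by blast
  have P: "P (?m, \<zeta>)"
    using pairing_eq[OF \<zeta>(1) _ C[OF c]] rhs[OF _ c] \<zeta> by (simp add: P_def)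
  have "beta0 A ((?m, V), u) = (THE y. P y)"
    by (simp add: beta0_def P_def)
  also have "\<dots> = (?m, \<zeta>)"
  proof (rule the_equality[of P, OF P])
    fix y assume y: "P y"
    then obtain \<zeta>' where y_eq: "y = (?m, \<zeta>')" by (metis P_def prod.collapse)
    then have "\<zeta>' = \<zeta>"
      using covector_eqI[OF B _ \<zeta>(1) C[OF c]] y P_coords[of \<zeta>' c] c \<zeta>(2) by (simp add: P_def)
    then show "y = (?m, \<zeta>)" using y_eq by simp
  qed
  finally show thesis using that[of \<zeta>] \<zeta>(1) P_coords[OF P] by blast
qed


section \<open>Both inverse images as one first-order condition on the Lagrangian\<close>

text \<open>
  The equation \<open>dL = (u p\<^sub>i + p'\<^sub>i) dq\<^sup>i + p\<^sub>i dq'\<^sup>i - u dz\<close> at \<open>(q, q', z)\<close>, read in one chart: the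
  form in which the two inverse images are compared.
\<close>

definition legendre_at ::
    "('q, 'e::euclidean_space) chart set \<Rightarrow> (('q, 'e) TQR_pt \<Rightarrow> real) \<Rightarrow> ('q, 'e) chart
      \<Rightarrow> ('q, 'e) TMR_pt \<Rightarrow> bool" where
  "legendre_at A L c w \<longleftrightarrow> (case cmap (HMR_chart A c) w of (x, p, z, xd, pd, u) \<Rightarrow>
     (GDERIV (L \<circ> cinv (TQR_chart A c)) ((x, xd), z) :> ((u *\<^sub>R p + pd, p), - u)))"

lemma alpha0_in_im_d_iff:
  assumes A: "smooth_atlas A" and w: "(((q, \<xi>), z), V) \<in> HM_set A" and c: "c \<in> A" "q \<in> cdom c"
  shows "alpha0 A ((((q, \<xi>), z), V), u) \<in> im_d (TQR A) L \<longleftrightarrow> legendre_at A L c ((((q, \<xi>), z), V), u)"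
proof -
  let ?w = "((((q, \<xi>), z), V), u)"
  obtain v \<zeta> where *: "alpha0 A ?w = (((q, v), z), \<zeta>)"
    "(q, v) \<in> tangent_set A" "(((q, v), z), \<zeta>) \<in> cotangent_set (TQR A)"
    "\<And>c. c \<in> A \<Longrightarrow> q \<in> cdom c \<Longrightarrow> v c = fst (fst (V (M_chart A c)))"
    "\<And>c. c \<in> A \<Longrightarrow> q \<in> cdom c \<Longrightarrow> \<zeta> (TQR_chart A c) =
      ((u *\<^sub>R \<xi> c + snd (fst (V (M_chart A c))), \<xi> c), - u)"
    using alpha0_eq[OF A w, of u] by blast
  let ?m = "((q, v), z)"
  have iff: "legendre_at A L c ?w \<longleftrightarrow>
      (GDERIV (L \<circ> cinv (TQR_chart A c)) (cmap (TQR_chart A c) ?m) :> \<zeta> (TQR_chart A c))"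
    using * c by (simp add: legendre_at_def)
  have C: "TQR_chart A c \<in> TQR A" "?m \<in> cdom (TQR_chart A c)" using c * by (auto simp: TQR_eq)
  show ?thesis
    unfolding iff using *(1,3) C GDERIV_change_chart[OF smooth_atlas_TQR[OF A] C(1) _ C(2) _ *(3)]
    by (auto simp: im_d_def)
qed

lemma whitney_chart_simps [simp]:
  "cdom (whitney_chart A c) =
     {(q, v, \<xi>, z). (q, v) \<in> tangent_set A \<and> (q, \<xi>) \<in> cotangent_set A \<and> q \<in> cdom c}"
  "cmap (whitney_chart A c) (q, v, \<xi>, z) = (cmap c q, v c, \<xi> c, z)"
  by (auto simp: whitney_chart_def)

lemma energy_in_coordinates:
  assumes A: "smooth_atlas A" and c: "c \<in> A" and x: "x \<in> cmap c ` cdom c"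
  shows "energy A L (cinv (whitney_chart A c) (x, k, p, z)) = p \<bullet> k - L (cinv (TQR_chart A c) ((x, k), z))"
proof -
  obtain q where q: "q \<in> cdom c" "x = cmap c q" using x by auto
  obtain v where v: "(q, v) \<in> tangent_set A" "v c = k" using tangent_vector_exists[OF A c q(1)] by blast
  obtain \<xi> where \<xi>: "(q, \<xi>) \<in> cotangent_set A" "\<xi> c = p" using covector_exists[OF A c q(1)] by blast
  have "inj_on (cmap (whitney_chart A c)) (cdom (whitney_chart A c))"
  proof (rule inj_onI)
    fix a b assume ab: "a \<in> cdom (whitney_chart A c)" "b \<in> cdom (whitney_chart A c)"
      "cmap (whitney_chart A c) a = cmap (whitney_chart A c) b"
    obtain q v \<xi> z where a: "a = (q, v, \<xi>, z)" by (metis prod.collapse)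
    obtain q' v' \<xi>' z' where b: "b = (q', v', \<xi>', z')" by (metis prod.collapse)
    have *: "(q, v) \<in> tangent_set A" "(q, \<xi>) \<in> cotangent_set A" "q \<in> cdom c"
      "(q', v') \<in> tangent_set A" "(q', \<xi>') \<in> cotangent_set A" "q' \<in> cdom c"
      "cmap c q = cmap c q'" "v c = v' c" "\<xi> c = \<xi>' c" "z = z'"
      using ab by (auto simp: a b)
    have qq: "q' = q" using inj_onD[OF smooth_atlas_inj[OF A c] *(7,3,6)] by simp
    show "a = b"
      using tangent_vector_eqI[OF A *(1) *(4)[unfolded qq] c *(3,8)]
        covector_eqI[OF A *(2) *(5)[unfolded qq] c *(3,9)] qq *(10) by (simp add: a b)
  qed
  then have "cinv (whitney_chart A c) (cmap (whitney_chart A c) (q, v, \<xi>, z)) = (q, v, \<xi>, z)"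
    unfolding cinv_def by (rule inv_into_f_f) (use v \<xi> q in simp)
  moreover have "cinv (TQR_chart A c) (cmap (TQR_chart A c) ((q, v), z)) = ((q, v), z)"
    by (rule cinv_cmap[OF smooth_atlas_TQR[OF A]]) (use c v q in \<open>auto simp: TQR_eq\<close>)
  ultimately show ?thesis
    using pairing_eq[OF \<xi>(1) v(1) c q(1), of q] v \<xi> q by (simp add: energy_def)
qed

lemma GDERIV_neg_energy:
  assumes A: "smooth_atlas A" and c: "c \<in> A" and x: "x \<in> cmap c ` cdom c"
    and G: "GDERIV (L \<circ> cinv (TQR_chart A c)) ((x, k), z) :> ((a, b), d)"
  shows "GDERIV ((\<lambda>b. - energy A L b) \<circ> cinv (whitney_chart A c)) (x, k, p, z) :> (a, b - p, - k, d)"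
proof -
  let ?X = "(x, k, p, z)"
  let ?i = "\<lambda>Y :: 'b \<times> 'b \<times> 'b \<times> real. ((fst Y, fst (snd Y)), snd (snd (snd Y)))"
  let ?F = "\<lambda>Y. (L \<circ> cinv (TQR_chart A c)) (?i Y) - fst (snd (snd Y)) \<bullet> fst (snd Y)"
  have i: "bounded_linear ?i"
    by (intro bounded_linear_Pair bounded_linear_fst_comp bounded_linear_snd_comp bounded_linear_ident)
  have 1: "((\<lambda>Y. (L \<circ> cinv (TQR_chart A c)) (?i Y)) has_derivative (\<lambda>h. ?i h \<bullet> ((a, b), d))) (at ?X)"
    by (rule has_derivative_compose[OF bounded_linear_imp_has_derivative[OF i]])
       (use G in \<open>simp add: gderiv_def o_def\<close>)
  have 2: "((\<lambda>Y :: 'b \<times> 'b \<times> 'b \<times> real. fst (snd (snd Y)) \<bullet> fst (snd Y)) has_derivative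
      (\<lambda>h. p \<bullet> fst (snd h) + fst (snd (snd h)) \<bullet> k)) (at ?X)"
    by (auto intro!: derivative_eq_intros)
  have "(?F has_derivative (\<lambda>h. h \<bullet> (a, b - p, - k, d))) (at ?X)"
    by (rule has_derivative_eq_rhs[OF has_derivative_diff[OF 1 2]])
       (auto simp: fun_eq_iff inner_diff_right inner_commute)
  then have "((\<lambda>b. - energy A L b) \<circ> cinv (whitney_chart A c) has_derivative (\<lambda>h. h \<bullet> (a, b - p, - k, d))) (at ?X)"
  proof (rule has_derivative_transform_within_open)
    show "open (cmap c ` cdom c \<times> (UNIV :: ('b \<times> 'b \<times> real) set))"
      using open_chart_image[OF A c] by (simp add: open_Times)
    show "?X \<in> cmap c ` cdom c \<times> UNIV" using x by simp
    fix Y assume Y: "Y \<in> cmap c ` cdom c \<times> (UNIV :: ('b \<times> 'b \<times> real) set)"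
    obtain x' k' p' z' where Y_eq: "Y = (x', k', p', z')" by (metis prod.collapse)
    show "?F Y = ((\<lambda>b. - energy A L b) \<circ> cinv (whitney_chart A c)) Y"
      using energy_in_coordinates[OF A c, of x' L k' p' z'] Y by (simp add: Y_eq)
  qed
  then show ?thesis by (simp add: gderiv_def)
qed

text \<open>
  Since \<open>-E = L - p\<^sub>i q'\<^sup>i\<close> has the partial derivatives \<open>\<partial>L/\<partial>q'\<^sup>i - p\<^sub>i\<close> in \<open>q'\<close> and \<open>-q'\<close> in \<open>p\<close>,
  criticality along the fibre is the Legendre condition \<open>p = \<partial>L/\<partial>q'\<close>, and the fibre point is
  recovered from the covector \<open>\<beta>\<^sup>0(w)\<close> as the velocity of \<open>w\<close>.
\<close>

lemma beta0_in_generated_set_iff: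
  assumes A: "smooth_atlas A" and L: "smooth_function (TQR A) L"
    and w: "(((q, \<xi>), z), V) \<in> HM_set A"
  shows "beta0 A ((((q, \<xi>), z), V), u) \<in> generated_set A (\<lambda>b. - energy A L b) \<longleftrightarrow>
    (\<forall>c\<in>A. q \<in> cdom c \<longrightarrow> legendre_at A L c ((((q, \<xi>), z), V), u))"
proof -
  let ?w = "((((q, \<xi>), z), V), u)" and ?m = "((q, \<xi>), z)"
  let ?F = "\<lambda>b. - energy A L b"
  let ?xd = "\<lambda>c. fst (fst (V (M_chart A c)))" and ?pd = "\<lambda>c. snd (fst (V (M_chart A c)))"
  note V = HM_setD[OF w]
  have \<xi>: "(q, \<xi>) \<in> cotangent_set A" using cotangent_of_contactM_tangent[OF V] .
  obtain \<zeta> where \<zeta>: "beta0 A ?w = (?m, \<zeta>)" "(?m, \<zeta>) \<in> cotangent_set (contactM A)"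
    "\<And>c. c \<in> A \<Longrightarrow> q \<in> cdom c \<Longrightarrow> \<zeta> (M_chart A c) = ((u *\<^sub>R \<xi> c + ?pd c, - ?xd c), - u)"
    using beta0_eq[OF A w, of u] by blast
  obtain v where v: "(q, v) \<in> tangent_set A" "\<And>c. c \<in> A \<Longrightarrow> q \<in> cdom c \<Longrightarrow> v c = ?xd c"
    by (rule alpha0_eq[OF A w, of u], rule that, assumption, blast)
  have mem: "beta0 A ?w \<in> generated_set A ?F \<longleftrightarrow> (\<exists>v. (q, v) \<in> tangent_set A \<and>
      (\<forall>c\<in>A. q \<in> cdom c \<longrightarrow> GDERIV (?F \<circ> cinv (whitney_chart A c)) (cmap c q, v c, \<xi> c, z) :>
          (u *\<^sub>R \<xi> c + ?pd c, 0, - ?xd c, - u)))"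
    unfolding \<zeta>(1) generated_set_def using \<zeta>(2,3) by fastforce
  have key: "(GDERIV (?F \<circ> cinv (whitney_chart A c)) (cmap c q, k, \<xi> c, z) :> (u *\<^sub>R \<xi> c + ?pd c, 0, - ?xd c, - u))
      \<longleftrightarrow> k = ?xd c \<and> legendre_at A L c ?w" (is "?l \<longleftrightarrow> ?r") if c: "c \<in> A" "q \<in> cdom c" for c k
  proof -
    let ?f = "L \<circ> cinv (TQR_chart A c)" and ?X = "((cmap c q, k), z)"
    obtain v where vk: "(q, v) \<in> tangent_set A" "v c = k" using tangent_vector_exists[OF A c] by blast
    have "?X \<in> cmap (TQR_chart A c) ` cdom (TQR_chart A c)"
      using vk c by (intro image_eqI[of _ _ "((q, v), z)"]) auto
    moreover have "smooth_on (cmap (TQR_chart A c) ` cdom (TQR_chart A c)) ?f"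
      using L c by (simp add: smooth_function_def TQR_eq)
    ultimately have G: "GDERIV ?f ?X :> grad ?f ?X"
      using smooth_on_differentiable GDERIV_grad by blast
    obtain a b d where abd: "grad ?f ?X = ((a, b), d)" by (metis prod.collapse)
    have E: "GDERIV (?F \<circ> cinv (whitney_chart A c)) (cmap c q, k, \<xi> c, z) :> (a, b - \<xi> c, - k, d)"
      by (rule GDERIV_neg_energy[OF A c(1) imageI[OF c(2)] G[unfolded abd]])
    have "?l \<longleftrightarrow> (a, b - \<xi> c, - k, d) = (u *\<^sub>R \<xi> c + ?pd c, 0, - ?xd c, - u)"
      using E GDERIV_unique by metis
    also have "\<dots> \<longleftrightarrow> k = ?xd c \<and> ((a, b), d) = ((u *\<^sub>R \<xi> c + ?pd c, \<xi> c), - u)"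
      by auto
    also have "\<dots> \<longleftrightarrow> k = ?xd c \<and> legendre_at A L c ?w"
      using G[unfolded abd] GDERIV_unique by (auto simp: legendre_at_def)
    finally show ?thesis .
  qed
  show ?thesis
    unfolding mem using key v by (metis (no_types, lifting))
qed


section \<open>The Lagrangian submanifold\<close>

text \<open>
  A curve representing a tangent vector stays in any given chart around its starting point for a
  short time, and its velocity there is the component of the vector in that chart.
\<close>

lemma tangent_to_in_chart:
  assumes B: "smooth_atlas B" and c: "c \<in> B" "x \<in> cdom c" and v: "(x, v) \<in> tangent_to B S x"
  obtains \<delta> \<gamma> where "\<delta> > 0" "\<gamma> 0 = x" "\<And>t. \<bar>t\<bar> < \<delta> \<Longrightarrow> \<gamma> t \<in> S \<inter> cdom c"
    "((\<lambda>t. cmap c (\<gamma> t)) has_vector_derivative v c) (at (0::real))"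
proof -
  obtain d \<epsilon> \<gamma> where d: "d \<in> B" "\<epsilon> > 0" "\<gamma> 0 = x" "\<gamma> ` {-\<epsilon><..<\<epsilon>} \<subseteq> S \<inter> cdom d"
    and vd: "((cmap d \<circ> \<gamma>) has_vector_derivative v d) (at (0::real))" and vt: "(x, v) \<in> tangent_set B"
    using v unfolding tangent_to_def by blast
  have x: "x \<in> cdom d" using d by force
  let ?O = "cmap d ` (cdom d \<inter> cdom c)"
  have op: "open ?O" by (rule open_overlap[OF B d(1) c(1)])
  have "isCont (cmap d \<circ> \<gamma>) 0" using has_vector_derivative_continuous[OF vd] .
  moreover have "(cmap d \<circ> \<gamma>) 0 \<in> ?O" using d x c by auto
  ultimately have "eventually (\<lambda>t. (cmap d \<circ> \<gamma>) t \<in> ?O) (at 0)"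
    using op topological_tendstoD unfolding continuous_at by metis
  then obtain \<delta>' where \<delta>': "\<delta>' > 0" "\<And>t. t \<noteq> 0 \<Longrightarrow> dist t 0 < \<delta>' \<Longrightarrow> (cmap d \<circ> \<gamma>) t \<in> ?O"
    unfolding eventually_at by auto
  define \<delta> where "\<delta> = min \<delta>' \<epsilon>"
  have in_dom: "\<gamma> t \<in> S" "\<gamma> t \<in> cdom d" "\<gamma> t \<in> cdom c" if t: "\<bar>t\<bar> < \<delta>" for t
  proof -
    have "t \<in> {-\<epsilon><..<\<epsilon>}" using t by (auto simp: \<delta>_def)
    then show S: "\<gamma> t \<in> S" and D: "\<gamma> t \<in> cdom d" using d(4) by blast+
    have "cmap d (\<gamma> t) \<in> ?O"
    proof (cases "t = 0")
      case False
      then show ?thesis using \<delta>'(2)[of t] t by (simp add: \<delta>_def)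
    qed (use d x c in auto)
    then obtain y where "cmap d (\<gamma> t) = cmap d y" "y \<in> cdom d" "y \<in> cdom c" by auto
    then show "\<gamma> t \<in> cdom c" using inj_onD[OF smooth_atlas_inj[OF B d(1)]] D by metis
  qed
  have "((\<lambda>t. transition d c ((cmap d \<circ> \<gamma>) t)) has_derivative (\<lambda>s. jacobian d c x (s *\<^sub>R v d))) (at 0)"
    by (rule has_derivative_compose[OF vd[unfolded has_vector_derivative_def]])
       (use transition_has_derivative[OF B d(1) c(1) x c(2)] d(3) in simp)
  then have "((\<lambda>t. cmap c (\<gamma> t)) has_derivative (\<lambda>s. jacobian d c x (s *\<^sub>R v d))) (at 0)"
  proof (rule has_derivative_transform_within_open[where s = "{-\<delta><..<\<delta>}"])
    show "transition d c ((cmap d \<circ> \<gamma>) t) = cmap c (\<gamma> t)" if "t \<in> {-\<delta><..<\<delta>}" for t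
      using in_dom(2)[of t] that transition_cmap[OF B d(1)] by (auto simp: abs_less_iff)
  qed (use \<delta>' d in \<open>auto simp: \<delta>_def\<close>)
  moreover have "jacobian d c x (s *\<^sub>R v d) = s *\<^sub>R v c" for s
    using linear_scale[OF linear_jacobian[OF B d(1) c(1) x c(2)]] tangent_setD(1)[OF vt d(1) c(1) x c(2)]
    by simp
  ultimately have "((\<lambda>t. cmap c (\<gamma> t)) has_vector_derivative v c) (at 0)"
    by (simp add: has_vector_derivative_def)
  moreover have "\<delta> > 0" using \<delta>' d by (simp add: \<delta>_def)
  ultimately show thesis using that[of \<delta> \<gamma>] d(3) in_dom by blast
qed

lemma omega_eta_eq:
  assumes A: "smooth_atlas A" and w: "(((q, \<xi>), z), V) \<in> HM_set A"
    and a: "(((((q, \<xi>), z), V), u), a) \<in> tangent_set (HMR A)"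
      "a (HMR_chart A c) = (ax, ap, az, axd, apd, au)"
    and b: "(((((q, \<xi>), z), V), u), b) \<in> tangent_set (HMR A)"
      "b (HMR_chart A c) = (bx, bp, bz, bxd, bpd, bu)"
    and c: "c \<in> A" "q \<in> cdom c"
  shows "omega_eta A (((((q, \<xi>), z), V), u), a) (((((q, \<xi>), z), V), u), b) =
    (- ((apd + u *\<^sub>R ap + au *\<^sub>R \<xi> c) \<bullet> bx) + axd \<bullet> bp + au * bz)
    - (- ((bpd + u *\<^sub>R bp + bu *\<^sub>R \<xi> c) \<bullet> ax) + bxd \<bullet> ap + bu * az)"
proof -
  note H = smooth_atlas_HMR[OF A]
  let ?w = "((((q, \<xi>), z), V), u)"
  let ?f = "\<lambda>X :: 'b \<times> 'b \<times> real \<times> 'b \<times> 'b \<times> real. (- (fst (snd (snd (snd (snd X))))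
      + snd (snd (snd (snd (snd X)))) *\<^sub>R fst (snd X)), fst (snd (snd (snd X))),
      snd (snd (snd (snd (snd X)))), 0 :: 'b, 0 :: 'b, 0 :: real)"
  let ?D = "\<lambda>X h :: 'b \<times> 'b \<times> real \<times> 'b \<times> 'b \<times> real. (- (fst (snd (snd (snd (snd h))))
      + (snd (snd (snd (snd (snd X)))) *\<^sub>R fst (snd h) + snd (snd (snd (snd (snd h)))) *\<^sub>R fst (snd X))),
      fst (snd (snd (snd h))), snd (snd (snd (snd (snd h)))), 0 :: 'b, 0 :: 'b, 0 :: real)"
  have f: "(?f has_derivative ?D X) (at X)" for X
    by (intro has_derivative_Pair has_derivative_minus has_derivative_add has_derivative_scaleR
        has_derivative_fst has_derivative_snd has_derivative_ident has_derivative_const)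
  have D: "((\<lambda>y. snd (theta_eta A (cinv (HMR_chart A c) y)) (HMR_chart A c)) has_derivative ?D X) (at X)"
    if c: "c \<in> A" and X: "X \<in> cmap (HMR_chart A c) ` cdom (HMR_chart A c)" for c X
  proof (rule has_derivative_transform_within_open[OF f open_chart_image[OF H] X])
    show C: "HMR_chart A c \<in> HMR A" using c by (simp add: HMR_eq)
    fix Y assume "Y \<in> cmap (HMR_chart A c) ` cdom (HMR_chart A c)"
    then obtain n where n: "n \<in> cdom (HMR_chart A c)" "Y = cmap (HMR_chart A c) n" by auto
    obtain q \<xi> z V u where n_eq: "n = ((((q, \<xi>), z), V), u)" by (metis prod.collapse)
    have n': "(((q, \<xi>), z), V) \<in> HM_set A" "q \<in> cdom c" using n n_eq by auto
    obtain \<zeta> where "theta_eta A n = (n, \<zeta>)" "\<zeta> (HMR_chart A c) =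
      (- (snd (fst (V (M_chart A c))) + u *\<^sub>R \<xi> c), fst (fst (V (M_chart A c))), u, 0, 0, 0)"
      using theta_eta_eq[OF A n'(1), of u] c n'(2) unfolding n_eq by metis
    then show "?f Y = snd (theta_eta A (cinv (HMR_chart A c) Y)) (HMR_chart A c)"
      using cinv_cmap[OF H C n(1)] n(2) n_eq by simp
  qed
  have \<sigma>: "fst (theta_eta A y) = y \<and> theta_eta A y \<in> cotangent_set (HMR A)"
    if y: "y \<in> carrier (HMR A)" for y
  proof -
    obtain q \<xi> z V u where y_eq: "y = ((((q, \<xi>), z), V), u)" by (metis prod.collapse)
    then have "(((q, \<xi>), z), V) \<in> HM_set A" using y carrier_HMR by blast
    then show ?thesis using theta_eta_eq[OF A, of q \<xi> z V u] y_eq by (metis fst_conv)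
  qed
  have diff: "(\<lambda>y. snd (theta_eta A (cinv C y)) C) differentiable at y"
    if C: "C \<in> HMR A" and y: "y \<in> cmap C ` cdom C" for C y
  proof -
    obtain c where "c \<in> A" "C = HMR_chart A c" using C by (auto simp: HMR_eq)
    then show ?thesis using D[of c y] y unfolding differentiable_def by blast
  qed
  have \<xi>: "(q, \<xi>) \<in> cotangent_set A" using cotangent_of_contactM_tangent[OF HM_setD[OF w]] .
  have C: "HMR_chart A c \<in> HMR A" "?w \<in> cdom (HMR_chart A c)"
    using c \<xi> w by (auto simp: HMR_eq)
  let ?X = "cmap (HMR_chart A c) ?w"
  have "ext_d (HMR A) (theta_eta A) (?w, a) (?w, b)
    = ?D ?X (a (HMR_chart A c)) \<bullet> b (HMR_chart A c) - ?D ?X (b (HMR_chart A c)) \<bullet> a (HMR_chart A c)"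
    by (rule ext_d_eq[OF H \<sigma> diff a(1) b(1) C D[OF c(1) imageI[OF C(2)]]])
  then show ?thesis
    unfolding omega_eta_def
    by (simp add: a(2) b(2) algebra_simps inner_diff_left inner_minus_left)
qed

text \<open>
  The tangent vectors to the submanifold satisfy the linearization of
  \<open>dL = (u p + p') dq + p dq' - u dz\<close>. Because the Hessian of \<open>L\<close> is self-adjoint,
  these equations make the symplectic form vanish.
\<close>

lemma tangent_to_legendre:
  assumes A: "smooth_atlas A"
    and w: "(((q, \<xi>), z), V) \<in> HM_set A" and c: "c \<in> A" "q \<in> cdom c"
    and S: "\<And>w. w \<in> S \<Longrightarrow> w \<in> cdom (HMR_chart A c) \<Longrightarrow> legendre_at A L c w"
    and a: "(((((q, \<xi>), z), V), u), a) \<in> tangent_to (HMR A) S ((((q, \<xi>), z), V), u)"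
      "a (HMR_chart A c) = (ax, ap, az, axd, apd, au)"
    and G: "(grad (L \<circ> cinv (TQR_chart A c)) has_derivative G)
      (at ((cmap c q, fst (fst (V (M_chart A c)))), z))"
  shows "G ((ax, axd), az) = ((apd + u *\<^sub>R ap + au *\<^sub>R \<xi> c, ap), - au)"
proof -
  let ?w = "((((q, \<xi>), z), V), u)" and ?C = "HMR_chart A c" and ?l = "L \<circ> cinv (TQR_chart A c)"
  have \<xi>: "(q, \<xi>) \<in> cotangent_set A" using cotangent_of_contactM_tangent[OF HM_setD[OF w]] .
  have C: "?C \<in> HMR A" "?w \<in> cdom ?C"
    using c \<xi> w by (auto simp: HMR_eq)
  obtain \<delta> \<gamma> where \<gamma>: "\<delta> > 0" "\<gamma> 0 = ?w" "\<And>t. \<bar>t\<bar> < \<delta> \<Longrightarrow> \<gamma> t \<in> S \<inter> cdom ?C"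
    "((\<lambda>t. cmap ?C (\<gamma> t)) has_vector_derivative a ?C) (at (0::real))"
    using tangent_to_in_chart[OF smooth_atlas_HMR[OF A] C a(1)] by blast
  let ?k = "\<lambda>t. cmap ?C (\<gamma> t)"
  let ?bar = "\<lambda>X :: 'b \<times> 'b \<times> real \<times> 'b \<times> 'b \<times> real. ((fst X, fst (snd (snd (snd X)))), fst (snd (snd X)))"
  let ?E = "\<lambda>X :: 'b \<times> 'b \<times> real \<times> 'b \<times> 'b \<times> real.
     ((snd (snd (snd (snd (snd X)))) *\<^sub>R fst (snd X) + fst (snd (snd (snd (snd X)))), fst (snd X)),
      - snd (snd (snd (snd (snd X)))))"
  let ?DE = "\<lambda>X h :: 'b \<times> 'b \<times> real \<times> 'b \<times> 'b \<times> real.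
     (((snd (snd (snd (snd (snd X)))) *\<^sub>R fst (snd h) + snd (snd (snd (snd (snd h)))) *\<^sub>R fst (snd X))
       + fst (snd (snd (snd (snd h)))), fst (snd h)), - snd (snd (snd (snd (snd h)))))"
  have k0: "?k 0 = (cmap c q, \<xi> c, z, fst (fst (V (M_chart A c))), snd (fst (V (M_chart A c))), u)"
    by (simp add: \<gamma>(2))
  have k: "(?k has_derivative (\<lambda>s. s *\<^sub>R a ?C)) (at 0)"
    using \<gamma>(4) by (simp add: has_vector_derivative_def)
  have eq: "grad ?l (?bar (?k t)) = ?E (?k t)" if t: "\<bar>t\<bar> < \<delta>" for t
  proof -
    obtain q' \<xi>' z' V' u' where g: "\<gamma> t = ((((q', \<xi>'), z'), V'), u')" by (metis prod.collapse)
    have G: "GDERIV ?l (?bar (?k t)) :> ?E (?k t)"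
      using S[of "\<gamma> t"] \<gamma>(3)[OF t] by (auto simp: legendre_at_def g)
    moreover have "GDERIV ?l (?bar (?k t)) :> grad ?l (?bar (?k t))"
      by (rule GDERIV_grad) (use G in \<open>auto simp: gderiv_def differentiable_def\<close>)
    ultimately show ?thesis using GDERIV_unique by blast
  qed
  have "(?bar has_derivative ?bar) (at X)" for X
    by (intro has_derivative_Pair has_derivative_fst has_derivative_snd has_derivative_ident)
  from has_derivative_compose[OF k this]
  have "((\<lambda>t. ?bar (?k t)) has_derivative (\<lambda>s. ?bar (s *\<^sub>R a ?C))) (at 0)" .
  from has_derivative_compose[OF this, of "grad ?l" G]
  have 1: "((\<lambda>t. grad ?l (?bar (?k t))) has_derivative (\<lambda>s. G (?bar (s *\<^sub>R a ?C)))) (at 0)"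
    using G by (simp add: \<gamma>(2))
  have "(?E has_derivative ?DE X) (at X)" for X
    by (intro has_derivative_Pair has_derivative_minus has_derivative_add has_derivative_scaleR
        has_derivative_fst has_derivative_snd has_derivative_ident)
  from has_derivative_compose[OF k this]
  have 2: "((\<lambda>t. ?E (?k t)) has_derivative (\<lambda>s. ?DE (?k 0) (s *\<^sub>R a ?C))) (at 0)" .
  have "((\<lambda>t. ?E (?k t)) has_derivative (\<lambda>s. G (?bar (s *\<^sub>R a ?C)))) (at 0)"
  proof (rule has_derivative_transform_within_open[OF 1, where s = "{-\<delta><..<\<delta>}"])
    show "grad ?l (?bar (?k t)) = ?E (?k t)" if "t \<in> {-\<delta><..<\<delta>}" for t
      by (rule eq) (use that in auto)
  qed (use \<gamma>(1) in auto)
  from fun_cong[OF has_derivative_unique[OF this 2], of 1]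
  show ?thesis by (simp add: k0 a(2) algebra_simps)
qed

text \<open>
  With \<open>a\<close> and \<open>b\<close> rewritten by the linearized equations, \<open>\<omega>\<^sub>\<eta>(a, b)\<close> is the Hessian of \<open>L\<close>
  applied to the \<open>(q, q', z)\<close> parts of \<open>b\<close> and \<open>a\<close>, minus the same with \<open>a\<close> and \<open>b\<close> exchanged.
\<close>

lemma submanifold_isotropic:
  assumes A: "smooth_atlas A" and L: "smooth_function (TQR A) L"
    and S: "S \<subseteq> carrier (HMR A)"
      "\<And>c w. c \<in> A \<Longrightarrow> w \<in> S \<Longrightarrow> w \<in> cdom (HMR_chart A c) \<Longrightarrow> legendre_at A L c w"
    and x: "x \<in> S" and a: "a \<in> tangent_to (HMR A) S x" and b: "b \<in> tangent_to (HMR A) S x"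
  shows "omega_eta A a b = 0"
proof -
  obtain q \<xi> z V u where x_eq: "x = ((((q, \<xi>), z), V), u)" by (metis prod.collapse)
  have w: "(((q, \<xi>), z), V) \<in> HM_set A" using x S(1) carrier_HMR x_eq by blast
  have \<xi>: "(q, \<xi>) \<in> cotangent_set A" using cotangent_of_contactM_tangent[OF HM_setD[OF w]] .
  obtain c where c: "c \<in> A" "q \<in> cdom c" using \<xi> by (auto simp: cotangent_set_def carrier_def)
  obtain a' where a': "a = (x, a')" "(x, a') \<in> tangent_set (HMR A)"
    using a by (auto simp: tangent_to_def)
  obtain b' where b': "b = (x, b')" "(x, b') \<in> tangent_set (HMR A)"
    using b by (auto simp: tangent_to_def)
  obtain ax ap az axd apd au where ac: "a' (HMR_chart A c) = (ax, ap, az, axd, apd, au)"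
    by (metis prod.collapse)
  obtain bx bp bz bxd bpd bu where bc: "b' (HMR_chart A c) = (bx, bp, bz, bxd, bpd, bu)"
    by (metis prod.collapse)
  let ?l = "L \<circ> cinv (TQR_chart A c)" and ?C = "TQR_chart A c"
  let ?X = "((cmap c q, fst (fst (V (M_chart A c)))), z)"
  have C: "?C \<in> TQR A" using c by (simp add: TQR_eq)
  have l: "smooth_on (cmap ?C ` cdom ?C) ?l" using L C unfolding smooth_function_def by blast
  have op: "open (cmap ?C ` cdom ?C)" by (rule open_chart_image[OF smooth_atlas_TQR[OF A] C])
  obtain v where v: "(q, v) \<in> tangent_set A" "v c = fst (fst (V (M_chart A c)))"
    using tangent_vector_exists[OF A c] by blast
  have X: "?X \<in> cmap ?C ` cdom ?C"
    using v c by (intro image_eqI[of _ _ "((q, v), z)"]) auto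
  obtain G where G: "(grad ?l has_derivative G) (at ?X)"
    using smooth_on_has_derivative[OF smooth_on_grad[OF op l] X] by blast
  have Ga: "G ((ax, axd), az) = ((apd + u *\<^sub>R ap + au *\<^sub>R \<xi> c, ap), - au)"
    by (rule tangent_to_legendre[OF A w c S(2)[OF c(1)] a[unfolded a' x_eq] ac G])
  have Gb: "G ((bx, bxd), bz) = ((bpd + u *\<^sub>R bp + bu *\<^sub>R \<xi> c, bp), - bu)"
    by (rule tangent_to_legendre[OF A w c S(2)[OF c(1)] b[unfolded b' x_eq] bc G])
  have "G ((ax, axd), az) \<bullet> ((bx, bxd), bz) = G ((bx, bxd), bz) \<bullet> ((ax, axd), az)"
    by (rule grad_has_derivative_symmetric[OF op X l G])
  then show ?thesis
    unfolding a' b' x_eq omega_eta_eq[OF A w a'(2)[unfolded x_eq] ac b'(2)[unfolded x_eq] bc c] Ga Gb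
    by (simp add: inner_commute[of ap] inner_commute[of bp])
qed

text \<open>
  In a chart the set is the graph of a smooth map \<open>(q, q', z) \<mapsto> (p, p', u)\<close>, and subtracting that
  map is a global straightening.
\<close>

lemma submanifold_embedded:
  fixes A :: "('q, 'e::euclidean_space) chart set"
  assumes A: "smooth_atlas A" and L: "smooth_function (TQR A) L"
    and S: "S \<subseteq> carrier (HMR A)"
      "\<And>c w. c \<in> A \<Longrightarrow> w \<in> cdom (HMR_chart A c) \<Longrightarrow> w \<in> S \<longleftrightarrow> legendre_at A L c w"
  shows "embedded_submanifold (HMR A) (2 * DIM('e) + 1) S"
  unfolding embedded_submanifold_def
proof (intro conjI ballI S(1))
  fix x assume x: "x \<in> S"
  then obtain c where c: "c \<in> A" and xc: "x \<in> cdom (HMR_chart A c)"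
    using S(1) by (auto simp: carrier_def HMR_eq)
  let ?H = "HMR_chart A c" and ?C = "TQR_chart A c" and ?l = "L \<circ> cinv (TQR_chart A c)"
  let ?W = "cmap c ` cdom c \<times> (UNIV :: ('e \<times> real \<times> 'e \<times> 'e \<times> real) set)"
  have W: "cmap ?H ` cdom ?H = ?W" using HMR_overlap[OF A c, of c] by simp
  have opW: "open ?W" using open_chart_image[OF A c] by (simp add: open_Times)
  have C: "?C \<in> TQR A" using c by (simp add: TQR_eq)
  have opC: "open (cmap ?C ` cdom ?C)" by (rule open_chart_image[OF smooth_atlas_TQR[OF A] C])
  have l: "smooth_on (cmap ?C ` cdom ?C) ?l" using L C unfolding smooth_function_def by blast
  have C_image: "((y, k), z) \<in> cmap ?C ` cdom ?C" if "y \<in> cmap c ` cdom c" for y k z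
  proof -
    obtain q where q: "q \<in> cdom c" "y = cmap c q" using \<open>y \<in> cmap c ` cdom c\<close> by auto
    obtain v where v: "(q, v) \<in> tangent_set A" "v c = k"
      using tangent_vector_exists[OF A c q(1)] by blast
    then show ?thesis using q by (intro image_eqI[of _ _ "((q, v), z)"]) auto
  qed
  define g :: "'e \<times> 'e \<times> real \<times> 'e \<times> 'e \<times> real \<Rightarrow> ('e \<times> 'e) \<times> real"
    where "g X = grad ?l ((fst X, fst (snd (snd (snd X)))), fst (snd (snd X)))" for X
  \<comment> \<open>subtracting the shift turns \<open>p\<close>, \<open>p'\<close>, \<open>u\<close> into their deviations from the values forced by \<open>dL\<close>\<close>
  define shift :: "'e \<times> 'e \<times> real \<times> 'e \<times> 'e \<times> real \<Rightarrow> 'e \<times> 'e \<times> real \<times> 'e \<times> 'e \<times> real"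
    where "shift X = (0, snd (fst (g X)), 0, 0, fst (fst (g X)) + snd (g X) *\<^sub>R snd (fst (g X)), - snd (g X))" for X
  define \<Psi> where "\<Psi> X = X - shift X" for X
  define \<Psi>' where "\<Psi>' X = X + shift X" for X
  define K :: "('e \<times> 'e \<times> real \<times> 'e \<times> 'e \<times> real) set"
    where "K = range (\<lambda>((y, k), z). (y, 0, z, k, 0, 0))"
  have sg: "smooth_on ?W g"
    unfolding g_def
    by (rule smooth_on_compose[OF opW opC _ smooth_on_grad[OF opC l]])
       (use opW C_image in \<open>auto intro!: smooth_on_intros smooth_on_fst' smooth_on_snd' smooth_on_ident\<close>)
  have ss: "smooth_on ?W shift"
    unfolding shift_def[abs_def] using opW sg
    by (intro smooth_on_intros smooth_on_fst' smooth_on_snd')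
  (* the shift depends only on q, z and q', and translation by it leaves these fixed *)
  have sh: "shift (X + shift X) = shift X" "shift (X - shift X) = shift X" for X
    by (simp_all add: shift_def g_def)
  have inv: "\<Psi>' (\<Psi> X) = X" "\<Psi> (\<Psi>' X) = X" for X
    by (simp_all add: \<Psi>_def \<Psi>'_def sh)
  have mem: "\<Psi> X \<in> ?W" "\<Psi>' X \<in> ?W" if "X \<in> ?W" for X
    using that by (auto simp: \<Psi>_def \<Psi>'_def shift_def mem_Times_iff)
  have \<Psi>W: "\<Psi> ` ?W = ?W"
  proof
    show "\<Psi> ` ?W \<subseteq> ?W" using mem(1) by blast
    show "?W \<subseteq> \<Psi> ` ?W" using mem(2) inv(2) by (metis image_eqI subsetI)
  qed
  have lin: "linear (\<lambda>((y :: 'e, k :: 'e), z :: real). (y, 0 :: 'e, z, k, 0 :: 'e, 0 :: real))"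
    by (rule linearI) auto
  have K: "subspace K" unfolding K_def by (rule linear_subspace_image[OF lin subspace_UNIV])
  have dimK: "dim K = 2 * DIM('e) + 1"
    unfolding K_def using dim_image_eq[OF lin, of UNIV] by (auto simp: inj_on_def)
  have in_K: "\<Psi> (cmap ?H w) \<in> K \<longleftrightarrow> w \<in> S" if w: "w \<in> cdom ?H" for w
  proof -
    obtain q \<xi> z V u where w_eq: "w = ((((q, \<xi>), z), V), u)" by (metis prod.collapse)
    obtain xd pd where V: "fst (V (M_chart A c)) = (xd, pd)" by (metis prod.collapse)
    let ?X = "((cmap c q, xd), z)"
    obtain gx gv gz where G: "grad ?l ?X = ((gx, gv), gz)" by (metis prod.collapse)
    have q: "q \<in> cdom c" using w by (auto simp: w_eq)
    have "GDERIV ?l ?X :> ((gx, gv), gz)"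
      unfolding G[symmetric] by (rule GDERIV_grad[OF smooth_on_differentiable[OF l C_image]]) (use q in simp)
    then have "legendre_at A L c w \<longleftrightarrow> ((gx, gv), gz) = ((u *\<^sub>R \<xi> c + pd, \<xi> c), - u)"
      using GDERIV_unique by (auto simp: legendre_at_def w_eq V)
    also have "\<dots> \<longleftrightarrow> \<xi> c = gv \<and> pd = gx + gz *\<^sub>R gv \<and> u = - gz"
      by auto
    also have "\<dots> \<longleftrightarrow> \<Psi> (cmap ?H w) \<in> K"
      by (auto simp: w_eq V \<Psi>_def shift_def g_def G K_def image_iff)
    finally show ?thesis using S(2)[OF c w] by simp
  qed
  have straight: "\<Psi> ` (?W \<inter> cmap ?H ` (S \<inter> cdom ?H)) = \<Psi> ` ?W \<inter> K"
  proof (intro equalityI subsetI)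
    fix Y assume "Y \<in> \<Psi> ` (?W \<inter> cmap ?H ` (S \<inter> cdom ?H))"
    then obtain X where Y: "Y = \<Psi> X" and X: "X \<in> ?W \<inter> cmap ?H ` (S \<inter> cdom ?H)" by (rule imageE)
    from IntD2[OF X] obtain w where w: "w \<in> S" "w \<in> cdom ?H" "X = cmap ?H w" by (elim imageE IntE)
    then have "\<Psi> X \<in> K" using in_K[OF w(2)] by simp
    then show "Y \<in> \<Psi> ` ?W \<inter> K" unfolding Y using IntD1[OF X] by (intro IntI imageI)
  next
    fix Y assume "Y \<in> \<Psi> ` ?W \<inter> K"
    then have "Y \<in> \<Psi> ` ?W" and YK: "Y \<in> K" by (rule IntD1, rule IntD2)
    then obtain X where X: "X \<in> ?W" "Y = \<Psi> X" by (elim imageE)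
    from X(1)[folded W] obtain w where w: "w \<in> cdom ?H" "X = cmap ?H w" by (rule imageE)
    then have "w \<in> S" using in_K[OF w(1)] X(2) YK by simp
    then have "X \<in> cmap ?H ` (S \<inter> cdom ?H)" unfolding w(2) using w(1) by (intro imageI IntI)
    then show "Y \<in> \<Psi> ` (?W \<inter> cmap ?H ` (S \<inter> cdom ?H))"
      unfolding X(2) using X(1) by (intro imageI IntI)
  qed
  have smooth: "smooth_on ?W \<Psi>" "smooth_on ?W \<Psi>'"
    unfolding \<Psi>_def[abs_def] \<Psi>'_def[abs_def] using opW ss
    by (auto intro!: smooth_on_add smooth_on_diff smooth_on_ident)
  have main: "open ?W \<and> cmap ?H x \<in> ?W \<and> ?W \<subseteq> cmap ?H ` cdom ?H \<and>
      open (\<Psi> ` ?W) \<and> smooth_on ?W \<Psi> \<and> smooth_on (\<Psi> ` ?W) \<Psi>' \<and> (\<forall>y\<in>?W. \<Psi>' (\<Psi> y) = y) \<and>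
      subspace K \<and> dim K = 2 * DIM('e) + 1 \<and>
      \<Psi> ` (?W \<inter> cmap ?H ` (S \<inter> cdom ?H)) = \<Psi> ` ?W \<inter> K"
    unfolding straight unfolding \<Psi>W W
    by (intro conjI ballI opW smooth inv(1) K dimK refl order_refl imageI[OF xc, of "cmap ?H", unfolded W])
  have H: "?H \<in> HMR A" using c by (simp add: HMR_eq)
  show "\<exists>C\<in>HMR A. x \<in> cdom C \<and>
    (\<exists>W (\<Psi> :: 'e \<times> 'e \<times> real \<times> 'e \<times> 'e \<times> real \<Rightarrow> 'e \<times> 'e \<times> real \<times> 'e \<times> 'e \<times> real) \<Psi>' K.
      open W \<and> cmap C x \<in> W \<and> W \<subseteq> cmap C ` cdom C \<and>
      open (\<Psi> ` W) \<and> smooth_on W \<Psi> \<and> smooth_on (\<Psi> ` W) \<Psi>' \<and> (\<forall>y\<in>W. \<Psi>' (\<Psi> y) = y) \<and>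
      subspace K \<and> dim K = 2 * DIM('e) + 1 \<and>
      \<Psi> ` (W \<inter> cmap C ` (S \<inter> cdom C)) = \<Psi> ` W \<inter> K)"
    by (rule bexI[OF _ H], intro conjI[OF xc], rule exI[of _ ?W], rule exI[of _ \<Psi>],
        rule exI[of _ \<Psi>'], rule exI[of _ K], rule main)
qed


section \<open>The Legendre transformation\<close>

theorem mainTheorem5:
  fixes Q :: "('q, 'e::euclidean_space) chart set"
    and L :: "('q, 'e) TQR_pt \<Rightarrow> real"
  assumes "smooth_manifold Q"
    and "smooth_function (TQR Q) L"
  shows "let E = energy Q L;
             S = carrier (HMR Q) \<inter> beta0 Q -` generated_set Q (\<lambda>b. - E b)
         in S = carrier (HMR Q) \<inter> alpha0 Q -` im_d (TQR Q) L \<and>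
            lagrangian_submanifold (HMR Q) (omega_eta Q) S \<and>
            (\<forall>c\<in>Q. cmap (TMR_chart Q c) ` (S \<inter> cdom (TMR_chart Q c)) =
               {((((x, Lv), z), ((xd, Lz *\<^sub>R Lv + Lx), zd)), - Lz) | x xd z zd Lx Lv Lz.
                  x \<in> cmap c ` cdom c \<and>
                  (GDERIV (L \<circ> cinv (TQR_chart Q c)) ((x, xd), z) :> ((Lx, Lv), Lz)) \<and>
                  zd = xd \<bullet> Lv})"
proof -
  have A: "smooth_atlas Q" using assms(1) by (simp add: smooth_manifold_def)
  note L = assms(2)
  define S where "S = carrier (HMR Q) \<inter> beta0 Q -` generated_set Q (\<lambda>b. - energy Q L b)"
  have S_sub: "S \<subseteq> carrier (HMR Q)" by (simp add: S_def)
  have iffs: "(w \<in> S \<longleftrightarrow> legendre_at Q L c w) \<and> (alpha0 Q w \<in> im_d (TQR Q) L \<longleftrightarrow> legendre_at Q L c w)"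
    if c: "c \<in> Q" and w: "w \<in> cdom (HMR_chart Q c)" for c w
  proof -
    obtain q \<xi> z V u where w_eq: "w = ((((q, \<xi>), z), V), u)" by (metis prod.collapse)
    have h: "(((q, \<xi>), z), V) \<in> HM_set Q" "q \<in> cdom c" using w by (auto simp: w_eq)
    have "w \<in> S \<longleftrightarrow> (\<forall>d\<in>Q. q \<in> cdom d \<longrightarrow> legendre_at Q L d w)"
      using beta0_in_generated_set_iff[OF A L h(1), of u] h(1) carrier_HMR unfolding S_def w_eq by blast
    moreover have "legendre_at Q L d w \<longleftrightarrow> alpha0 Q w \<in> im_d (TQR Q) L" if "d \<in> Q" "q \<in> cdom d" for d
      using alpha0_in_im_d_iff[OF A h(1) that] w_eq by simp
    ultimately show ?thesis using c h(2) by blast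
  qed
  have S_iff: "w \<in> S \<longleftrightarrow> legendre_at Q L c w" if "c \<in> Q" "w \<in> cdom (HMR_chart Q c)" for c w
    using iffs[OF that] by simp
  have eq: "S = carrier (HMR Q) \<inter> alpha0 Q -` im_d (TQR Q) L"
  proof -
    have "w \<in> S \<longleftrightarrow> alpha0 Q w \<in> im_d (TQR Q) L" if "w \<in> carrier (HMR Q)" for w
      using that iffs by (auto simp: carrier_def HMR_eq)
    then show ?thesis using S_sub by auto
  qed
  have lagr: "lagrangian_submanifold (HMR Q) (omega_eta Q) S"
    unfolding lagrangian_submanifold_def
  proof (intro conjI exI[of _ "2 * DIM('e) + 1"] ballI)
    show "2 * (2 * DIM('e) + 1) = DIM('e \<times> 'e \<times> real \<times> 'e \<times> 'e \<times> real)" by simp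
    show "embedded_submanifold (HMR Q) (2 * DIM('e) + 1) S"
      by (rule submanifold_embedded[OF A L S_sub S_iff])
    show "omega_eta Q v w = 0" if "x \<in> S" "v \<in> tangent_to (HMR Q) S x" "w \<in> tangent_to (HMR Q) S x" for x v w
      by (rule submanifold_isotropic[OF A L S_sub _ that]) (simp add: S_iff)
  qed
  have coords: "cmap (TMR_chart Q c) ` (S \<inter> cdom (TMR_chart Q c)) =
               {((((x, Lv), z), ((xd, Lz *\<^sub>R Lv + Lx), zd)), - Lz) | x xd z zd Lx Lv Lz.
                  x \<in> cmap c ` cdom c \<and>
                  (GDERIV (L \<circ> cinv (TQR_chart Q c)) ((x, xd), z) :> ((Lx, Lv), Lz)) \<and>
                  zd = xd \<bullet> Lv}" (is "?l = ?r") if c: "c \<in> Q" for c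
  proof (intro equalityI subsetI)
    fix Y assume "Y \<in> ?l"
    then obtain w where w: "w \<in> S" "w \<in> cdom (TMR_chart Q c)" "Y = cmap (TMR_chart Q c) w" by auto
    obtain q \<xi> z V u where w_eq: "w = ((((q, \<xi>), z), V), u)" by (metis prod.collapse)
    obtain xd pd zd where V: "V (M_chart Q c) = ((xd, pd), zd)" by (metis prod.collapse)
    have q: "q \<in> cdom c" using w(2) by (simp add: w_eq)
    have h: "(((q, \<xi>), z), V) \<in> HM_set Q" using w(1) S_sub carrier_HMR w_eq by blast
    have wc: "w \<in> cdom (HMR_chart Q c)" using h w(2) by (simp add: w_eq)
    have "GDERIV (L \<circ> cinv (TQR_chart Q c)) ((cmap c q, xd), z) :> ((u *\<^sub>R \<xi> c + pd, \<xi> c), - u)"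
      using S_iff[OF c wc] w(1) by (simp add: legendre_at_def w_eq V)
    moreover have "zd = xd \<bullet> \<xi> c"
      using HM_set_iff[OF A c q, of \<xi> z V] h V by (simp add: inner_commute)
    moreover have "Y = ((((cmap c q, \<xi> c), z), ((xd, (- u) *\<^sub>R \<xi> c + (u *\<^sub>R \<xi> c + pd)), zd)), - (- u))"
      by (simp add: w(3) w_eq V)
    ultimately show "Y \<in> ?r" using q by blast
  next
    fix Y assume "Y \<in> ?r"
    then obtain q xd z Lx Lv Lz where Y: "Y = ((((cmap c q, Lv), z), ((xd, Lz *\<^sub>R Lv + Lx), xd \<bullet> Lv)), - Lz)"
      and q: "q \<in> cdom c"
      and G: "GDERIV (L \<circ> cinv (TQR_chart Q c)) ((cmap c q, xd), z) :> ((Lx, Lv), Lz)"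
      by blast
    obtain \<xi> V where h: "(((q, \<xi>), z), V) \<in> HM_set Q" "\<xi> c = Lv"
      "V (M_chart Q c) = ((xd, Lz *\<^sub>R Lv + Lx), Lv \<bullet> xd)"
      using HMR_point_exists[OF A c q] by blast
    let ?w = "((((q, \<xi>), z), V), - Lz)"
    note t = HM_setD[OF h(1)]
    have w: "?w \<in> cdom (HMR_chart Q c)" "?w \<in> cdom (TMR_chart Q c)"
      using h(1) t q cotangent_of_contactM_tangent[OF t] by auto
    have "?w \<in> S" unfolding S_iff[OF c w(1)] using G by (simp add: legendre_at_def h)
    moreover have "cmap (TMR_chart Q c) ?w = Y" by (simp add: Y h inner_commute)
    ultimately show "Y \<in> ?l" using w(2) by blast
  qed
  show ?thesis
    unfolding Let_def S_def[symmetric] using eq lagr coords by blast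
qed

end
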